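(* Let $L\geq 1$, let $s_1,\dots,s_L\in\{1/2,1,3/2,\dots\}$ and let $J_{x,x+1}>0$ for $x=1,\dots,L-1$. On $\mathcal{H}=\bigotimes_{x=1}^L\mathbb{C}^{2s_x+1}$ consider $$H=-\sum_{x=1}^{L-1}J_{x,x+1}\Big(\frac{1}{s_xs_{x+1}}\vec S_x\cdot\vec S_{x+1}-1\Big).$$ Then $H$ has the ferromagnetic ordering of energy levels (FOEL) property: for all admissible total spins $S,S'$ with $S'<S$ one has $E(H,S)<E(H,S')$.
   Context: $S^i_x$ ($i=1,2,3$) denote the standard spin-$s_x$ matrices (generators of the irreducible representation $D^{(s_x)}$ of $SU(2)$) acting on the $x$-th tensor factor, and $\vec S_x\cdot\vec S_y=\sum_{i=1}^3 S^i_xS^i_y$. The total spin operators are $S^i=\sum_x S^i_x$, and the Casimir $C=\sum_i (S^i)^2$ commutes with $H$. The eigenvalues of $C$ are $S(S+1)$ with $S$ ranging over $S_{\min},S_{\min}+1,\dots,S_{\max}=\sum_x s_x$ (the spin labels occurring in the decomposition of $\bigotimes_x D^{(s_x)}$ into irreducibles); $\mathcal{H}^{(S)}$ denotes the eigenspace of $C$ for eigenvalue $S(S+1)$, an invariant subspace of $H$. For a Hermitian $H$ leaving all $\mathcal H^{(S)}$ invariant, $E(H,S)=\min\operatorname{spec}(H|_{\mathcal H^{(S)}})$. FOEL means $E(H,S)<E(H,S')$ whenever $S'<S$, for all $S,S'\in[S_{\min},S_{\max}]$ with $\mathcal H^{(S)},\mathcal H^{(S')}\neq\{0\}$. *)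

theory Defs
  imports Complex_Main
begin

text \<open>Spin chain of L sites labelled 1..L. Site x carries spin s_x = n x / 2
  (n x = 2 s_x \<ge> 1). The local basis at site x is indexed by a \<in> {0..n x},
  corresponding to the magnetic quantum number m = s_x - a.
  A basis vector of the tensor product is a configuration c :: nat \<Rightarrow> nat with
  c x \<le> n x for x \<in> {1..L} and c x = 0 otherwise; a state is a complex
  function on configurations vanishing outside the configuration set.\<close>

type_synonym state = "(nat \<Rightarrow> nat) \<Rightarrow> complex"

definition conf :: "nat \<Rightarrow> (nat \<Rightarrow> nat) \<Rightarrow> (nat \<Rightarrow> nat) set" where
  "conf L n = {c. \<forall>x. (x \<in> {1..L} \<longrightarrow> c x \<le> n x) \<and> (x \<notin> {1..L} \<longrightarrow> c x = 0)}"

definition in_space :: "nat \<Rightarrow> (nat \<Rightarrow> nat) \<Rightarrow> state \<Rightarrow> bool" where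
  "in_space L n v \<longleftrightarrow> (\<forall>c. c \<notin> conf L n \<longrightarrow> v c = 0)"

definition spin_plus :: "nat \<Rightarrow> nat \<Rightarrow> nat \<Rightarrow> complex" where
  "spin_plus N a b = (let s = real N / 2; m = s - real b in
     if a + 1 = b then complex_of_real (sqrt (s * (s + 1) - m * (m + 1))) else 0)"

definition spin_minus :: "nat \<Rightarrow> nat \<Rightarrow> nat \<Rightarrow> complex" where
  "spin_minus N a b = (let s = real N / 2; m = s - real b in
     if a = b + 1 then complex_of_real (sqrt (s * (s + 1) - m * (m - 1))) else 0)"

definition spin_mat :: "nat \<Rightarrow> nat \<Rightarrow> nat \<Rightarrow> nat \<Rightarrow> complex" where
  "spin_mat N i a b =
     (if i = 1 then (spin_plus N a b + spin_minus N a b) / 2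
      else if i = 2 then (spin_plus N a b - spin_minus N a b) / (2 * \<i>)
      else if i = 3 then (if a = b then complex_of_real (real N / 2 - real b) else 0)
      else 0)"

definition site_op :: "nat \<Rightarrow> (nat \<Rightarrow> nat) \<Rightarrow> nat \<Rightarrow> nat \<Rightarrow> state \<Rightarrow> state" where
  "site_op L n i x v = (\<lambda>c. if c \<in> conf L n
      then (\<Sum>b\<in>{..n x}. spin_mat (n x) i (c x) b * v (c(x := b))) else 0)"

definition spin_dot :: "nat \<Rightarrow> (nat \<Rightarrow> nat) \<Rightarrow> nat \<Rightarrow> nat \<Rightarrow> state \<Rightarrow> state" where
  "spin_dot L n x y v = (\<lambda>c. \<Sum>i\<in>{1,2,3}. site_op L n i x (site_op L n i y v) c)"

definition hamiltonian :: "nat \<Rightarrow> (nat \<Rightarrow> nat) \<Rightarrow> (nat \<Rightarrow> real) \<Rightarrow> state \<Rightarrow> state" where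
  "hamiltonian L n J v = (\<lambda>c. - (\<Sum>x\<in>{1..<L}. complex_of_real (J x) *
      (complex_of_real (1 / ((real (n x) / 2) * (real (n (x + 1)) / 2))) * spin_dot L n x (x + 1) v c
       - v c)))"

definition total_spin :: "nat \<Rightarrow> (nat \<Rightarrow> nat) \<Rightarrow> nat \<Rightarrow> state \<Rightarrow> state" where
  "total_spin L n i v = (\<lambda>c. \<Sum>x\<in>{1..L}. site_op L n i x v c)"

definition casimir :: "nat \<Rightarrow> (nat \<Rightarrow> nat) \<Rightarrow> state \<Rightarrow> state" where
  "casimir L n v = (\<lambda>c. \<Sum>i\<in>{1,2,3}. total_spin L n i (total_spin L n i v) c)"

definition spin_space :: "nat \<Rightarrow> (nat \<Rightarrow> nat) \<Rightarrow> real \<Rightarrow> state set" where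
  "spin_space L n S = {v. in_space L n v \<and>
      casimir L n v = (\<lambda>c. complex_of_real (S * (S + 1)) * v c)}"

definition energy :: "nat \<Rightarrow> (nat \<Rightarrow> nat) \<Rightarrow> (state \<Rightarrow> state) \<Rightarrow> real \<Rightarrow> real" where
  "energy L n H S = Inf {e::real. \<exists>v\<in>spin_space L n S. v \<noteq> (\<lambda>c. 0) \<and>
      H v = (\<lambda>c. complex_of_real e * v c)}"

text \<open>FOEL: E(H,S) < E(H,S') whenever S' < S and both eigenspaces are nonzero.
  Spin labels are S \<ge> 0 (a nonzero H^(S) with S \<ge> 0 is exactly an admissible label).\<close>
definition FOEL :: "nat \<Rightarrow> (nat \<Rightarrow> nat) \<Rightarrow> (state \<Rightarrow> state) \<Rightarrow> bool" where
  "FOEL L n H \<longleftrightarrow> (\<forall>S S'. 0 \<le> S' \<and> S' < S \<and>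
      spin_space L n S \<noteq> {\<lambda>c. 0} \<and> spin_space L n S' \<noteq> {\<lambda>c. 0} \<longrightarrow>
      energy L n H S < energy L n H S')"

end

theory Submission
  imports Defs "HOL-Library.Multiset"
begin

text \<open>A spin \<open>N/2\<close> is realised on the polynomials of degree at most \<open>N\<close> in one variable, with \<open>S\<^sup>+ = \<partial>\<close>. The
  highest weight vectors with \<open>n\<close> spin deviations, which carry the total spin \<open>\<Sum> N x / 2 - n\<close>, are the
  translation invariant homogeneous polynomials of degree \<open>n\<close>. They are spanned by the products of \<open>n\<close>
  differences \<open>z\<^sub>a - z\<^sub>b\<close>, \<open>a < b\<close>, of degree at most \<open>N x\<close> in each \<open>z\<^sub>x\<close>. A constant minus the
  Hamiltonian preserves the cone generated by these products and is irreducible on it, so a Perron-Frobenius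
  argument yields a ground state \<open>E(N, n)\<close> in the interior of the cone.

  The chain is now built up by adding half-spins to its last site (or to a new one). If \<open>N'\<close> arises from
  \<open>N\<close> in this way, then the Hamiltonian decreases with respect to the cone, whence \<open>E(N', n) < E(N, n)\<close> for
  \<open>n \<ge> 1\<close> by a Collatz-Wielandt comparison. On the other hand the Hamiltonian of \<open>N'\<close> is bounded below by a
  compression of that of \<open>N\<close> with a decoupled half-spin, so \<open>E(N', n + 1) \<ge> min (E(N, n)) (E(N, n + 1))\<close>.
  By induction this minimum is \<open>E(N, n)\<close>, and therefore \<open>E(N', n) < E(N', n + 1)\<close>.\<close>

text \<open>The products of differences are linearly dependent, by identities such as (z_a -
  z_c)(z_b - z_d) = (z_a - z_b)(z_c - z_d) + (z_a - z_d)(z_b - z_c). The cone is therefore no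
  orthant, and positivity of matrix entries in a basis is replaced by the order of the cone. What
  makes this order usable is a functional that is positive on all generators, and one configuration
  that lies above all generators and is reached from each of them. The three-term identities
  themselves show that it lies above. Growth at the right end gives the comparison its sign: arcs
  end at the last occupied site and none starts there, so shifting an end from x to x + 1 changes a
  product by a generator. The normalisation 1 / (s s') matters for the opposite estimate: compressed
  to the longer spin, a spin operator of length N / 2 shrinks by the factor N / (N + 1), which is
  exactly the change of the coupling. The step from n = 0 to n = 1 lies outside the comparison, as
  E(N, 0) = 0 for every chain; there the energy is a discrete Dirichlet form.\<close>

declare [[coercion_enabled = false]]

section \<open>Coordinate vectors and compactness\<close>

typedef 'i vec = "UNIV :: ('i \<Rightarrow> real) set"
  morphisms coef Vec by blast

setup_lifting type_definition_vec

lemma coef_Vec [simp]: "coef (Vec f) = f"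
  by (simp add: Vec_inverse)

lemma vec_eq_iff: "f = g \<longleftrightarrow> (\<forall>c. coef f c = coef g c)"
  by (metis coef_inject ext)

instantiation vec :: (type) real_vector
begin

lift_definition zero_vec :: "'a vec" is "\<lambda>_. 0" .
lift_definition plus_vec :: "'a vec \<Rightarrow> 'a vec \<Rightarrow> 'a vec" is "\<lambda>f g c. f c + g c" .
lift_definition minus_vec :: "'a vec \<Rightarrow> 'a vec \<Rightarrow> 'a vec" is "\<lambda>f g c. f c - g c" .
lift_definition uminus_vec :: "'a vec \<Rightarrow> 'a vec" is "\<lambda>f c. - f c" .
lift_definition scaleR_vec :: "real \<Rightarrow> 'a vec \<Rightarrow> 'a vec" is "\<lambda>r f c. r * f c" .

instance
  by standard (transfer; simp add: fun_eq_iff algebra_simps)+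

end

lemma coef_simps [simp]:
  "coef 0 c = 0" "coef (f + g) c = coef f c + coef g c" "coef (f - g) c = coef f c - coef g c"
  "coef (- f) c = - coef f c" "coef (r *\<^sub>R f) c = r * coef f c"
  by (transfer; simp)+

lemma coef_sum [simp]: "coef (\<Sum>i\<in>I. f i) c = (\<Sum>i\<in>I. coef (f i) c)"
  by (induction I rule: infinite_finite_induct) auto

text \<open>Successive extraction: a bounded real sequence has a monotone, hence convergent,
  subsequence, and thinning out keeps the limits already obtained. It serves for minimising
  sequences and for the coefficients of cone elements.\<close>

lemma bounded_subseq_convergent:
  fixes a :: "nat \<Rightarrow> 'i \<Rightarrow> real"
  assumes "finite I" and "\<And>m i. i \<in> I \<Longrightarrow> \<bar>a m i\<bar> \<le> B"
  shows "\<exists>r l. strict_mono (r :: nat \<Rightarrow> nat) \<and> (\<forall>i\<in>I. (\<lambda>m. a (r m) i) \<longlonglongrightarrow> l i)"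
  using assms
proof (induction I rule: finite_induct)
  case empty
  show ?case by (rule exI[of _ id]) (auto simp: strict_mono_def)
next
  case (insert j I)
  then obtain r l where r: "strict_mono r" and l: "\<forall>i\<in>I. (\<lambda>m. a (r m) i) \<longlonglongrightarrow> l i"
    by auto
  have bd: "Bseq (\<lambda>m. a (r m) j)"
    by (rule BseqI'[of _ B]) (use insert.prems in auto)
  obtain q where q: "strict_mono q" "monoseq (\<lambda>m. a (r (q m)) j)"
    using seq_monosub[of "\<lambda>m. a (r m) j"] by blast
  have "convergent (\<lambda>m. a (r (q m)) j)"
    by (rule Bseq_monoseq_convergent[OF Bseq_subseq[OF bd] q(2)])
  then obtain x where x: "(\<lambda>m. a (r (q m)) j) \<longlonglongrightarrow> x"
    by (auto simp: convergent_def)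
  have "(\<lambda>m. a (r (q m)) i) \<longlonglongrightarrow> (l(j := x)) i" if "i \<in> insert j I" for i
  proof (cases "i = j")
    case False
    then have "(\<lambda>m. a (r m) i) \<longlonglongrightarrow> l i" using l that by auto
    from LIMSEQ_subseq_LIMSEQ[OF this q(1)] show ?thesis
      using False by (simp add: o_def)
  qed (use x in simp)
  then show ?case
    using strict_mono_o[OF r q(1)] by (intro exI[of _ "r \<circ> q"] exI[of _ "l(j := x)"]) (simp add: o_def)
qed

section \<open>Symmetric operators on a weighted space\<close>

text \<open>The form \<open>ip\<close> sees only the coordinates in \<open>C\<close>; it is definite
  on \<open>supp\<close>, not on all vectors.\<close>

locale finite_weights =
  fixes C :: "'i set" and w :: "'i \<Rightarrow> real"
  assumes finite_C: "finite C" and w_pos: "c \<in> C \<Longrightarrow> 0 < w c"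
begin

definition ip :: "'i vec \<Rightarrow> 'i vec \<Rightarrow> real" where
  "ip f g = (\<Sum>c\<in>C. w c * coef f c * coef g c)"

definition supp :: "'i vec set" where
  "supp = {f. \<forall>c. c \<notin> C \<longrightarrow> coef f c = 0}"

lemma ip_commute: "ip f g = ip g f"
  by (simp add: ip_def mult_ac)

lemma ip_add_left: "ip (f + g) h = ip f h + ip g h"
  by (simp add: ip_def algebra_simps sum.distrib)

lemma ip_add_right: "ip h (f + g) = ip h f + ip h g"
  by (simp add: ip_def algebra_simps sum.distrib)

lemma ip_scale_left: "ip (a *\<^sub>R f) g = a * ip f g"
  by (simp add: ip_def sum_distrib_left mult_ac)

lemma ip_scale_right: "ip f (a *\<^sub>R g) = a * ip f g"
  by (simp add: ip_def sum_distrib_left mult_ac)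

lemma ip_minus_left: "ip (- f) g = - ip f g"
  by (simp add: ip_def sum_negf)

lemma ip_minus_right: "ip f (- g) = - ip f g"
  by (simp add: ip_def sum_negf)

lemma ip_diff_left: "ip (f - g) h = ip f h - ip g h"
  by (simp add: ip_def algebra_simps sum_subtractf)

lemma ip_diff_right: "ip h (f - g) = ip h f - ip h g"
  by (simp add: ip_def algebra_simps sum_subtractf)

lemma ip_zero [simp]: "ip 0 f = 0" "ip f 0 = 0"
  by (simp_all add: ip_def)

lemma ip_sum_right:
  fixes g :: "'j \<Rightarrow> 'i vec"
  shows "ip f (\<Sum>i\<in>I. g i) = (\<Sum>i\<in>I. ip f (g i))"
  by (induction I rule: infinite_finite_induct) (simp_all add: ip_def algebra_simps sum.distrib)

lemmas ip_simps = ip_add_left ip_add_right ip_scale_left ip_scale_right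
  ip_minus_left ip_minus_right ip_diff_left ip_diff_right

lemma ip_self_nonneg: "0 \<le> ip f f"
  unfolding ip_def by (intro sum_nonneg) (use w_pos in \<open>force simp: mult.assoc\<close>)

lemma coordinate_le: "c \<in> C \<Longrightarrow> w c * (coef f c)\<^sup>2 \<le> ip f f"
  unfolding ip_def power2_eq_square mult.assoc[symmetric]
  by (rule member_le_sum) (use w_pos finite_C in \<open>force simp: mult.assoc\<close>)+

lemma ip_self_zero: "f \<in> supp \<Longrightarrow> ip f f = 0 \<longleftrightarrow> f = 0"
proof
  assume f: "f \<in> supp" "ip f f = 0"
  have "coef f c = 0" for c
  proof (cases "c \<in> C")
    case True
    then show ?thesis using coordinate_le[OF True, of f] f(2) w_pos[OF True]
      by (metis dual_order.irrefl mult_pos_pos order_less_le_trans zero_less_power2)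
  qed (use f in \<open>auto simp: supp_def\<close>)
  then show "f = 0" by (simp add: vec_eq_iff)
qed simp

lemma ip_self_pos: "f \<in> supp \<Longrightarrow> f \<noteq> 0 \<Longrightarrow> 0 < ip f f"
  using ip_self_nonneg[of f] ip_self_zero[of f] by linarith

definition unit_vec :: "'i \<Rightarrow> 'i vec" where
  "unit_vec c = Vec (\<lambda>d. if d = c then 1 else 0)"

lemma supp_expand:
  assumes "f \<in> supp"
  shows "f = (\<Sum>c\<in>C. coef f c *\<^sub>R unit_vec c)"
  using assms finite_C
  by (auto simp: vec_eq_iff unit_vec_def supp_def if_distrib sum.delta cong: if_cong)

lemma linear_expand:
  fixes \<phi> :: "'i vec \<Rightarrow> real"
  assumes "linear \<phi>" "f \<in> supp"
  shows "\<phi> f = (\<Sum>c\<in>C. coef f c * \<phi> (unit_vec c))"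
  by (subst supp_expand[OF assms(2)]) (simp add: linear_sum[OF assms(1)] linear_scale[OF assms(1)])

lemma coordinate_bound: "\<exists>B\<ge>0. \<forall>f\<in>supp. \<forall>c. \<bar>coef f c\<bar> \<le> B * sqrt (ip f f)"
\<comment> \<open>The sum of all 1 / sqrt (w c) replaces their maximum and is also meaningful for
  empty \<open>C\<close>.\<close>
proof (intro exI[of _ "\<Sum>c\<in>C. 1 / sqrt (w c)"] conjI ballI allI)
  show nonneg: "0 \<le> (\<Sum>c\<in>C. 1 / sqrt (w c))"
    by (intro sum_nonneg) (use w_pos in \<open>force intro: less_imp_le\<close>)
  fix f c assume f: "f \<in> supp"
  show "\<bar>coef f c\<bar> \<le> (\<Sum>c\<in>C. 1 / sqrt (w c)) * sqrt (ip f f)"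
  proof (cases "c \<in> C")
    case True
    have "sqrt (w c) * \<bar>coef f c\<bar> = sqrt (w c * (coef f c)\<^sup>2)"
      by (simp add: real_sqrt_mult)
    also have "\<dots> \<le> sqrt (ip f f)" using coordinate_le[OF True] by simp
    finally have "\<bar>coef f c\<bar> \<le> 1 / sqrt (w c) * sqrt (ip f f)"
      using w_pos[OF True] by (simp add: field_simps)
    also have "1 / sqrt (w c) \<le> (\<Sum>c\<in>C. 1 / sqrt (w c))"
      by (rule member_le_sum) (use True w_pos finite_C in \<open>auto intro: less_imp_le\<close>)
    finally show ?thesis using ip_self_nonneg[of f] by (simp add: mult_right_mono)
  next
    case False
    then show ?thesis using f nonneg ip_self_nonneg[of f] by (simp add: supp_def)
  qed
qed

lemma linear_bound:
  fixes \<phi> :: "'i vec \<Rightarrow> real"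
  assumes "linear \<phi>"
  shows "\<exists>B\<ge>0. \<forall>f\<in>supp. \<bar>\<phi> f\<bar> \<le> B * sqrt (ip f f)"
proof -
  obtain B where B: "B \<ge> 0" "\<And>f c. f \<in> supp \<Longrightarrow> \<bar>coef f c\<bar> \<le> B * sqrt (ip f f)"
    using coordinate_bound by blast
  let ?d = "\<lambda>c. \<bar>\<phi> (unit_vec c)\<bar>"
  have "\<bar>\<phi> f\<bar> \<le> (\<Sum>c\<in>C. B * ?d c) * sqrt (ip f f)" if f: "f \<in> supp" for f
  proof -
    have "\<bar>\<phi> f\<bar> \<le> (\<Sum>c\<in>C. \<bar>coef f c\<bar> * ?d c)"
      unfolding linear_expand[OF assms f] by (rule order.trans[OF sum_abs]) (simp add: abs_mult)
    also have "\<dots> \<le> (\<Sum>c\<in>C. (B * sqrt (ip f f)) * ?d c)"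
      by (intro sum_mono mult_right_mono B f) auto
    finally show ?thesis by (simp add: sum_distrib_left sum_distrib_right mult_ac)
  qed
  then show ?thesis using B(1) by (intro exI[of _ "\<Sum>c\<in>C. B * ?d c"]) (auto intro!: sum_nonneg)
qed

lemma linear_tendsto:
  fixes \<phi> :: "'i vec \<Rightarrow> real"
  assumes "linear \<phi>" "\<And>m. u m \<in> supp" "l \<in> supp" "\<And>c. (\<lambda>m. coef (u m) c) \<longlonglongrightarrow> coef l c"
  shows "(\<lambda>m. \<phi> (u m)) \<longlonglongrightarrow> \<phi> l"
  unfolding linear_expand[OF assms(1) assms(2)] linear_expand[OF assms(1) assms(3)]
  by (intro tendsto_intros assms)

end

section \<open>Variational characterisation of the lowest eigenvalue\<close>

lemma quadratic_discriminant:
  fixes a b c :: real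
  assumes "\<And>t. 0 \<le> a + 2 * t * b + t\<^sup>2 * c"
  shows "b\<^sup>2 \<le> a * c"
proof (cases "c = 0")
  case True
  have "b = 0"
  proof (rule ccontr)
    assume "b \<noteq> 0"
    \<comment> \<open>At this t the linear function takes the value -1.\<close>
    then show False using assms[of "- (a + 1) / (2 * b)"] True by (simp add: field_simps)
  qed
  then show ?thesis using True by simp
next
  case False
  have "c \<ge> 0"
  proof (rule ccontr)
    assume c: "\<not> c \<ge> 0"
    \<comment> \<open>Chosen so that t \<ge> 1 and t |c| exceeds |a| + 2 |b|; the negative quadratic
      term then outweighs the others.\<close>
    define t where "t = (\<bar>a\<bar> + 1 + 2 * \<bar>b\<bar>) / \<bar>c\<bar> + 1"
    have t: "t \<ge> 1" unfolding t_def by simp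
    have "t * \<bar>c\<bar> = \<bar>a\<bar> + 1 + 2 * \<bar>b\<bar> + \<bar>c\<bar>" using False by (simp add: t_def field_simps)
    then have "t * (t * \<bar>c\<bar>) \<ge> t * (\<bar>a\<bar> + 1 + 2 * \<bar>b\<bar>)" using t by (intro mult_left_mono) auto
    moreover have "t * (\<bar>a\<bar> + 1) \<ge> \<bar>a\<bar> + 1" using mult_right_mono[OF t, of "\<bar>a\<bar> + 1"] by simp
    moreover have "t * b \<le> t * \<bar>b\<bar>" using t by (intro mult_left_mono) auto
    ultimately show False using assms[of t] c by (simp add: power2_eq_square algebra_simps)
  qed
  then have "c > 0" using False by simp
  then show ?thesis using assms[of "- b / c"] by (simp add: field_simps power2_eq_square)
qed

text \<open>\<open>V\<close> will be a space of highest weight vectors inside a larger coordinate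
  space, so symmetry and invariance are asked on \<open>V\<close> alone. \<open>V_closed\<close>
  keeps limits of minimising sequences in \<open>V\<close>.\<close>

locale symmetric_operator = finite_weights C w for C :: "'i set" and w +
  fixes T :: "'i vec \<Rightarrow> 'i vec" and V :: "'i vec set"
  assumes linear_T: "linear T"
    and subspace_V: "subspace V"
    and V_supp: "V \<subseteq> supp"
    and V_closed: "\<And>(u :: nat \<Rightarrow> 'i vec) l.
      (\<And>m. u m \<in> V) \<Longrightarrow> (\<And>c. (\<lambda>m. coef (u m) c) \<longlonglongrightarrow> coef l c) \<Longrightarrow> l \<in> V"
    and T_V: "\<And>v. v \<in> V \<Longrightarrow> T v \<in> V"
    and T_sym: "\<And>u v. u \<in> V \<Longrightarrow> v \<in> V \<Longrightarrow> ip u (T v) = ip (T u) v"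
begin

lemmas T_simps = linear_add[OF linear_T] linear_scale[OF linear_T] linear_diff[OF linear_T]
  linear_sum[OF linear_T]

lemma linear_coordinate: "linear (\<lambda>u. coef (T u) c)"
  by (intro linearI) (simp_all add: T_simps)

lemma form_bound: "\<exists>B\<ge>0. \<forall>u\<in>supp. \<bar>ip u (T u)\<bar> \<le> B * ip u u"
proof -
  obtain B where B: "B \<ge> 0" "\<And>f c. f \<in> supp \<Longrightarrow> \<bar>coef f c\<bar> \<le> B * sqrt (ip f f)"
    using coordinate_bound by blast
  have "\<forall>c. \<exists>D\<ge>0. \<forall>f\<in>supp. \<bar>coef (T f) c\<bar> \<le> D * sqrt (ip f f)"
    using linear_bound[OF linear_coordinate] by blast
  then obtain D where D: "\<And>c. D c \<ge> 0" "\<And>f c. f \<in> supp \<Longrightarrow> \<bar>coef (T f) c\<bar> \<le> D c * sqrt (ip f f)"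
    by metis
  have "\<bar>ip u (T u)\<bar> \<le> (\<Sum>c\<in>C. w c * B * D c) * ip u u" if u: "u \<in> supp" for u
  proof -
    have "\<bar>ip u (T u)\<bar> \<le> (\<Sum>c\<in>C. \<bar>w c * coef u c * coef (T u) c\<bar>)"
      unfolding ip_def by (rule sum_abs)
    also have "\<dots> \<le> (\<Sum>c\<in>C. w c * (B * sqrt (ip u u)) * (D c * sqrt (ip u u)))"
      using w_pos D B u ip_self_nonneg[of u] unfolding abs_mult
      by (intro sum_mono mult_mono mult_nonneg_nonneg) (auto intro: less_imp_le)
    also have "\<dots> = (\<Sum>c\<in>C. w c * B * D c * (sqrt (ip u u) * sqrt (ip u u)))"
      by (intro sum.cong) (auto simp: mult_ac)
    also have "\<dots> = (\<Sum>c\<in>C. w c * B * D c) * ip u u"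
      using ip_self_nonneg[of u] by (simp add: sum_distrib_right)
    finally show ?thesis .
  qed
  moreover have "(\<Sum>c\<in>C. w c * B * D c) \<ge> 0"
    using w_pos D B by (intro sum_nonneg mult_nonneg_nonneg) (auto intro: less_imp_le)
  ultimately show ?thesis by blast
qed

text \<open>Minimisation of the Rayleigh quotient over \<open>V\<close>: unit vectors of nearly
  minimal energy have a coordinatewise limit, which attains the infimum, and variation in the
  direction of its residual shows that it is an eigenvector.\<close>

lemma ground_state_exists:
  assumes v0: "v0 \<in> V" "v0 \<noteq> 0"
  shows "\<exists>e. (\<exists>v\<in>V. v \<noteq> 0 \<and> T v = e *\<^sub>R v) \<and> (\<forall>u\<in>V. e * ip u u \<le> ip u (T u))"
proof -
  define R where "R = {ip u (T u) |u. u \<in> V \<and> ip u u = 1}"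
  have normalise: "\<exists>s>0. (s *\<^sub>R u) \<in> V \<and> ip (s *\<^sub>R u) (s *\<^sub>R u) = 1 \<and> s\<^sup>2 * ip u u = 1"
    if "u \<in> V" "u \<noteq> 0" for u
  proof (intro exI[of _ "1 / sqrt (ip u u)"] conjI)
    have p: "ip u u > 0" using ip_self_pos that V_supp by auto
    then show "0 < 1 / sqrt (ip u u)" by simp
    show "(1 / sqrt (ip u u)) *\<^sub>R u \<in> V" using that subspace_V by (simp add: subspace_scale)
    show "ip ((1 / sqrt (ip u u)) *\<^sub>R u) ((1 / sqrt (ip u u)) *\<^sub>R u) = 1"
      using p by (simp add: ip_simps)
    show "(1 / sqrt (ip u u))\<^sup>2 * ip u u = 1" using p by (simp add: power_divide)
  qed
  obtain B where B: "B \<ge> 0" "\<And>u. u \<in> supp \<Longrightarrow> \<bar>ip u (T u)\<bar> \<le> B * ip u u"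
    using form_bound by blast
  have bdd: "bdd_below R"
    unfolding R_def using B(2) V_supp by (intro bdd_belowI[of _ "- B"]) force
  have ne: "R \<noteq> {}" unfolding R_def using normalise[OF v0] by blast
  define e where "e = Inf R"
  have e_le: "e * ip u u \<le> ip u (T u)" if u: "u \<in> V" for u
  proof (cases "u = 0")
    case False
    then obtain s where s: "s > 0" "(s *\<^sub>R u) \<in> V" "ip (s *\<^sub>R u) (s *\<^sub>R u) = 1" "s\<^sup>2 * ip u u = 1"
      using normalise[OF u] by blast
    then have "e \<le> ip (s *\<^sub>R u) (T (s *\<^sub>R u))"
      unfolding e_def by (intro cInf_lower bdd) (auto simp: R_def)
    also have "\<dots> = s\<^sup>2 * ip u (T u)" by (simp add: T_simps ip_simps power2_eq_square)
    finally have "e * (s\<^sup>2 * ip u u) \<le> s\<^sup>2 * ip u (T u)" using s(4) by simp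
    then have "s\<^sup>2 * (e * ip u u) \<le> s\<^sup>2 * ip u (T u)" by (simp add: mult_ac)
    then show ?thesis using s(1) by simp
  qed simp
  have "\<forall>m::nat. \<exists>u\<in>V. ip u u = 1 \<and> ip u (T u) < e + inverse (real (Suc m))"
  proof
    fix m :: nat
    obtain y where "y \<in> R" "y < e + inverse (real (Suc m))"
      using cInf_lessD[OF ne, of "e + inverse (real (Suc m))"] unfolding e_def by auto
    then show "\<exists>u\<in>V. ip u u = 1 \<and> ip u (T u) < e + inverse (real (Suc m))"
      by (auto simp: R_def)
  qed
  then obtain u where u: "\<And>m. u m \<in> V" "\<And>m. ip (u m) (u m) = 1"
    "\<And>m. ip (u m) (T (u m)) < e + inverse (real (Suc m))"
    by metis
  obtain B' where B': "B' \<ge> 0" "\<And>f c. f \<in> supp \<Longrightarrow> \<bar>coef f c\<bar> \<le> B' * sqrt (ip f f)"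
    using coordinate_bound by blast
  have "\<bar>coef (u m) c\<bar> \<le> B'" for m c
    using B'(2)[of "u m" c] u(1,2) V_supp by force
  then obtain r l where r: "strict_mono (r :: nat \<Rightarrow> nat)"
    and l: "\<forall>c\<in>C. (\<lambda>m. coef (u (r m)) c) \<longlonglongrightarrow> l c"
    using bounded_subseq_convergent[OF finite_C, of "\<lambda>m. coef (u m)" B'] by blast
  define v where "v = Vec (\<lambda>c. if c \<in> C then l c else 0)"
  have lim: "(\<lambda>m. coef (u (r m)) c) \<longlonglongrightarrow> coef v c" for c
  proof (cases "c \<in> C")
    case True
    then show ?thesis using l by (simp add: v_def)
  next
    case False
    then have "coef (u m) c = 0" for m using u(1)[of m] V_supp by (auto simp: supp_def)
    then show ?thesis using False by (simp add: v_def)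
  qed
  have vV: "v \<in> V" by (rule V_closed[OF _ lim]) (use u in auto)
  have Tlim: "(\<lambda>m. coef (T (u (r m))) c) \<longlonglongrightarrow> coef (T v) c" for c
    by (rule linear_tendsto[OF linear_coordinate]) (use u vV V_supp lim in auto)
  have "(\<lambda>m. ip (u (r m)) (u (r m))) \<longlonglongrightarrow> ip v v"
    unfolding ip_def by (intro tendsto_intros lim)
  then have vv: "ip v v = 1" using u(2) by (simp add: LIMSEQ_const_iff)
  have lim1: "(\<lambda>m. ip (u (r m)) (T (u (r m)))) \<longlonglongrightarrow> ip v (T v)"
    unfolding ip_def by (intro tendsto_intros lim Tlim)
  have lim2: "(\<lambda>m. e + inverse (real (Suc (r m)))) \<longlonglongrightarrow> e + 0"
    using LIMSEQ_subseq_LIMSEQ[OF LIMSEQ_inverse_real_of_nat r]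
    by (intro tendsto_intros) (simp add: o_def)
  have ve: "ip v (T v) \<le> e"
  proof -
    have "ip (u (r m)) (T (u (r m))) \<le> e + inverse (real (Suc (r m)))" for m
      using u(3)[of "r m"] by simp
    then have "ip v (T v) \<le> e + 0" by (intro LIMSEQ_le[OF lim1 lim2]) auto
    then show ?thesis by simp
  qed
  define h where "h = T v - e *\<^sub>R v"
  have hV: "h \<in> V" unfolding h_def using vV T_V subspace_V by (simp add: subspace_diff subspace_scale)
  \<comment> \<open>The constant term is at most 0 because \<open>v\<close> attains the infimum, and
    the linear coefficient is the squared norm of the residual. Nonnegativity for all t forces the
    latter to vanish.\<close>
  have "0 \<le> 0 + 2 * t * ip h h + t\<^sup>2 * (ip h (T h) - e * ip h h)" for t
  proof -
    have "v + t *\<^sub>R h \<in> V" using vV hV subspace_V by (simp add: subspace_add subspace_scale)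
    from e_le[OF this] have "0 \<le> (ip v (T v) - e * ip v v) + 2 * t * (ip h (T v) - e * ip h v)
        + t\<^sup>2 * (ip h (T h) - e * ip h h)"
      using T_sym[OF vV hV] ip_commute[of "T v" h] ip_commute[of v h]
      by (simp add: T_simps ip_simps power2_eq_square algebra_simps)
    moreover have "ip h (T v) - e * ip h v = ip h h" by (simp add: h_def ip_simps)
    moreover have "ip v (T v) - e * ip v v \<le> 0" using ve vv by simp
    ultimately show ?thesis by simp
  qed
  then have "(ip h h)\<^sup>2 \<le> 0 * (ip h (T h) - e * ip h h)" by (rule quadratic_discriminant)
  then have "h = 0" using ip_self_zero hV V_supp by auto
  then have "T v = e *\<^sub>R v" by (simp add: h_def)
  moreover have "v \<noteq> 0" using vv by auto
  ultimately show ?thesis using e_le vV by blast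
qed

text \<open>Cauchy-Schwarz for the nonnegative form (u, T v), applied to u and T u, bounds |T u|^4
  by (u, T u) (T u, T T u). A bound on the form thus becomes a bound on the operator without any
  spectral decomposition.\<close>

lemma norm_bound:
  assumes "\<And>u. u \<in> V \<Longrightarrow> 0 \<le> ip u (T u)" "\<And>u. u \<in> V \<Longrightarrow> ip u (T u) \<le> \<rho> * ip u u"
    and "\<rho> \<ge> 0" "u \<in> V"
  shows "ip (T u) (T u) \<le> \<rho>\<^sup>2 * ip u u"
proof -
  have Tu: "T u \<in> V" using T_V assms by simp
  have "0 \<le> ip u (T u) + 2 * t * ip (T u) (T u) + t\<^sup>2 * ip (T u) (T (T u))" for t
    using assms(1)[of "u + t *\<^sub>R T u"] Tu assms(4) subspace_V T_sym[OF assms(4) Tu]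
    by (simp add: subspace_add subspace_scale T_simps ip_simps power2_eq_square algebra_simps)
  then have "(ip (T u) (T u))\<^sup>2 \<le> ip u (T u) * ip (T u) (T (T u))"
    by (rule quadratic_discriminant)
  also have "\<dots> \<le> (\<rho> * ip u u) * (\<rho> * ip (T u) (T u))"
    using assms Tu ip_self_nonneg by (intro mult_mono) auto
  finally have "ip (T u) (T u) * ip (T u) (T u) \<le> (\<rho>\<^sup>2 * ip u u) * ip (T u) (T u)"
    by (simp add: power2_eq_square mult_ac)
  moreover have "0 \<le> \<rho>\<^sup>2 * ip u u" using ip_self_nonneg by simp
  ultimately show ?thesis
    using ip_self_nonneg[of "T u"] by (cases "ip (T u) (T u) = 0") auto
qed

lemma iterate_V: "u \<in> V \<Longrightarrow> (T ^^ m) u \<in> V"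
  by (induction m) (auto intro: T_V)

lemma iterate_norm_bound:
  assumes "\<And>u. u \<in> V \<Longrightarrow> ip (T u) (T u) \<le> \<rho>\<^sup>2 * ip u u" "\<rho> \<ge> 0" "u \<in> V"
  shows "sqrt (ip ((T ^^ m) u) ((T ^^ m) u)) \<le> \<rho> ^ m * sqrt (ip u u)"
proof (induction m)
  case (Suc m)
  have "sqrt (ip ((T ^^ Suc m) u) ((T ^^ Suc m) u)) \<le> sqrt (\<rho>\<^sup>2 * ip ((T ^^ m) u) ((T ^^ m) u))"
    using assms(1)[OF iterate_V[OF assms(3)]] by simp
  also have "\<dots> = \<rho> * sqrt (ip ((T ^^ m) u) ((T ^^ m) u))"
    using assms(2) by (simp add: real_sqrt_mult)
  also have "\<dots> \<le> \<rho> * (\<rho> ^ m * sqrt (ip u u))" using Suc assms(2) by (rule mult_left_mono)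
  finally show ?case by (simp add: mult_ac)
qed simp

end

section \<open>Operators preserving a polyhedral cone\<close>

text \<open>Coefficients need not be unique, so arguments about the cone go through linear
  functionals or through a chosen representation.\<close>

definition cone_of :: "'j set \<Rightarrow> ('j \<Rightarrow> 'v::real_vector) \<Rightarrow> 'v set" where
  "cone_of I g = {(\<Sum>i\<in>I. a i *\<^sub>R g i) |a. \<forall>i\<in>I. 0 \<le> a i}"

lemma cone_zero [simp]: "0 \<in> cone_of I g"
  unfolding cone_of_def by (rule CollectI, rule exI[of _ "\<lambda>_. 0"]) simp

lemma cone_add: "x \<in> cone_of I g \<Longrightarrow> y \<in> cone_of I g \<Longrightarrow> x + y \<in> cone_of I g"
proof -
  assume "x \<in> cone_of I g" "y \<in> cone_of I g"
  then obtain a b where "\<forall>i\<in>I. 0 \<le> a i" "\<forall>i\<in>I. 0 \<le> b i"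
    "x = (\<Sum>i\<in>I. a i *\<^sub>R g i)" "y = (\<Sum>i\<in>I. b i *\<^sub>R g i)"
    unfolding cone_of_def by blast
  then show ?thesis
    unfolding cone_of_def
    by (intro CollectI exI[of _ "\<lambda>i. a i + b i"]) (simp add: scaleR_add_left sum.distrib)
qed

lemma cone_scale: "x \<in> cone_of I g \<Longrightarrow> 0 \<le> r \<Longrightarrow> r *\<^sub>R x \<in> cone_of I g"
proof -
  assume "x \<in> cone_of I g" and r: "0 \<le> r"
  then obtain a where "\<forall>i\<in>I. 0 \<le> a i" "x = (\<Sum>i\<in>I. a i *\<^sub>R g i)"
    unfolding cone_of_def by blast
  then show ?thesis using r
    unfolding cone_of_def
    by (intro CollectI exI[of _ "\<lambda>i. r * a i"]) (simp add: scaleR_sum_right)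
qed

lemma cone_gen: "finite I \<Longrightarrow> i \<in> I \<Longrightarrow> g i \<in> cone_of I g"
  unfolding cone_of_def
  by (rule CollectI, rule exI[of _ "\<lambda>j. if j = i then 1 else 0"])
    (simp add: if_distrib[of "\<lambda>r. r *\<^sub>R _"] sum.delta cong: if_cong)

lemma cone_sum: "(\<And>j. j \<in> A \<Longrightarrow> f j \<in> cone_of I g) \<Longrightarrow> sum f A \<in> cone_of I g"
  by (induction A rule: infinite_finite_induct) (auto intro: cone_add)

lemma cone_sum_mset: "(\<And>j. j \<in># A \<Longrightarrow> f j \<in> cone_of I g) \<Longrightarrow> (\<Sum>j\<in>#A. f j) \<in> cone_of I g"
  by (induction A) (auto intro: cone_add)

lemma cone_induct [consumes 1, case_names zero add]:
  assumes "x \<in> cone_of I g" "P 0"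
    "\<And>a i x. 0 \<le> a \<Longrightarrow> i \<in> I \<Longrightarrow> x \<in> cone_of I g \<Longrightarrow> P x \<Longrightarrow> P (a *\<^sub>R g i + x)"
  shows "P x"
proof (cases "finite I")
  case False
  \<comment> \<open>For infinite \<open>I\<close> all the sums are 0, and the cone contains 0
    only.\<close>
  then show ?thesis using assms unfolding cone_of_def by auto
next
  case True
  from assms(1) obtain a where a: "\<forall>i\<in>I. 0 \<le> a i" and x: "x = (\<Sum>i\<in>I. a i *\<^sub>R g i)"
    unfolding cone_of_def by blast
  have "P (\<Sum>i\<in>A. a i *\<^sub>R g i)" if "finite A" "A \<subseteq> I" for A
    using that
  proof (induction A rule: finite_induct)
    case (insert j A)
    have "(\<Sum>i\<in>A. a i *\<^sub>R g i) \<in> cone_of I g"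
      using insert a True by (intro cone_sum cone_scale cone_gen) auto
    then show ?case using insert a by (auto intro!: assms(3))
  qed (use assms in simp)
  then show ?thesis using True x by blast
qed

lemma cone_linear_image:
  assumes "linear T" "\<And>i. i \<in> I \<Longrightarrow> T (g i) \<in> cone_of I' g'" "x \<in> cone_of I g"
  shows "T x \<in> cone_of I' g'"
  using assms(3)
proof (induction rule: cone_induct)
  case zero
  then show ?case by (simp add: linear_0[OF assms(1)])
next
  case (add a i x)
  then show ?case
    using assms by (simp add: linear_add linear_scale cone_add cone_scale)
qed

lemma cone_subset_subspace:
  assumes "subspace V" "\<And>i. i \<in> I \<Longrightarrow> g i \<in> V" "x \<in> cone_of I g"
  shows "x \<in> V"
  using assms(3) by (induction rule: cone_induct)
    (use assms(1,2) in \<open>auto intro: subspace_0 subspace_add subspace_scale\<close>)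

lemma cone_mono:
  assumes "\<And>i. i \<in> I \<Longrightarrow> g i \<in> cone_of I' g'" "x \<in> cone_of I g"
  shows "x \<in> cone_of I' g'"
  using assms(2) by (induction rule: cone_induct) (use assms(1) in \<open>auto intro: cone_add cone_scale\<close>)

lemma cone_functional_nonneg:
  fixes \<phi> :: "'v::real_vector \<Rightarrow> real"
  assumes "linear \<phi>" "\<And>i. i \<in> I \<Longrightarrow> 0 \<le> \<phi> (g i)" "x \<in> cone_of I g"
  shows "0 \<le> \<phi> x"
  using assms(3) by (induction rule: cone_induct)
    (use assms(1,2) in \<open>auto simp: linear_0 linear_add linear_scale\<close>)

text \<open>Such a functional makes the cone pointed and measures the size of its elements linearly;
  later \<open>ev\<close> takes this role.\<close>

lemma cone_functional_pos:
  fixes \<phi> :: "'v::real_vector \<Rightarrow> real"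
  assumes "linear \<phi>" "\<And>i. i \<in> I \<Longrightarrow> 0 < \<phi> (g i)" "x \<in> cone_of I g" "x \<noteq> 0"
  shows "0 < \<phi> x"
  using assms(3,4)
proof (induction rule: cone_induct)
  case (add a i x)
  have nn: "0 \<le> \<phi> x" "0 \<le> a * \<phi> (g i)"
    using cone_functional_nonneg[OF assms(1) less_imp_le[OF assms(2)] add.hyps(3)] add.hyps assms(2)
    by (auto intro: mult_nonneg_nonneg less_imp_le)
  have "0 < \<phi> x \<or> 0 < a * \<phi> (g i)"
    using add assms(2) by (cases "a = 0") (auto simp: less_le)
  with nn show ?case using assms(1) by (auto simp: linear_add linear_scale)
qed simp

text \<open>\<open>u\<close> is an order unit: once it dominates the generators up to constants, it
  dominates every vector of the span with both signs. The plus sign comes from c u + g i = (c u - g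
  i) + 2 g i.\<close>

lemma span_dominated:
  assumes "\<And>i. i \<in> I \<Longrightarrow> \<exists>c\<ge>0. c *\<^sub>R u - g i \<in> cone_of I g" and fin: "finite I"
    and x: "x \<in> span (g ` I)"
  shows "\<exists>c\<ge>0. c *\<^sub>R u - x \<in> cone_of I g \<and> c *\<^sub>R u + x \<in> cone_of I g"
  using x
proof (induction rule: span_induct_alt)
  case base
  show ?case by (rule exI[of _ 0]) simp
next
  case (step r y x)
  then obtain i where i: "i \<in> I" "y = g i" by auto
  obtain c where c: "c \<ge> 0" "c *\<^sub>R u - g i \<in> cone_of I g" using assms(1)[OF i(1)] by blast
  have gi: "g i \<in> cone_of I g" by (rule cone_gen[OF fin i(1)])
  have cu: "c *\<^sub>R u + g i \<in> cone_of I g"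
    using cone_add[OF c(2) cone_scale[OF gi, of 2]] by (simp add: scaleR_2)
  obtain d where d: "d \<ge> 0" "d *\<^sub>R u - x \<in> cone_of I g" "d *\<^sub>R u + x \<in> cone_of I g"
    using step.IH by blast
  have e1: "\<bar>r\<bar> *\<^sub>R (c *\<^sub>R u - g i) \<in> cone_of I g" "\<bar>r\<bar> *\<^sub>R (c *\<^sub>R u + g i) \<in> cone_of I g"
    using c cu by (auto intro: cone_scale)
  have e2: "(\<bar>r\<bar> * c) *\<^sub>R u - r *\<^sub>R g i \<in> cone_of I g \<and> (\<bar>r\<bar> * c) *\<^sub>R u + r *\<^sub>R g i \<in> cone_of I g"
  proof (cases "r \<ge> 0")
    case True
    then show ?thesis using e1 by (simp add: scaleR_diff_right scaleR_add_right)
  next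
    case False
    then show ?thesis using e1 by (simp add: scaleR_diff_right scaleR_add_right)
  qed
  show ?case
    using cone_add[OF conjunct1[OF e2] d(2)] cone_add[OF conjunct2[OF e2] d(3)] c d i
    by (intro exI[of _ "\<bar>r\<bar> * c + d"]) (simp add: algebra_simps)
qed

section \<open>Perron-Frobenius arguments for a polyhedral cone\<close>

context symmetric_operator
begin

text \<open>Iterating T \<psi> \<ge> a \<psi> in the cone order gives T^m \<psi> \<ge> a^m \<psi>.
  The functional then grows at least like a^m, while the norm bound permits at most
  \<rho>^m.\<close>

lemma collatz_wielandt_le:
  fixes \<phi> :: "'i vec \<Rightarrow> real"
  assumes bound: "\<And>u. u \<in> V \<Longrightarrow> ip (T u) (T u) \<le> \<rho>\<^sup>2 * ip u u" "\<rho> \<ge> 0"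
    and \<phi>: "linear \<phi>" "\<And>i. i \<in> I \<Longrightarrow> 0 < \<phi> (g i)"
    and g: "\<And>i. i \<in> I \<Longrightarrow> g i \<in> V" "\<And>i. i \<in> I \<Longrightarrow> T (g i) \<in> cone_of I g"
    and \<psi>: "\<psi> \<in> cone_of I g" "\<psi> \<noteq> 0" "T \<psi> - a *\<^sub>R \<psi> \<in> cone_of I g" and a: "a \<ge> 0"
  shows "a \<le> \<rho>"
proof (rule ccontr)
  assume "\<not> a \<le> \<rho>"
  then have a\<rho>: "a > \<rho>" "a > 0" using bound(2) by auto
  have K_V: "x \<in> V" if "x \<in> cone_of I g" for x
    by (rule cone_subset_subspace[OF subspace_V g(1) that])
  have T_K: "T x \<in> cone_of I g" if "x \<in> cone_of I g" for x
    by (rule cone_linear_image[OF linear_T g(2) that])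
  have iter: "(T ^^ m) \<psi> - (a ^ m) *\<^sub>R \<psi> \<in> cone_of I g" for m
  proof (induction m)
    case (Suc m)
    have "T ((T ^^ m) \<psi> - (a ^ m) *\<^sub>R \<psi>) + (a ^ m) *\<^sub>R (T \<psi> - a *\<^sub>R \<psi>) \<in> cone_of I g"
      by (intro cone_add cone_scale T_K Suc \<psi> zero_le_power a)
    moreover have "T ((T ^^ m) \<psi> - (a ^ m) *\<^sub>R \<psi>) + (a ^ m) *\<^sub>R (T \<psi> - a *\<^sub>R \<psi>)
      = (T ^^ Suc m) \<psi> - (a ^ Suc m) *\<^sub>R \<psi>"
      by (simp add: T_simps algebra_simps)
    ultimately show ?case by metis
  next
    case 0
    have "(T ^^ 0) \<psi> - (a ^ 0) *\<^sub>R \<psi> = 0" by simp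
    then show ?case by (metis cone_zero)
  qed
  obtain B where B: "B \<ge> 0" "\<And>f. f \<in> supp \<Longrightarrow> \<bar>\<phi> f\<bar> \<le> B * sqrt (ip f f)"
    using linear_bound[OF \<phi>(1)] by blast
  have pos: "\<phi> \<psi> > 0" using cone_functional_pos[OF \<phi> \<psi>(1,2)] .
  have "\<phi> \<psi> \<le> B * sqrt (ip \<psi> \<psi>) * (\<rho> / a) ^ m" for m
  proof -
    have "a ^ m * \<phi> \<psi> \<le> \<phi> ((T ^^ m) \<psi>)"
      using cone_functional_nonneg[OF \<phi>(1) less_imp_le[OF \<phi>(2)] iter[of m]] \<phi>(1)
      by (simp add: linear_diff linear_scale)
    also have "\<dots> \<le> B * sqrt (ip ((T ^^ m) \<psi>) ((T ^^ m) \<psi>))"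
      using B(2)[of "(T ^^ m) \<psi>"] iterate_V[OF K_V[OF \<psi>(1)], of m] V_supp by auto
    also have "\<dots> \<le> B * (\<rho> ^ m * sqrt (ip \<psi> \<psi>))"
      using iterate_norm_bound[OF bound K_V[OF \<psi>(1)]] B(1) by (intro mult_left_mono) auto
    finally show ?thesis using a\<rho> by (simp add: power_divide field_simps)
  qed
  moreover have "(\<lambda>m. B * sqrt (ip \<psi> \<psi>) * (\<rho> / a) ^ m) \<longlonglongrightarrow> B * sqrt (ip \<psi> \<psi>) * 0"
    using a\<rho> bound(2) by (intro tendsto_intros LIMSEQ_realpow_zero) auto
  ultimately have "\<phi> \<psi> \<le> 0"
    by (intro LIMSEQ_le_const) auto
  then show False using pos by simp
qed

text \<open>The partial sums of the resolvent series at \<rho> become unbounded because u dominates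
  v and -v, while their defect T s - \<rho> s stays bounded. Normalised by \<phi>, they accumulate
  at an eigenvector in the cone.\<close>

lemma cone_eigenvector:
  fixes \<phi> :: "'i vec \<Rightarrow> real"
  assumes bound: "\<And>u. u \<in> V \<Longrightarrow> ip (T u) (T u) \<le> \<rho>\<^sup>2 * ip u u" "\<rho> > 0"
    and \<phi>: "linear \<phi>" "\<And>i. i \<in> I \<Longrightarrow> 0 < \<phi> (g i)" and fin: "finite I"
    and g: "\<And>i. i \<in> I \<Longrightarrow> g i \<in> V" "\<And>i. i \<in> I \<Longrightarrow> T (g i) \<in> cone_of I g"
    and u: "u \<in> cone_of I g" "\<tau> *\<^sub>R u + v \<in> cone_of I g" "\<tau> *\<^sub>R u - v \<in> cone_of I g"
    and v: "v \<in> V" "v \<noteq> 0" "T v = \<rho> *\<^sub>R v"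
  shows "\<exists>\<psi>\<in>cone_of I g. \<psi> \<noteq> 0 \<and> T \<psi> = \<rho> *\<^sub>R \<psi>"
proof -
  have K_V: "x \<in> V" if "x \<in> cone_of I g" for x
    by (rule cone_subset_subspace[OF subspace_V g(1) that])
  have T_K: "T x \<in> cone_of I g" if "x \<in> cone_of I g" for x
    by (rule cone_linear_image[OF linear_T g(2) that])
  have iter_K: "(T ^^ m) x \<in> cone_of I g" if "x \<in> cone_of I g" for x m
    by (induction m) (auto intro: T_K that)
  have iter_v: "(T ^^ m) v = \<rho> ^ m *\<^sub>R v" for m
  proof (induction m)
    case (Suc m)
    have "(T ^^ Suc m) v = T (\<rho> ^ m *\<^sub>R v)" using Suc by (metis comp_apply funpow.simps(2))
    then show ?case by (simp add: T_simps v(3) mult.commute)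
  qed simp
  have iter_lin: "linear (T ^^ m)" for m
  proof (induction m)
    case (Suc m)
    then show ?case using linear_compose[OF Suc linear_T] by (simp add: o_def)
  qed (auto intro: linearI)
  \<comment> \<open>Partial sums of the formal solution of s - T s / \<rho> = u.\<close>
  define s where "s M = (\<Sum>m<M. (1 / \<rho> ^ m) *\<^sub>R (T ^^ m) u)" for M
  have s_K: "s M \<in> cone_of I g" for M
    unfolding s_def using bound(2) by (intro cone_sum cone_scale iter_K u) auto
  have s_T: "T (s M) = \<rho> *\<^sub>R (s M - u + (1 / \<rho> ^ M) *\<^sub>R (T ^^ M) u)" for M
  proof (induction M)
    case 0
    show ?case by (simp add: s_def linear_0[OF linear_T])
  next
    case (Suc M)
    have "T (s (Suc M)) = T (s M) + (1 / \<rho> ^ M) *\<^sub>R T ((T ^^ M) u)"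
      by (simp add: s_def T_simps)
    then show ?case using Suc bound(2) by (simp add: s_def algebra_simps)
  qed
  \<comment> \<open>Nonnegative coefficients cannot cancel under \<phi>, so they are bounded by its
    value even when the generators are dependent.\<close>
  have coeff_bound: "a i \<le> \<phi> (\<Sum>i\<in>I. a i *\<^sub>R g i) / \<phi> (g i)"
    if "\<forall>i\<in>I. 0 \<le> a i" "i \<in> I" for a i
  proof -
    have "a i * \<phi> (g i) \<le> (\<Sum>i\<in>I. a i * \<phi> (g i))"
      using that fin \<phi>(2) by (intro member_le_sum) (auto intro: mult_nonneg_nonneg less_imp_le)
    also have "\<dots> = \<phi> (\<Sum>i\<in>I. a i *\<^sub>R g i)"
      by (simp add: linear_sum[OF \<phi>(1)] linear_scale[OF \<phi>(1)])
    finally show ?thesis using \<phi>(2)[OF that(2)] by (simp add: field_simps)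
  qed
  have coord_bound: "\<bar>coef k c\<bar> \<le> \<phi> k * (\<Sum>i\<in>I. \<bar>coef (g i) c\<bar> / \<phi> (g i))" if k: "k \<in> cone_of I g" for k c
  proof -
    obtain a where a: "\<forall>i\<in>I. 0 \<le> a i" "k = (\<Sum>i\<in>I. a i *\<^sub>R g i)"
      using k unfolding cone_of_def by blast
    have "\<bar>coef k c\<bar> \<le> (\<Sum>i\<in>I. a i * \<bar>coef (g i) c\<bar>)"
      using a sum_abs[of "\<lambda>i. a i * coef (g i) c" I] by (simp add: abs_mult)
    also have "\<dots> \<le> (\<Sum>i\<in>I. \<phi> k / \<phi> (g i) * \<bar>coef (g i) c\<bar>)"
      using coeff_bound[OF a(1)] a(2) by (intro sum_mono mult_right_mono) auto
    finally show ?thesis by (simp add: sum_distrib_left)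
  qed
  have unbounded: "\<exists>M. \<phi> (s M) > B" for B
  proof (rule ccontr)
    assume "\<not> (\<exists>M. \<phi> (s M) > B)"
    then have sB: "\<phi> (s M) \<le> B" for M by (simp add: not_less)
    obtain c where c: "coef v c \<noteq> 0" using v(2) by (auto simp: vec_eq_iff)
    \<comment> \<open>T / \<rho> fixes v, so the M summands contribute M v to the sum over \<tau> u
      + v, and - M v to the one over \<tau> u - v.\<close>
    have pm: "\<tau> *\<^sub>R s M + real M *\<^sub>R v \<in> cone_of I g \<and> \<tau> *\<^sub>R s M - real M *\<^sub>R v \<in> cone_of I g" for M
    proof -
      have "(\<Sum>m<M. (1 / \<rho> ^ m) *\<^sub>R (T ^^ m) (\<tau> *\<^sub>R u + v)) \<in> cone_of I g"
        "(\<Sum>m<M. (1 / \<rho> ^ m) *\<^sub>R (T ^^ m) (\<tau> *\<^sub>R u - v)) \<in> cone_of I g"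
        using bound(2) u by (intro cone_sum cone_scale iter_K; simp)+
      moreover have "(\<Sum>m<M. (1 / \<rho> ^ m) *\<^sub>R (T ^^ m) (\<tau> *\<^sub>R u + v)) = \<tau> *\<^sub>R s M + real M *\<^sub>R v"
        "(\<Sum>m<M. (1 / \<rho> ^ m) *\<^sub>R (T ^^ m) (\<tau> *\<^sub>R u - v)) = \<tau> *\<^sub>R s M - real M *\<^sub>R v"
        using bound(2)
        by (simp_all add: s_def linear_add[OF iter_lin] linear_diff[OF iter_lin] linear_scale[OF iter_lin]
            iter_v scaleR_add_right scaleR_diff_right sum.distrib sum_subtractf scaleR_sum_right
            mult.commute sum_constant_scaleR)
      ultimately show ?thesis by simp
    qed
    define S where "S = (\<Sum>i\<in>I. \<bar>coef (g i) c\<bar> / \<phi> (g i))"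
    have S0: "S \<ge> 0" unfolding S_def using \<phi>(2) by (intro sum_nonneg divide_nonneg_pos) auto
    have "2 * real M * \<bar>coef v c\<bar> \<le> 2 * \<bar>\<tau>\<bar> * \<bar>B\<bar> * S" for M
    proof -
      let ?k = "\<tau> *\<^sub>R s M + real M *\<^sub>R v" and ?l = "\<tau> *\<^sub>R s M - real M *\<^sub>R v"
      have "2 * real M * coef v c = coef ?k c - coef ?l c" by simp
      then have "2 * real M * \<bar>coef v c\<bar> \<le> \<bar>coef ?k c\<bar> + \<bar>coef ?l c\<bar>"
        by (metis abs_mult abs_numeral abs_of_nat abs_triangle_ineq4)
      also have "\<dots> \<le> \<phi> ?k * S + \<phi> ?l * S"
        using coord_bound pm unfolding S_def by (intro add_mono) blast+
      also have "\<dots> = 2 * (\<tau> * \<phi> (s M)) * S"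
        using \<phi>(1) by (simp add: linear_add linear_diff linear_scale algebra_simps)
      also have "\<dots> \<le> 2 * (\<bar>\<tau>\<bar> * \<bar>B\<bar>) * S"
      proof -
        have "0 \<le> \<phi> (s M)"
          by (rule cone_functional_nonneg[OF \<phi>(1) less_imp_le[OF \<phi>(2)] s_K])
        then have "\<tau> * \<phi> (s M) \<le> \<bar>\<tau>\<bar> * \<bar>B\<bar>" using sB[of M] by (intro mult_mono) auto
        then show ?thesis using S0 by (simp add: mult_right_mono)
      qed
      finally show ?thesis by (simp add: mult_ac)
    qed
    moreover obtain M :: nat where M: "real M > \<bar>\<tau>\<bar> * \<bar>B\<bar> * S / \<bar>coef v c\<bar>"
      using reals_Archimedean2 by blast
    moreover have "real M * \<bar>coef v c\<bar> > \<bar>\<tau>\<bar> * \<bar>B\<bar> * S" using M c by (simp add: field_simps)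
    ultimately show False by (metis linorder_not_less mult.assoc mult_less_cancel_left_pos zero_less_numeral)
  qed
  \<comment> \<open>With \<phi> (s M) beyond j + 1 the normalised defect is of order 1 / (j +
    1).\<close>
  define sel where "sel j = (SOME M. \<phi> (s M) > real (Suc j))" for j :: nat
  have sel: "\<phi> (s (sel j)) > real (Suc j)" for j
    unfolding sel_def using someI_ex[OF unbounded[of "real (Suc j)"]] .
  define \<sigma> where "\<sigma> j = \<phi> (s (sel j))" for j
  have \<sigma>: "\<sigma> j > real (Suc j)" "\<sigma> j > 0" for j
    using sel[of j] by (auto simp: \<sigma>_def intro: le_less_trans[of 0])
  define y where "y j = (1 / \<sigma> j) *\<^sub>R s (sel j)" for j
  have y_K: "y j \<in> cone_of I g" for j
    unfolding y_def using \<sigma>(2)[of j] by (intro cone_scale s_K) auto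
  have \<phi>y: "\<phi> (y j) = 1" for j
    using \<sigma>(2)[of j] \<phi>(1) by (simp add: y_def linear_scale \<sigma>_def[symmetric])
  have "\<forall>j. \<exists>a. (\<forall>i\<in>I. 0 \<le> a i) \<and> y j = (\<Sum>i\<in>I. a i *\<^sub>R g i)"
    using y_K unfolding cone_of_def by blast
  then obtain a where a: "\<And>j. \<forall>i\<in>I. 0 \<le> a j i" "\<And>j. y j = (\<Sum>i\<in>I. a j i *\<^sub>R g i)"
    by metis
  have "\<bar>a j i\<bar> \<le> (\<Sum>i\<in>I. 1 / \<phi> (g i))" if "i \<in> I" for j i
  proof -
    have "a j i \<le> 1 / \<phi> (g i)" using coeff_bound[OF a(1) that, of j] \<phi>y[of j] a(2)[of j] by simp
    also have "\<dots> \<le> (\<Sum>i\<in>I. 1 / \<phi> (g i))"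
      using that fin \<phi>(2) by (intro member_le_sum) (auto intro: less_imp_le)
    finally show ?thesis using a(1) that by auto
  qed
  then obtain r l where r: "strict_mono (r :: nat \<Rightarrow> nat)"
    and l: "\<forall>i\<in>I. (\<lambda>j. a (r j) i) \<longlonglongrightarrow> l i"
    using bounded_subseq_convergent[OF fin, of a] by blast
  \<comment> \<open>The limit is taken in the coefficients and not in the vectors, so that
    membership in the cone needs only their nonnegativity.\<close>
  define \<psi> where "\<psi> = (\<Sum>i\<in>I. l i *\<^sub>R g i)"
  have l0: "0 \<le> l i" if "i \<in> I" for i
    using LIMSEQ_le_const[of "\<lambda>j. a (r j) i" "l i" 0] l a(1) that by blast
  then have \<psi>_K: "\<psi> \<in> cone_of I g" unfolding \<psi>_def by (intro cone_sum cone_scale cone_gen fin) auto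
  have lin_lim: "(\<lambda>j. \<theta> (y (r j))) \<longlonglongrightarrow> \<theta> \<psi>" if "linear \<theta>" for \<theta> :: "'i vec \<Rightarrow> real"
    unfolding a(2) \<psi>_def linear_sum[OF that] linear_scale[OF that]
    using l by (intro tendsto_intros) auto
  have "(\<lambda>j. \<phi> (y (r j))) \<longlonglongrightarrow> \<phi> \<psi>" by (rule lin_lim[OF \<phi>(1)])
  then have "\<phi> \<psi> = 1" using \<phi>y by (simp add: LIMSEQ_const_iff)
  then have \<psi>0: "\<psi> \<noteq> 0" using linear_0[OF \<phi>(1)] by auto
  obtain B where B: "B \<ge> 0" "\<And>f c. f \<in> supp \<Longrightarrow> \<bar>coef f c\<bar> \<le> B * sqrt (ip f f)"
    using coordinate_bound by blast
  have small: "\<bar>coef (T (y j)) c - \<rho> * coef (y j) c\<bar> \<le> 2 * \<rho> * B * sqrt (ip u u) * inverse (real (Suc j))" for j c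
  proof -
    let ?M = "sel j"
    have "T (y j) - \<rho> *\<^sub>R y j = (\<rho> / \<sigma> j) *\<^sub>R ((1 / \<rho> ^ ?M) *\<^sub>R (T ^^ ?M) u - u)"
      using \<sigma>(2)[of j] by (simp add: y_def T_simps s_T algebra_simps)
    then have "coef (T (y j)) c - \<rho> * coef (y j) c = (\<rho> / \<sigma> j) * ((1 / \<rho> ^ ?M) * coef ((T ^^ ?M) u) c - coef u c)"
      by (metis coef_simps(3,5))
    moreover have "\<bar>(1 / \<rho> ^ ?M) * coef ((T ^^ ?M) u) c - coef u c\<bar> \<le> 2 * (B * sqrt (ip u u))"
    proof -
      have uV: "u \<in> V" using K_V u by simp
      have "\<bar>coef ((T ^^ ?M) u) c\<bar> \<le> B * sqrt (ip ((T ^^ ?M) u) ((T ^^ ?M) u))"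
        using B(2) iterate_V[OF uV] V_supp by blast
      also have "\<dots> \<le> B * (\<rho> ^ ?M * sqrt (ip u u))"
        using iterate_norm_bound[OF bound(1) _ uV] bound(2) B(1) by (intro mult_left_mono) auto
      finally have "\<bar>(1 / \<rho> ^ ?M) * coef ((T ^^ ?M) u) c\<bar> \<le> B * sqrt (ip u u)"
        using bound(2) by (simp add: abs_mult field_simps)
      moreover have "\<bar>coef u c\<bar> \<le> B * sqrt (ip u u)" using B(2) uV V_supp by blast
      ultimately show ?thesis by linarith
    qed
    ultimately have "\<bar>coef (T (y j)) c - \<rho> * coef (y j) c\<bar> \<le> (\<rho> / \<sigma> j) * (2 * (B * sqrt (ip u u)))"
      using bound(2) \<sigma>(2)[of j] by (simp add: abs_mult divide_right_mono mult_left_mono)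
    also have "\<dots> \<le> (\<rho> / real (Suc j)) * (2 * (B * sqrt (ip u u)))"
      using bound(2) \<sigma>(1)[of j] B(1) ip_self_nonneg[of u]
      by (intro mult_right_mono divide_left_mono mult_pos_pos) auto
    finally show ?thesis by (simp add: field_simps)
  qed
  have "coef (T \<psi>) c = \<rho> * coef \<psi> c" for c
  proof -
    have l1: "linear (\<lambda>x. coef (T x) c - \<rho> * coef x c)"
      by (intro linearI) (simp_all add: T_simps algebra_simps)
    have z: "(\<lambda>j. 2 * \<rho> * B * sqrt (ip u u) * inverse (real (Suc (r j)))) \<longlonglongrightarrow> 2 * \<rho> * B * sqrt (ip u u) * 0"
      using LIMSEQ_subseq_LIMSEQ[OF LIMSEQ_inverse_real_of_nat r]
      by (intro tendsto_intros) (simp add: o_def)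
    have "(\<lambda>j. coef (T (y (r j))) c - \<rho> * coef (y (r j)) c) \<longlonglongrightarrow> 0"
    proof (rule tendsto_rabs_zero_cancel, rule tendsto_sandwich[OF _ _ tendsto_const])
      show "(\<lambda>j. 2 * \<rho> * B * sqrt (ip u u) * inverse (real (Suc (r j)))) \<longlonglongrightarrow> 0"
        using z by (simp only: mult_zero_right)
    qed (use small in auto)
    with lin_lim[OF l1] have "coef (T \<psi>) c - \<rho> * coef \<psi> c = 0" using LIMSEQ_unique by blast
    then show ?thesis by simp
  qed
  then have "T \<psi> = \<rho> *\<^sub>R \<psi>" by (simp add: vec_eq_iff)
  then show ?thesis using \<psi>_K \<psi>0 by blast
qed

end

section \<open>The polynomial model of the chain\<close>

text \<open>Coefficient functions on exponent vectors. The type imposes no finiteness; it enters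
  through \<open>chain.supp\<close>, which bounds the degree in each variable.\<close>

type_synonym pol = "(nat \<Rightarrow> nat) vec"

definition zmul :: "nat \<Rightarrow> pol \<Rightarrow> pol" where
  "zmul x f = Vec (\<lambda>c. if c x = 0 then 0 else coef f (c(x := c x - 1)))"

definition pd :: "nat \<Rightarrow> pol \<Rightarrow> pol" where
  "pd x f = Vec (\<lambda>c. real (Suc (c x)) * coef f (c(x := Suc (c x))))"

definition one_pol :: pol where
  "one_pol = Vec (\<lambda>c. if c = (\<lambda>_. 0) then 1 else 0)"

lemma coef_zmul: "coef (zmul x f) c = (if c x = 0 then 0 else coef f (c(x := c x - 1)))"
  by (simp add: zmul_def)

lemma coef_pd: "coef (pd x f) c = real (Suc (c x)) * coef f (c(x := Suc (c x)))"
  by (simp add: pd_def)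

lemma linear_zmul: "linear (zmul x)"
  by (intro linearI) (auto simp: vec_eq_iff coef_zmul)

lemma linear_pd: "linear (pd x)"
  by (intro linearI) (auto simp: vec_eq_iff coef_pd algebra_simps)

lemmas op_simps =
  linear_0[OF linear_zmul] linear_add[OF linear_zmul] linear_diff[OF linear_zmul]
  linear_neg[OF linear_zmul] linear_scale[OF linear_zmul] linear_sum[OF linear_zmul]
  linear_0[OF linear_pd] linear_add[OF linear_pd] linear_diff[OF linear_pd]
  linear_neg[OF linear_pd] linear_scale[OF linear_pd] linear_sum[OF linear_pd]

lemma zmul_commute: "zmul x (zmul y f) = zmul y (zmul x f)"
  by (auto simp: vec_eq_iff coef_zmul fun_upd_twist)

lemma pd_commute: "pd x (pd y f) = pd y (pd x f)"
  by (cases "x = y") (auto simp: vec_eq_iff coef_pd fun_upd_twist)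

lemma pd_zmul_same: "pd x (zmul x f) = zmul x (pd x f) + f"
  by (auto simp: vec_eq_iff coef_zmul coef_pd algebra_simps)

lemma pd_zmul_other: "x \<noteq> y \<Longrightarrow> pd x (zmul y f) = zmul y (pd x f)"
  by (auto simp: vec_eq_iff coef_zmul coef_pd fun_upd_twist)

lemmas weyl_simps = op_simps pd_zmul_same pd_zmul_other

lemma coef_zmul_pd: "coef (zmul x (pd x f)) c = real (c x) * coef f c"
  by (auto simp: coef_zmul coef_pd)

lemma pd_one [simp]: "pd x one_pol = 0"
  by (auto simp: vec_eq_iff coef_pd one_pol_def fun_eq_iff)

definition dmul :: "nat \<Rightarrow> nat \<Rightarrow> pol \<Rightarrow> pol" where
  "dmul a b f = zmul a f - zmul b f"

lemma linear_dmul: "linear (dmul a b)"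
  by (intro linearI) (simp_all add: dmul_def op_simps algebra_simps)

lemmas dmul_simps =
  linear_0[OF linear_dmul] linear_add[OF linear_dmul] linear_diff[OF linear_dmul]
  linear_neg[OF linear_dmul] linear_scale[OF linear_dmul] linear_sum[OF linear_dmul]

lemma dmul_commute: "dmul a b (dmul c d f) = dmul c d (dmul a b f)"
  by (simp add: dmul_def op_simps zmul_commute algebra_simps)

text \<open>\<open>bond N x\<close> is \<open>2 (S\<^sub>x \<cdot> S\<^sub>x\<^sub>+\<^sub>1 - s\<^sub>x s\<^sub>x\<^sub>+\<^sub>1)\<close> when a spin \<open>s = N / 2\<close> is realised on the polynomials
  of degree at most \<open>N\<close> by \<open>S\<^sup>+ = \<partial>\<close>, \<open>S\<^sup>3 = s - z\<partial>\<close>, \<open>S\<^sup>- = N z - z\<^sup>2\<partial>\<close>.\<close>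

definition bond :: "(nat \<Rightarrow> nat) \<Rightarrow> nat \<Rightarrow> pol \<Rightarrow> pol" where
  "bond N x f = real (N x) *\<^sub>R dmul x (Suc x) (pd (Suc x) f)
     - real (N (Suc x)) *\<^sub>R dmul x (Suc x) (pd x f)
     - dmul x (Suc x) (dmul x (Suc x) (pd x (pd (Suc x) f)))"

definition smin :: "(nat \<Rightarrow> nat) \<Rightarrow> nat \<Rightarrow> pol \<Rightarrow> pol" where
  "smin N x f = real (N x) *\<^sub>R zmul x f - zmul x (zmul x (pd x f))"

definition sz :: "(nat \<Rightarrow> nat) \<Rightarrow> nat \<Rightarrow> pol \<Rightarrow> pol" where
  "sz N x f = (real (N x) / 2) *\<^sub>R f - zmul x (pd x f)"

lemma linear_bond: "linear (bond N x)"
  by (intro linearI) (simp_all add: bond_def dmul_simps op_simps algebra_simps)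

lemma linear_smin: "linear (smin N x)"
  by (intro linearI) (simp_all add: smin_def op_simps algebra_simps)

lemmas bond_simps =
  linear_0[OF linear_bond] linear_add[OF linear_bond] linear_diff[OF linear_bond]
  linear_scale[OF linear_bond] linear_sum[OF linear_bond]

lemmas smin_simps =
  linear_0[OF linear_smin] linear_add[OF linear_smin] linear_diff[OF linear_smin]
  linear_scale[OF linear_smin] linear_sum[OF linear_smin]

lemma coef_smin:
  "coef (smin N x f) c = (if c x = 0 then 0 else (real (N x) - real (c x - 1)) * coef f (c(x := c x - 1)))"
proof (cases "c x")
  case (Suc k)
  then show ?thesis by (cases k) (auto simp: smin_def coef_zmul coef_pd algebra_simps)
qed (simp add: smin_def coef_zmul)

lemma coef_sz: "coef (sz N x f) c = (real (N x) / 2 - real (c x)) * coef f c"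
  by (simp add: sz_def coef_zmul_pd algebra_simps)

text \<open>The ladder form of the scalar product, lowered by its ferromagnetic value. Symmetry and
  degree bounds are read off here; translation invariance and the action on products of differences
  are read off from \<open>bond_def\<close>.\<close>

lemma bond_spin:
  "bond N x f = pd x (smin N (Suc x) f) + pd (Suc x) (smin N x f) + 2 *\<^sub>R sz N x (sz N (Suc x) f)
     - (real (N x) * real (N (Suc x)) / 2) *\<^sub>R f"
  unfolding bond_def smin_def sz_def dmul_def
  by (simp add: weyl_simps zmul_commute pd_commute)
    (simp add: vec_eq_iff algebra_simps)

lemma pd_bond_other: "z \<noteq> x \<Longrightarrow> z \<noteq> Suc x \<Longrightarrow> pd z (bond N x f) = bond N x (pd z f)"
  unfolding bond_def dmul_def by (simp add: weyl_simps zmul_commute pd_commute)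

lemma zmul_bond_other: "z \<noteq> x \<Longrightarrow> z \<noteq> Suc x \<Longrightarrow> zmul z (bond N x f) = bond N x (zmul z f)"
  unfolding bond_def dmul_def
  by (simp add: weyl_simps) (simp add: zmul_commute pd_commute op_simps algebra_simps)

text \<open>The variables enter the coefficients of the bond only through z_x - z_{x+1}, which is
  annihilated by the sum of the two derivatives.\<close>

lemma pd_bond_pair:
  "pd x (bond N x f) + pd (Suc x) (bond N x f) = bond N x (pd x f) + bond N x (pd (Suc x) f)"
  unfolding bond_def dmul_def
  by (simp add: weyl_simps zmul_commute pd_commute) (simp add: vec_eq_iff algebra_simps)

section \<open>Total spin operators and homogeneous polynomials\<close>

definition dtot :: "nat \<Rightarrow> pol \<Rightarrow> pol" where
  "dtot L f = (\<Sum>x\<in>{1..L}. pd x f)"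

definition smintot :: "nat \<Rightarrow> (nat \<Rightarrow> nat) \<Rightarrow> pol \<Rightarrow> pol" where
  "smintot L N f = (\<Sum>x\<in>{1..L}. smin N x f)"

text \<open>Sites with \<open>N x = 0\<close> are allowed: by \<open>x / 0 = 0\<close> they decouple. This lets a chain grow by half-spins,
  also beyond its last site.\<close>

definition ham :: "nat \<Rightarrow> (nat \<Rightarrow> nat) \<Rightarrow> (nat \<Rightarrow> real) \<Rightarrow> pol \<Rightarrow> pol" where
  "ham L N J f = - (\<Sum>x\<in>{1..<L}. (2 * J x / (real (N x) * real (N (Suc x)))) *\<^sub>R bond N x f)"

lemma linear_dtot: "linear (dtot L)"
  by (intro linearI) (simp_all add: dtot_def op_simps sum.distrib scaleR_sum_right)

lemma linear_smintot: "linear (smintot L N)"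
  by (intro linearI) (simp_all add: smintot_def smin_simps sum.distrib scaleR_sum_right)

lemma linear_ham: "linear (ham L N J)"
  by (intro linearI)
    (simp_all add: ham_def bond_simps scaleR_add_right sum.distrib scaleR_sum_right mult.commute)

lemmas tot_simps =
  linear_0[OF linear_dtot] linear_add[OF linear_dtot] linear_diff[OF linear_dtot]
  linear_neg[OF linear_dtot] linear_scale[OF linear_dtot] linear_sum[OF linear_dtot]
  linear_0[OF linear_smintot] linear_add[OF linear_smintot] linear_diff[OF linear_smintot]
  linear_scale[OF linear_smintot] linear_sum[OF linear_smintot]
  linear_0[OF linear_ham] linear_add[OF linear_ham] linear_diff[OF linear_ham]
  linear_scale[OF linear_ham] linear_sum[OF linear_ham]

lemma dtot_bond:
  assumes "x \<in> {1..<L}"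
  shows "dtot L (bond N x f) = bond N x (dtot L f)"
proof -
  have split: "dtot L g = (pd x g + pd (Suc x) g) + (\<Sum>z\<in>{1..L} - {x, Suc x}. pd z g)" for g
    unfolding dtot_def using assms
    by (subst sum.subset_diff[of "{x, Suc x}"]) (auto simp: add.commute)
  show ?thesis
    unfolding split bond_simps pd_bond_pair
    by (simp add: bond_simps pd_bond_other)
qed

lemma dtot_ham: "dtot L (ham L N J f) = ham L N J (dtot L f)"
  by (simp add: ham_def tot_simps dtot_bond)

lemma pd_smin: "pd x (smin N y f) = smin N y (pd x f) + (if x = y then 2 *\<^sub>R sz N x f else 0)"
  unfolding smin_def sz_def
  by (cases "x = y") (simp_all add: weyl_simps pd_commute vec_eq_iff algebra_simps)

text \<open>The relation [S+, S-] = 2 S3; only equal sites contribute.\<close>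

lemma dtot_smintot:
  "dtot L (smintot L N f) = smintot L N (dtot L f) + (\<Sum>x\<in>{1..L}. 2 *\<^sub>R sz N x f)"
proof -
  have "dtot L (smintot L N f) = (\<Sum>x\<in>{1..L}. \<Sum>y\<in>{1..L}. pd x (smin N y f))"
    by (simp add: dtot_def smintot_def op_simps)
  also have "\<dots> = (\<Sum>x\<in>{1..L}. \<Sum>y\<in>{1..L}. smin N y (pd x f)) + (\<Sum>x\<in>{1..L}. 2 *\<^sub>R sz N x f)"
    by (simp add: pd_smin sum.distrib sum.delta)
  also have "(\<Sum>x\<in>{1..L}. \<Sum>y\<in>{1..L}. smin N y (pd x f)) = smintot L N (dtot L f)"
    by (simp add: dtot_def smintot_def smin_simps) (rule sum.swap)
  finally show ?thesis .
qed

text \<open>The degree is an integer so that a derivative lowers it without truncation; degree -1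
  then forces the zero polynomial, which is homogeneous of every degree.\<close>

definition homog :: "nat \<Rightarrow> int \<Rightarrow> pol \<Rightarrow> bool" where
  "homog L k f \<longleftrightarrow> (\<forall>c. coef f c \<noteq> 0 \<longrightarrow> int (\<Sum>x\<in>{1..L}. c x) = k)"

lemma sum_upd_Suc: "x \<in> {1..L} \<Longrightarrow> (\<Sum>i\<in>{1..L}. (c(x := Suc (c x))) i) = Suc (\<Sum>i\<in>{1..L}. c i)"
  for c :: "nat \<Rightarrow> nat"
  using sum.remove[of "{1..L}" x "c(x := Suc (c x))"] sum.remove[of "{1..L}" x c] by simp

lemma sum_upd_pred:
  "x \<in> {1..L} \<Longrightarrow> c x \<noteq> 0 \<Longrightarrow> Suc (\<Sum>i\<in>{1..L}. (c(x := c x - 1)) i) = (\<Sum>i\<in>{1..L}. c i)"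
  for c :: "nat \<Rightarrow> nat"
  using sum_upd_Suc[of x L "c(x := c x - 1)"] by simp

lemma homog_zmul: "homog L k f \<Longrightarrow> x \<in> {1..L} \<Longrightarrow> homog L (k + 1) (zmul x f)"
  unfolding homog_def coef_zmul
proof (intro allI impI)
  fix c assume f: "\<forall>c. coef f c \<noteq> 0 \<longrightarrow> int (\<Sum>x\<in>{1..L}. c x) = k" and x: "x \<in> {1..L}"
    and c: "(if c x = 0 then 0 else coef f (c(x := c x - 1))) \<noteq> 0"
  then have cx: "c x \<noteq> 0" and "coef f (c(x := c x - 1)) \<noteq> 0" by (auto split: if_splits)
  then have "int (sum (c(x := c x - 1)) {1..L}) = k" using f by blast
  then show "int (\<Sum>x\<in>{1..L}. c x) = k + 1" using sum_upd_pred[of x L c, OF x cx] by linarith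
qed

lemma homog_pd: "homog L k f \<Longrightarrow> x \<in> {1..L} \<Longrightarrow> homog L (k - 1) (pd x f)"
  unfolding homog_def coef_pd
proof (intro allI impI)
  fix c assume f: "\<forall>c. coef f c \<noteq> 0 \<longrightarrow> int (\<Sum>x\<in>{1..L}. c x) = k" and x: "x \<in> {1..L}"
    and c: "real (Suc (c x)) * coef f (c(x := Suc (c x))) \<noteq> 0"
  then have "coef f (c(x := Suc (c x))) \<noteq> 0" by auto
  then have "int (sum (c(x := Suc (c x))) {1..L}) = k" using f by blast
  then show "int (\<Sum>x\<in>{1..L}. c x) = k - 1" using sum_upd_Suc[of x L c, OF x] by linarith
qed

lemma homog_add: "homog L k f \<Longrightarrow> homog L k g \<Longrightarrow> homog L k (f + g)"
  unfolding homog_def coef_simps by (metis add.right_neutral)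

lemma homog_diff: "homog L k f \<Longrightarrow> homog L k g \<Longrightarrow> homog L k (f - g)"
  unfolding homog_def coef_simps by (metis diff_self)

lemma homog_minus: "homog L k f \<Longrightarrow> homog L k (- f)"
  unfolding homog_def by fastforce

lemma homog_scale: "homog L k f \<Longrightarrow> homog L k (r *\<^sub>R f)"
  unfolding homog_def by fastforce

lemma homog_0 [simp]: "homog L k 0"
  unfolding homog_def by simp

lemma homog_sum: "(\<And>i. i \<in> I \<Longrightarrow> homog L k (g i)) \<Longrightarrow> homog L k (sum g I)"
  by (induction I rule: infinite_finite_induct) (auto intro: homog_add)

lemma homog_dmul: "homog L k f \<Longrightarrow> a \<in> {1..L} \<Longrightarrow> b \<in> {1..L} \<Longrightarrow> homog L (k + 1) (dmul a b f)"
  unfolding dmul_def by (intro homog_diff homog_zmul)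

lemma homog_bond: "homog L k f \<Longrightarrow> x \<in> {1..<L} \<Longrightarrow> homog L k (bond N x f)"
proof -
  assume f: "homog L k f" and x: "x \<in> {1..<L}"
  then have xs: "x \<in> {1..L}" "Suc x \<in> {1..L}" by auto
  have "homog L (k - 1 + 1) (dmul x (Suc x) (pd z f))" if "z \<in> {1..L}" for z
    using f xs that by (intro homog_dmul homog_pd)
  moreover have "homog L (k - 1 - 1 + 1 + 1) (dmul x (Suc x) (dmul x (Suc x) (pd x (pd (Suc x) f))))"
    using f xs by (intro homog_dmul homog_pd)
  ultimately show ?thesis
    unfolding bond_def using xs by (intro homog_diff homog_scale) auto
qed

lemma homog_ham: "homog L k f \<Longrightarrow> homog L k (ham L N J f)"
  unfolding ham_def by (intro homog_minus homog_sum homog_scale homog_bond)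

lemma homog_dtot: "homog L k f \<Longrightarrow> homog L (k - 1) (dtot L f)"
  unfolding dtot_def by (intro homog_sum homog_pd)

lemma homog_smintot: "homog L k f \<Longrightarrow> homog L (k + 1) (smintot L N f)"
proof -
  assume f: "homog L k f"
  have "homog L (k - 1 + 1 + 1) (zmul x (zmul x (pd x f)))" if "x \<in> {1..L}" for x
    using f that by (intro homog_zmul homog_pd)
  then have "homog L (k + 1) (smin N x f)" if "x \<in> {1..L}" for x
    unfolding smin_def using homog_zmul[OF f that] that by (intro homog_diff homog_scale) auto
  then show ?thesis
    unfolding smintot_def by (intro homog_sum)
qed

lemma sum_sz_homog:
  assumes "homog L k f"
  shows "(\<Sum>x\<in>{1..L}. 2 *\<^sub>R sz N x f) = (real (\<Sum>x\<in>{1..L}. N x) - 2 * of_int k) *\<^sub>R f"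
proof -
  have "(\<Sum>x\<in>{1..L}. 2 * ((real (N x) / 2 - real (c x)) * coef f c))
    = (real (\<Sum>x\<in>{1..L}. N x) - 2 * of_int k) * coef f c" for c
  proof (cases "coef f c = 0")
    case False
    then have "k = int (\<Sum>x\<in>{1..L}. c x)" using assms by (auto simp: homog_def)
    then show ?thesis
      by (simp add: sum_distrib_right[symmetric] sum_distrib_left[symmetric] sum_subtractf
          sum_divide_distrib[symmetric] algebra_simps)
  qed simp
  then show ?thesis by (simp add: vec_eq_iff coef_sz)
qed

text \<open>The norms of the monomials for which \<open>\<partial>\<close> and \<open>N z - z\<^sup>2\<partial>\<close> are adjoint to each other.\<close>

definition wt :: "nat \<Rightarrow> (nat \<Rightarrow> nat) \<Rightarrow> (nat \<Rightarrow> nat) \<Rightarrow> real" where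
  "wt L N c = (\<Prod>x\<in>{1..L}. 1 / real (N x choose c x))"

section \<open>Degree bounds and adjointness in the weighted inner product\<close>

lemma finite_conf: "finite (conf L N)"
proof (rule finite_subset)
  show "conf L N \<subseteq> {c. \<forall>x. (x \<in> {1..L} \<longrightarrow> c x \<in> {0..(\<Sum>x\<in>{1..L}. N x)}) \<and> (x \<notin> {1..L} \<longrightarrow> c x = 0)}"
    unfolding conf_def using member_le_sum[of _ "{1..L}" N] by (fastforce intro: order.trans)
  show "finite {c. \<forall>x. (x \<in> {1..L} \<longrightarrow> c x \<in> {0..(\<Sum>x\<in>{1..L}. N x)}) \<and> (x \<notin> {1..L} \<longrightarrow> c x = (0::nat))}"
    by (rule finite_set_of_finite_funs) auto
qed

lemma finite_weights_conf: "finite_weights (conf L N) (wt L N)"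
  by unfold_locales (rule finite_conf, auto simp: wt_def conf_def intro!: prod_pos)

interpretation chain: finite_weights "conf L N" "wt L N" for L N
  by (rule finite_weights_conf)

lemma chain_supp_iff: "f \<in> chain.supp L N \<longleftrightarrow> (\<forall>c. c \<notin> conf L N \<longrightarrow> coef f c = 0)"
  by (simp add: chain.supp_def)

lemma subspace_supp: "subspace (chain.supp L N)"
  unfolding subspace_def chain.supp_def by auto

lemma conf_Suc_iff:
  "x \<in> {1..L} \<Longrightarrow> c(x := Suc (c x)) \<in> conf L N \<longleftrightarrow> c \<in> conf L N \<and> c x < N x"
proof
  assume x: "x \<in> {1..L}" and c: "c(x := Suc (c x)) \<in> conf L N"
  have "(z \<in> {1..L} \<longrightarrow> c z \<le> N z) \<and> (z \<notin> {1..L} \<longrightarrow> c z = 0)" for z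
    using c x unfolding conf_def by (cases "z = x") (auto dest!: spec[of _ z])
  moreover have "c x < N x" using c x unfolding conf_def by (auto dest!: spec[of _ x])
  ultimately show "c \<in> conf L N \<and> c x < N x" by (simp add: conf_def)
qed (auto simp: conf_def)

lemma supp_pd:
  assumes "f \<in> chain.supp L N" shows "pd x f \<in> chain.supp L N"
proof -
  have "c(x := Suc (c x)) \<notin> conf L N" if "c \<notin> conf L N" for c
  proof (cases "x \<in> {1..L}")
    case True
    then show ?thesis using that conf_Suc_iff by blast
  next
    case False
    then show ?thesis by (auto simp: conf_def)
  qed
  then show ?thesis using assms by (auto simp: chain.supp_def coef_pd)
qed

lemma supp_smin:
  assumes "f \<in> chain.supp L N" "x \<in> {1..L}" shows "smin N x f \<in> chain.supp L N"
  unfolding chain_supp_iff coef_smin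
proof (intro allI impI)
  fix c assume c: "c \<notin> conf L N"
  show "(if c x = 0 then 0 else (real (N x) - real (c x - 1)) * coef f (c(x := c x - 1))) = 0"
  proof (cases "c x = 0 \<or> c(x := c x - 1) \<notin> conf L N")
    case False
    \<comment> \<open>Only the exponent \<open>N x\<close> + 1 is critical, and there the factor
      \<open>N x\<close> - (c x - 1) vanishes: S- annihilates the lowest weight.\<close>
    then have "\<not> c x - 1 < N x"
      using conf_Suc_iff[OF assms(2), of "c(x := c x - 1)" N] c by auto
    moreover have "c x - 1 \<le> N x"
      using False assms(2) by (auto simp: conf_def split: if_splits)
    ultimately show ?thesis by simp
  qed (use assms(1) in \<open>auto simp: chain.supp_def\<close>)
qed

lemma supp_zmul:
  assumes "f \<in> chain.supp L (N(x := N x - 1))" "x \<in> {1..L}" "N x \<ge> 1"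
  shows "zmul x f \<in> chain.supp L N"
  unfolding chain_supp_iff coef_zmul
proof (intro allI impI)
  fix c assume c: "c \<notin> conf L N"
  have "c(x := c x - 1) \<notin> conf L (N(x := N x - 1))" if "c x \<noteq> 0"
  proof
    assume a: "c(x := c x - 1) \<in> conf L (N(x := N x - 1))"
    have "c z \<le> N z" if "z \<in> {1..L}" for z
      using a that assms \<open>c x \<noteq> 0\<close> unfolding conf_def
      by (cases "z = x") (auto dest!: spec[of _ z])
    moreover have "c z = 0" if "z \<notin> {1..L}" for z
      using a that assms unfolding conf_def by (auto dest!: spec[of _ z])
    ultimately show False using c by (auto simp: conf_def)
  qed
  then show "(if c x = 0 then 0 else coef f (c(x := c x - 1))) = 0"
    using assms(1) by (auto simp: chain.supp_def)
qed

lemma supp_sz: "f \<in> chain.supp L N \<Longrightarrow> sz N x f \<in> chain.supp L N"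
  by (auto simp: chain.supp_def coef_sz)

lemmas supp_subspace_intros =
  subspace_0[OF subspace_supp] subspace_add[OF subspace_supp] subspace_diff[OF subspace_supp]
  subspace_neg[OF subspace_supp] subspace_scale[OF subspace_supp] subspace_sum[OF subspace_supp]

lemma supp_bond:
  assumes "f \<in> chain.supp L N" "x \<in> {1..<L}" shows "bond N x f \<in> chain.supp L N"
  unfolding bond_spin using assms
  by (intro supp_subspace_intros supp_pd supp_smin supp_sz) auto

lemma supp_ham: "f \<in> chain.supp L N \<Longrightarrow> ham L N J f \<in> chain.supp L N"
  unfolding ham_def by (intro supp_subspace_intros supp_bond) auto

lemma supp_smintot: "f \<in> chain.supp L N \<Longrightarrow> smintot L N f \<in> chain.supp L N"
  unfolding smintot_def by (intro supp_subspace_intros supp_smin) auto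

lemma supp_dtot: "f \<in> chain.supp L N \<Longrightarrow> dtot L f \<in> chain.supp L N"
  unfolding dtot_def by (intro supp_subspace_intros supp_pd) auto

text \<open>The identity (k + 1) C(N, k + 1) = (N - k) C(N, k), which is what makes the derivative
  and \<open>smin\<close> adjoint.\<close>

lemma wt_Suc:
  assumes "x \<in> {1..L}" "c x < N x"
  shows "wt L N c * real (Suc (c x)) = wt L N (c(x := Suc (c x))) * (real (N x) - real (c x))"
proof -
  have rest: "(\<Prod>z\<in>{1..L} - {x}. 1 / real (N z choose (c(x := Suc (c x))) z))
      = (\<Prod>z\<in>{1..L} - {x}. 1 / real (N z choose c z))"
    by (intro prod.cong) auto
  have split: "wt L N c = 1 / real (N x choose c x) * (\<Prod>z\<in>{1..L} - {x}. 1 / real (N z choose c z))"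
    "wt L N (c(x := Suc (c x))) = 1 / real (N x choose Suc (c x)) * (\<Prod>z\<in>{1..L} - {x}. 1 / real (N z choose c z))"
    using prod.remove[of "{1..L}" x "\<lambda>z. 1 / real (N z choose c z)"]
      prod.remove[of "{1..L}" x "\<lambda>z. 1 / real (N z choose (c(x := Suc (c x))) z)"] assms(1) rest
    by (simp_all add: wt_def)
  have "Suc (c x) * (N x choose Suc (c x)) = (N x - c x) * (N x choose c x)"
    by (simp only: binomial_absorption binomial_absorb_comp)
  then have "real (Suc (c x)) * real (N x choose Suc (c x)) = (real (N x) - real (c x)) * real (N x choose c x)"
    using assms(2) by (metis of_nat_diff of_nat_mult less_imp_le)
  moreover have "real (N x choose c x) > 0" "real (N x choose Suc (c x)) > 0"
    using assms(2) by simp_all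
  ultimately have "1 / real (N x choose c x) * real (Suc (c x))
      = 1 / real (N x choose Suc (c x)) * (real (N x) - real (c x))"
    by (simp add: field_simps)
  moreover have "a * p * r = b * p * s" if "a * r = b * s" for a b p r s :: real
    using that by algebra
  ultimately show ?thesis unfolding split by blast
qed

text \<open>Shift of the summation index by one exponent at x. The boundary terms drop out: f
  vanishes above the top exponent, and \<open>smin\<close> has coefficient 0 at exponent 0.\<close>

lemma ip_pd:
  assumes "f \<in> chain.supp L N" "x \<in> {1..L}"
  shows "chain.ip L N (pd x f) g = chain.ip L N f (smin N x g)"
proof -
  let ?A = "{c \<in> conf L N. c x < N x}" and ?B = "{c \<in> conf L N. c x \<noteq> 0}"
  have "chain.ip L N (pd x f) g = (\<Sum>c\<in>?A. wt L N c * coef (pd x f) c * coef g c)"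
    unfolding chain.ip_def
  proof (rule sum.mono_neutral_right[OF finite_conf])
    show "\<forall>c\<in>conf L N - ?A. wt L N c * coef (pd x f) c * coef g c = 0"
      using assms conf_Suc_iff[OF assms(2)] by (auto simp: coef_pd chain.supp_def)
  qed auto
  also have "\<dots> = (\<Sum>c\<in>?B. wt L N c * coef f c * coef (smin N x g) c)"
  proof (rule sum.reindex_bij_witness[of _ "\<lambda>c. c(x := c x - 1)" "\<lambda>c. c(x := Suc (c x))"])
    fix c assume c: "c \<in> ?A"
    show "c(x := Suc (c x), x := (c(x := Suc (c x))) x - 1) = c" by simp
    show "c(x := Suc (c x)) \<in> ?B" using c conf_Suc_iff[OF assms(2)] by simp
    show "wt L N (c(x := Suc (c x))) * coef f (c(x := Suc (c x))) * coef (smin N x g) (c(x := Suc (c x)))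
       = wt L N c * coef (pd x f) c * coef g c"
      using wt_Suc[of x L c N] assms(2) c by (simp add: coef_smin coef_pd mult_ac)
  next
    fix c assume c: "c \<in> ?B"
    then show "c(x := c x - 1, x := Suc ((c(x := c x - 1)) x)) = c" by simp
    show "c(x := c x - 1) \<in> ?A"
      using c conf_Suc_iff[OF assms(2), of "c(x := c x - 1)" N] by simp
  qed
  also have "\<dots> = chain.ip L N f (smin N x g)"
    unfolding chain.ip_def
    by (rule sum.mono_neutral_left[OF finite_conf]) (auto simp: coef_smin)
  finally show ?thesis .
qed

lemma ip_smin:
  assumes "g \<in> chain.supp L N" "x \<in> {1..L}"
  shows "chain.ip L N (smin N x f) g = chain.ip L N f (pd x g)"
  using ip_pd[OF assms, of f] by (simp add: chain.ip_commute)

lemma ip_sz: "chain.ip L N (sz N x f) g = chain.ip L N f (sz N x g)"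
  by (simp add: chain.ip_def coef_sz mult_ac)

lemma ip_dtot: "f \<in> chain.supp L N \<Longrightarrow> chain.ip L N (dtot L f) g = chain.ip L N f (smintot L N g)"
  unfolding dtot_def smintot_def
  by (subst chain.ip_commute) (simp add: chain.ip_sum_right ip_pd[symmetric] chain.ip_commute)

lemma sz_commute: "sz N x (sz N y f) = sz N y (sz N x f)"
  by (simp add: vec_eq_iff coef_sz)

lemma ip_bond:
  assumes f: "f \<in> chain.supp L N" and g: "g \<in> chain.supp L N" and "x \<in> {1..<L}"
  shows "chain.ip L N f (bond N x g) = chain.ip L N (bond N x f) g"
proof -
  have xs: "x \<in> {1..L}" "Suc x \<in> {1..L}" using assms by auto
  have e: "chain.ip L N f' (pd z (smin N z' g')) = chain.ip L N (pd z' (smin N z f')) g'"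
    if "z \<in> {1..L}" "z' \<in> {1..L}" "f' \<in> chain.supp L N" "g' \<in> chain.supp L N" for f' g' z z'
    using that by (simp add: ip_smin[symmetric] ip_pd supp_smin)
  show ?thesis
    unfolding bond_spin chain.ip_simps
    using e[OF xs f g] e[OF xs(2,1) f g] by (simp add: ip_sz sz_commute)
qed

lemma ip_ham:
  assumes "f \<in> chain.supp L N" "g \<in> chain.supp L N"
  shows "chain.ip L N f (ham L N J g) = chain.ip L N (ham L N J f) g"
proof -
  have "chain.ip L N f (ham L N J g)
      = - (\<Sum>x\<in>{1..<L}. (2 * J x / (real (N x) * real (N (Suc x)))) * chain.ip L N f (bond N x g))"
    unfolding ham_def by (simp add: chain.ip_simps chain.ip_sum_right)
  also have "\<dots> = - (\<Sum>x\<in>{1..<L}. (2 * J x / (real (N x) * real (N (Suc x)))) * chain.ip L N g (bond N x f))"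
    using ip_bond[OF assms] by (simp add: chain.ip_commute)
  also have "\<dots> = chain.ip L N g (ham L N J f)"
    unfolding ham_def by (simp add: chain.ip_simps chain.ip_sum_right)
  finally show ?thesis by (simp add: chain.ip_commute)
qed

section \<open>Highest weight spaces and their ground state energies\<close>

definition hw :: "nat \<Rightarrow> (nat \<Rightarrow> nat) \<Rightarrow> int \<Rightarrow> pol set" where
  "hw L N k = {f \<in> chain.supp L N. homog L k f \<and> dtot L f = 0}"

lemma subspace_hw: "subspace (hw L N k)"
  unfolding subspace_def hw_def
  by (auto simp: tot_simps intro: homog_add homog_scale supp_subspace_intros)

lemma ham_hw: "f \<in> hw L N k \<Longrightarrow> ham L N J f \<in> hw L N k"
  by (simp add: hw_def supp_ham homog_ham dtot_ham tot_simps)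

lemma hw_closed:
  fixes u :: "nat \<Rightarrow> pol"
  assumes u: "\<And>m. u m \<in> hw L N k" and lim: "\<And>c. (\<lambda>m. coef (u m) c) \<longlonglongrightarrow> coef l c"
  shows "l \<in> hw L N k"
proof -
  have zero: "coef l c = 0" if "\<And>m. coef (u m) c = 0" for c
    using lim[of c] that by (simp add: LIMSEQ_const_iff)
  have "coef (dtot L l) c = 0" for c
  proof -
    have "(\<lambda>m. coef (dtot L (u m)) c) \<longlonglongrightarrow> coef (dtot L l) c"
      unfolding dtot_def coef_sum coef_pd by (intro tendsto_intros lim)
    then show ?thesis using u by (simp add: hw_def LIMSEQ_const_iff)
  qed
  then have "dtot L l = 0" by (simp add: vec_eq_iff)
  moreover have "homog L k l"
    unfolding homog_def
  proof (intro allI impI)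
    fix c assume "coef l c \<noteq> 0"
    then obtain m where "coef (u m) c \<noteq> 0" using zero by blast
    then show "int (\<Sum>x\<in>{1..L}. c x) = k" using u[of m] by (auto simp: hw_def homog_def)
  qed
  moreover have "l \<in> chain.supp L N"
    using u zero by (auto simp: hw_def chain.supp_def)
  ultimately show ?thesis by (simp add: hw_def)
qed

text \<open>The combination covers both \<open>ham\<close> itself and the shifted operator c -
  \<open>ham\<close>.\<close>

lemma symmetric_ham:
  "symmetric_operator (conf L N) (wt L N) (\<lambda>f. a *\<^sub>R f + b *\<^sub>R ham L N J f) (hw L N k)"
proof (intro symmetric_operator.intro symmetric_operator_axioms.intro finite_weights_conf)
  show "linear (\<lambda>f. a *\<^sub>R f + b *\<^sub>R ham L N J f)"
    by (intro linearI) (simp_all add: tot_simps algebra_simps)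
  show "subspace (hw L N k)" by (rule subspace_hw)
  show "hw L N k \<subseteq> chain.supp L N" by (auto simp: hw_def)
  show "a *\<^sub>R f + b *\<^sub>R ham L N J f \<in> hw L N k" if "f \<in> hw L N k" for f
    using that ham_hw subspace_hw by (intro subspace_add subspace_scale) auto
  show "chain.ip L N f (a *\<^sub>R g + b *\<^sub>R ham L N J g) = chain.ip L N (a *\<^sub>R f + b *\<^sub>R ham L N J f) g"
    if "f \<in> hw L N k" "g \<in> hw L N k" for f g
    using that ip_ham[of f L N g J] by (simp add: chain.ip_simps hw_def)
qed (rule hw_closed)

text \<open>A relation and not a function, so that a zero space needs no default energy. It records
  both an attained eigenvalue and the variational bound.\<close>

definition gse :: "nat \<Rightarrow> (nat \<Rightarrow> nat) \<Rightarrow> (nat \<Rightarrow> real) \<Rightarrow> int \<Rightarrow> real \<Rightarrow> bool" where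
  "gse L N J k e \<longleftrightarrow> (\<exists>v\<in>hw L N k. v \<noteq> 0 \<and> ham L N J v = e *\<^sub>R v)
     \<and> (\<forall>u\<in>hw L N k. e * chain.ip L N u u \<le> chain.ip L N u (ham L N J u))"

lemma gse_exists: "v \<in> hw L N k \<Longrightarrow> v \<noteq> 0 \<Longrightarrow> \<exists>e. gse L N J k e"
  using symmetric_operator.ground_state_exists[OF symmetric_ham[of L N 0 1 J k], of v]
  unfolding gse_def by simp

lemma gse_le:
  assumes "gse L N J k e" "v \<in> hw L N k" "v \<noteq> 0" "ham L N J v = e' *\<^sub>R v"
  shows "e \<le> e'"
proof -
  have "e * chain.ip L N v v \<le> e' * chain.ip L N v v"
    using assms by (auto simp: gse_def chain.ip_simps)
  moreover have "chain.ip L N v v > 0"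
    using assms by (intro chain.ip_self_pos) (auto simp: hw_def)
  ultimately show ?thesis by simp
qed

lemma comp_fun_commute_dmul: "comp_fun_commute (\<lambda>(a, b). dmul a b)"
  by unfold_locales (auto simp: fun_eq_iff dmul_commute)

section \<open>Products of differences\<close>

text \<open>The fold over a multiset is well defined because multiplications by differences commute.
  A pair (a, b) is thought of as an arc from a to b.\<close>

definition gen :: "(nat \<times> nat) multiset \<Rightarrow> pol" where
  "gen M = fold_mset (\<lambda>(a, b). dmul a b) one_pol M"

lemma gen_empty [simp]: "gen {#} = one_pol"
  by (simp add: gen_def)

lemma gen_add: "gen (add_mset (a, b) M) = dmul a b (gen M)"
  unfolding gen_def using comp_fun_commute.fold_mset_add_mset[OF comp_fun_commute_dmul] by simp

definition deg :: "(nat \<times> nat) multiset \<Rightarrow> nat \<Rightarrow> nat" where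
  "deg M x = size (filter_mset (\<lambda>e. fst e = x \<or> snd e = x) M)"

lemma deg_empty [simp]: "deg {#} x = 0"
  by (simp add: deg_def)

lemma deg_add: "deg (add_mset (a, b) M) x = deg M x + (if a = x \<or> b = x then 1 else 0)"
  by (auto simp: deg_def)

text \<open>Site x offers \<open>N x\<close> places for arc ends. Crossing arcs are allowed: the
  products become dependent, but every exchange of ends between neighbouring sites stays within the
  family.\<close>

definition arcs :: "nat \<Rightarrow> (nat \<Rightarrow> nat) \<Rightarrow> nat \<Rightarrow> (nat \<times> nat) multiset set" where
  "arcs L N n = {M. size M = n \<and> (\<forall>(a, b)\<in>#M. 1 \<le> a \<and> a < b \<and> b \<le> L) \<and> (\<forall>x\<in>{1..L}. deg M x \<le> N x)}"

lemma finite_arcs: "finite (arcs L N n)"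
proof (rule finite_subset)
  show "arcs L N n \<subseteq> {M. set_mset M \<subseteq> {1..L} \<times> {1..L} \<and> size M = n}"
    unfolding arcs_def by fastforce
  show "finite {M. set_mset M \<subseteq> {1..L} \<times> {1..L} \<and> size M = n}"
    using finite_multisets_of_size[of "{1..L} \<times> {1..L}" n] by (simp add: multisets_of_size_def)
qed

lemma pd_dmul: "pd z (dmul a b f) = dmul a b (pd z f) + (if z = a then f else 0) - (if z = b then f else 0)"
  unfolding dmul_def by (cases "z = a"; cases "z = b") (auto simp: weyl_simps)

lemma dtot_dmul:
  assumes "a \<in> {1..L}" "b \<in> {1..L}"
  shows "dtot L (dmul a b f) = dmul a b (dtot L f)"
  using assms by (simp add: dtot_def pd_dmul sum.distrib sum_subtractf dmul_simps)

lemma one_pol_supp: "one_pol \<in> chain.supp L N"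
  unfolding chain_supp_iff by (auto simp: one_pol_def conf_def)

lemma homog_one: "homog L 0 one_pol"
  by (auto simp: homog_def one_pol_def)

lemma gen_supp:
  assumes "\<forall>(a, b)\<in>#M. 1 \<le> a \<and> a < b \<and> b \<le> L" "\<forall>x\<in>{1..L}. deg M x \<le> N x"
  shows "gen M \<in> chain.supp L N"
  using assms
proof (induction M arbitrary: N)
  case empty
  show ?case by (simp add: one_pol_supp)
next
  case (add e M)
  obtain a b where e: "e = (a, b)" by force
  have ab: "a \<in> {1..L}" "b \<in> {1..L}" "a \<noteq> b" using add.prems(1) e by auto
  have d: "deg M x + (if a = x \<or> b = x then 1 else 0) \<le> N x" if "x \<in> {1..L}" for x
    using add.prems(2) that by (auto simp: e deg_add)
  \<comment> \<open>Multiplication by one variable uses up a place at that site only, so the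
    induction hypothesis is taken with \<open>N\<close> lowered at a, respectively at b.\<close>
  have z: "zmul x (gen M) \<in> chain.supp L N" if "x = a \<or> x = b" for x
  proof (rule supp_zmul)
    show "gen M \<in> chain.supp L (N(x := N x - 1))"
    proof (rule add.IH)
      show "\<forall>y\<in>{1..L}. deg M y \<le> (N(x := N x - 1)) y"
      proof
        fix y assume y: "y \<in> {1..L}"
        show "deg M y \<le> (N(x := N x - 1)) y"
          using d[OF y] that by (cases "y = x") auto
      qed
    qed (use add.prems in auto)
    show "x \<in> {1..L}" "N x \<ge> 1" using d[of x] that ab by auto
  qed
  show ?case unfolding e gen_add dmul_def
    using z by (intro supp_subspace_intros) auto
qed

lemma gen_homog: "\<forall>(a, b)\<in>#M. 1 \<le> a \<and> a < b \<and> b \<le> L \<Longrightarrow> homog L (int (size M)) (gen M)"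
proof (induction M)
  case empty
  show ?case by (simp add: homog_one)
next
  case (add e M)
  obtain a b where e: "e = (a, b)" by force
  then show ?case
    using homog_dmul[of L "int (size M)" "gen M" a b] add by (simp add: gen_add add.commute)
qed

lemma gen_dtot: "\<forall>(a, b)\<in>#M. 1 \<le> a \<and> a < b \<and> b \<le> L \<Longrightarrow> dtot L (gen M) = 0"
proof (induction M)
  case empty
  show ?case by (simp add: dtot_def)
next
  case (add e M)
  obtain a b where e: "e = (a, b)" by force
  then show ?case using add by (simp add: gen_add dtot_dmul dmul_simps)
qed

lemma gen_hw: "M \<in> arcs L N n \<Longrightarrow> gen M \<in> hw L N (int n)"
  using gen_supp[of M L N] gen_homog[of M L] gen_dtot[of M L] by (auto simp: arcs_def hw_def)

text \<open>Evaluation at the decreasing point \<open>z\<^sub>x = L + 1 - x\<close>, where every product of differences is positive.\<close>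

definition ev :: "nat \<Rightarrow> (nat \<Rightarrow> nat) \<Rightarrow> pol \<Rightarrow> real" where
  "ev L N f = (\<Sum>c\<in>conf L N. coef f c * (\<Prod>x\<in>{1..L}. (real (Suc L) - real x) ^ c x))"

lemma linear_ev: "linear (ev L N)"
  by (intro linearI) (simp_all add: ev_def algebra_simps sum.distrib sum_distrib_left)

text \<open>\<open>ev\<close> sums over \<open>conf L N\<close> only, so it respects multiplication
  by z_a when this truncation is lowered along with it; L + 1 - a is the value of z_a.\<close>

lemma ev_zmul:
  assumes "a \<in> {1..L}" "N a \<ge> 1"
  shows "ev L N (zmul a f) = (real (Suc L) - real a) * ev L (N(a := N a - 1)) f"
proof -
  let ?p = "\<lambda>c :: nat \<Rightarrow> nat. \<Prod>x\<in>{1..L}. (real (Suc L) - real x) ^ c x"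
  let ?A = "conf L (N(a := N a - 1))" and ?B = "{c \<in> conf L N. c a \<noteq> 0}"
  have p: "?p (c(a := Suc (c a))) = (real (Suc L) - real a) * ?p c" for c
    using assms(1) prod.remove[of "{1..L}" a "\<lambda>x. (real (Suc L) - real x) ^ (c(a := Suc (c a))) x"]
      prod.remove[of "{1..L}" a "\<lambda>x. (real (Suc L) - real x) ^ c x"] by simp
  have "ev L N (zmul a f) = (\<Sum>c\<in>?B. coef (zmul a f) c * ?p c)"
    unfolding ev_def by (rule sum.mono_neutral_right[OF finite_conf]) (auto simp: coef_zmul)
  also have "\<dots> = (\<Sum>c\<in>?A. coef f c * ((real (Suc L) - real a) * ?p c))"
  proof (rule sum.reindex_bij_witness[of _ "\<lambda>c. c(a := Suc (c a))" "\<lambda>c. c(a := c a - 1)"])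
    fix c assume c: "c \<in> ?B"
    then show "c(a := c a - 1, a := Suc ((c(a := c a - 1)) a)) = c" by simp
    show "c(a := c a - 1) \<in> ?A" using c by (auto simp: conf_def)
    show "coef f (c(a := c a - 1)) * ((real (Suc L) - real a) * ?p (c(a := c a - 1))) = coef (zmul a f) c * ?p c"
      using c p[of "c(a := c a - 1)"] by (simp add: coef_zmul)
  next
    fix c assume c: "c \<in> ?A"
    show "c(a := Suc (c a), a := (c(a := Suc (c a))) a - 1) = c" by simp
    have "c \<in> conf L N" "c a < N a"
    proof -
      have "(z \<in> {1..L} \<longrightarrow> c z \<le> N z) \<and> (z \<notin> {1..L} \<longrightarrow> c z = 0)" for z
        using c assms unfolding conf_def by (cases "z = a") (auto dest!: spec[of _ z])
      then show "c \<in> conf L N" by (simp add: conf_def)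
      show "c a < N a" using c assms unfolding conf_def by (auto dest!: spec[of _ a])
    qed
    then show "c(a := Suc (c a)) \<in> ?B" using conf_Suc_iff[OF assms(1)] by simp
  qed
  also have "\<dots> = (real (Suc L) - real a) * ev L (N(a := N a - 1)) f"
    by (simp add: ev_def sum_distrib_left mult_ac)
  finally show ?thesis .
qed

lemma ev_gen:
  assumes "\<forall>(a, b)\<in>#M. 1 \<le> a \<and> a < b \<and> b \<le> L" "\<forall>x\<in>{1..L}. deg M x \<le> N x"
  shows "ev L N (gen M) = (\<Prod>(a, b)\<in>#M. real b - real a)"
  using assms
proof (induction M arbitrary: N)
  case empty
  have "(\<Sum>c\<in>conf L N. coef one_pol c * (\<Prod>x\<in>{1..L}. (real (Suc L) - real x) ^ c x))
     = (\<Sum>c\<in>{\<lambda>_. 0}. coef one_pol c * (\<Prod>x\<in>{1..L}. (real (Suc L) - real x) ^ c x))"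
    by (rule sum.mono_neutral_right[OF finite_conf]) (auto simp: one_pol_def conf_def)
  then show ?case by (simp add: ev_def one_pol_def)
next
  case (add e M)
  obtain a b where e: "e = (a, b)" by force
  have ab: "a \<in> {1..L}" "b \<in> {1..L}" "a \<noteq> b" using add.prems(1) e by auto
  have d: "deg M x + (if a = x \<or> b = x then 1 else 0) \<le> N x" if "x \<in> {1..L}" for x
    using add.prems(2) that by (auto simp: e deg_add)
  have z: "ev L N (zmul x (gen M)) = (real (Suc L) - real x) * (\<Prod>(a, b)\<in>#M. real b - real a)"
    if "x = a \<or> x = b" for x
  proof -
    have "ev L (N(x := N x - 1)) (gen M) = (\<Prod>(a, b)\<in>#M. real b - real a)"
    proof (rule add.IH)
      show "\<forall>y\<in>{1..L}. deg M y \<le> (N(x := N x - 1)) y"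
      proof
        fix y assume y: "y \<in> {1..L}"
        show "deg M y \<le> (N(x := N x - 1)) y"
          using d[OF y] that by (cases "y = x") auto
      qed
    qed (use add.prems in auto)
    then show ?thesis using ev_zmul[of x L N "gen M"] d[of x] that ab by auto
  qed
  show ?case unfolding e gen_add dmul_def
    using z[of a] z[of b] by (simp add: linear_diff[OF linear_ev] algebra_simps)
qed

lemma ev_gen_pos:
  assumes "M \<in> arcs L N n" shows "0 < ev L N (gen M)"
proof -
  have M: "\<forall>(a, b)\<in>#M. 1 \<le> a \<and> a < b \<and> b \<le> L" using assms by (simp add: arcs_def)
  then have "0 < (\<Prod>(a, b)\<in>#M. real b - real a)" by (induction M) auto
  then show ?thesis using ev_gen[OF M, of N] assms by (auto simp: arcs_def)
qed

lemma gen_nonzero: "M \<in> arcs L N n \<Longrightarrow> gen M \<noteq> 0"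
  using ev_gen_pos[of M L N n] linear_0[OF linear_ev] by fastforce

section \<open>The action of a bond\<close>

definition touches :: "nat \<Rightarrow> nat \<times> nat \<Rightarrow> bool" where
  "touches x e \<longleftrightarrow> fst e = x \<or> snd e = x"

definition swap_site :: "nat \<Rightarrow> nat \<Rightarrow> nat" where
  "swap_site x z = (if z = x then Suc x else if z = Suc x then x else z)"

definition move :: "nat \<Rightarrow> nat \<times> nat \<Rightarrow> nat \<times> nat" where
  "move x e = (swap_site x (fst e), swap_site x (snd e))"

text \<open>Direct arcs (x, x + 1) are left out, since moving one would reverse it and change the
  sign of its factor; they are counted separately.\<close>

definition left_arcs :: "nat \<Rightarrow> (nat \<times> nat) multiset \<Rightarrow> (nat \<times> nat) multiset" where
  "left_arcs x M = filter_mset (\<lambda>e. touches x e \<and> \<not> touches (Suc x) e) M"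

definition right_arcs :: "nat \<Rightarrow> (nat \<times> nat) multiset \<Rightarrow> (nat \<times> nat) multiset" where
  "right_arcs x M = filter_mset (\<lambda>e. touches (Suc x) e \<and> \<not> touches x e) M"

definition repl :: "nat \<Rightarrow> nat \<times> nat \<Rightarrow> (nat \<times> nat) multiset \<Rightarrow> (nat \<times> nat) multiset" where
  "repl x e M = add_mset (move x e) (M - {#e#})"

lemma deg_touches: "deg M x = size (filter_mset (touches x) M)"
  by (simp add: deg_def touches_def[abs_def])

lemma swap_site_swap_site [simp]: "swap_site x (swap_site x z) = z"
  by (simp add: swap_site_def)

lemma move_move [simp]: "move x (move x e) = e"
  by (simp add: move_def)

lemma touches_move: "touches z (move x e) \<longleftrightarrow> touches (swap_site x z) e"
  by (auto simp: touches_def move_def swap_site_def)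

lemma repl_repl_move: "e \<in># M \<Longrightarrow> repl x (move x e) (repl x e M) = M"
  by (simp add: repl_def)

lemma repl_add: "e \<in># M \<Longrightarrow> repl x e (add_mset d M) = add_mset d (repl x e M)"
  by (simp add: repl_def add_mset_commute)

lemma size_deg_left: "\<forall>(a, b)\<in>#M. a < b \<Longrightarrow> deg M x = size (left_arcs x M) + count M (x, Suc x)"
  by (induction M) (auto simp: deg_add left_arcs_def touches_def split: if_splits)

lemma size_deg_right: "\<forall>(a, b)\<in>#M. a < b \<Longrightarrow> deg M (Suc x) = size (right_arcs x M) + count M (x, Suc x)"
  by (induction M) (auto simp: deg_add right_arcs_def touches_def split: if_splits)

lemma sum_mset_const: "(\<Sum>e\<in>#A. v) = real (size A) *\<^sub>R (v :: 'v::real_vector)"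
  by (induction A) (simp_all add: algebra_simps)

lemma sum_mset_diff: "(\<Sum>e\<in>#A. f e - g e) = (\<Sum>e\<in>#A. f e) - (\<Sum>e\<in>#A. g e :: 'v::real_vector)"
  by (induction A) simp_all

lemma sum_mset_scale: "(\<Sum>e\<in>#A. r *\<^sub>R f e) = r *\<^sub>R (\<Sum>e\<in>#A. f e :: 'v::real_vector)"
  by (induction A) (simp_all add: algebra_simps)

lemma linear_sum_mset: "linear T \<Longrightarrow> T (\<Sum>e\<in>#A. f e) = (\<Sum>e\<in>#A. T (f e))"
  by (induction A) (simp_all add: linear_0 linear_add)

lemma sum_mset_cong: "(\<And>e. e \<in># A \<Longrightarrow> f e = g e) \<Longrightarrow> (\<Sum>e\<in>#A. f e) = (\<Sum>e\<in>#A. g e)"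
  by (metis image_mset_cong)

text \<open>Leibniz rule: differentiation removes the factor of an arc (x, b), and the new factor is
  z_x - z_{x+1} = (z_x - z_b) - (z_{x+1} - z_b), the old arc minus the moved one. Arcs (a, x) behave
  alike, and a direct arc is restored.\<close>

lemma dmul_pd_left:
  assumes "\<forall>(a, b)\<in>#M. a < b"
  shows "dmul x (Suc x) (pd x (gen M))
    = (\<Sum>e\<in>#left_arcs x M. gen M - gen (repl x e M)) + real (count M (x, Suc x)) *\<^sub>R gen M"
  using assms
proof (induction M)
  case empty
  show ?case by (simp add: left_arcs_def dmul_simps)
next
  case (add d M)
  obtain a b where d: "d = (a, b)" by force
  have ab: "a < b" using add.prems d by simp
  have sum: "(\<Sum>e\<in>#left_arcs x M. gen (add_mset d M) - gen (repl x e (add_mset d M)))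
     = dmul a b (\<Sum>e\<in>#left_arcs x M. gen M - gen (repl x e M))"
    unfolding linear_sum_mset[OF linear_dmul]
    by (rule sum_mset_cong) (simp add: left_arcs_def repl_add d gen_add dmul_simps)
  have "dmul x (Suc x) (pd x (gen (add_mset d M)))
     = dmul a b (dmul x (Suc x) (pd x (gen M)))
       + dmul x (Suc x) ((if x = a then gen M else 0) - (if x = b then gen M else 0))"
    by (simp add: d gen_add pd_dmul dmul_simps dmul_commute)
  also have "dmul a b (dmul x (Suc x) (pd x (gen M)))
     = (\<Sum>e\<in>#left_arcs x M. gen (add_mset d M) - gen (repl x e (add_mset d M)))
       + real (count M (x, Suc x)) *\<^sub>R gen (add_mset d M)"
    using add unfolding sum by (simp add: d dmul_simps gen_add)
  finally have *: "dmul x (Suc x) (pd x (gen (add_mset d M)))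
     = (\<Sum>e\<in>#left_arcs x M. gen (add_mset d M) - gen (repl x e (add_mset d M)))
       + real (count M (x, Suc x)) *\<^sub>R gen (add_mset d M)
       + dmul x (Suc x) ((if x = a then gen M else 0) - (if x = b then gen M else 0))" .
  consider "d = (x, Suc x)" | "a = x" "b \<noteq> Suc x" | "b = x" | "a \<noteq> x" "b \<noteq> x" using d by blast
  then show ?case
  proof cases
    case 1
    then have "left_arcs x (add_mset d M) = left_arcs x M" by (simp add: left_arcs_def touches_def)
    then show ?thesis unfolding * using 1 d by (simp add: gen_add algebra_simps)
  next
    case 2
    then have "left_arcs x (add_mset d M) = add_mset d (left_arcs x M)"
      using ab d by (simp add: left_arcs_def touches_def)
    moreover have "repl x d (add_mset d M) = add_mset (Suc x, b) M"
      using 2 ab d by (simp add: repl_def move_def swap_site_def)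
    ultimately show ?thesis unfolding * using 2 ab d by (simp add: gen_add dmul_def[of _ _ "gen M"])
  next
    case 3
    then have "left_arcs x (add_mset d M) = add_mset d (left_arcs x M)"
      using ab d by (simp add: left_arcs_def touches_def)
    moreover have "repl x d (add_mset d M) = add_mset (a, Suc x) M"
      using 3 ab d by (simp add: repl_def move_def swap_site_def)
    ultimately show ?thesis unfolding * using 3 ab d
      by (simp add: gen_add dmul_simps dmul_def[of _ _ "gen M"])
  next
    case 4
    then have "left_arcs x (add_mset d M) = left_arcs x M"
      using d by (simp add: left_arcs_def touches_def)
    then show ?thesis unfolding * using 4 d by (simp add: dmul_simps)
  qed
qed

text \<open>The mirror image at x + 1, with opposite signs.\<close>

lemma dmul_pd_right:
  assumes "\<forall>(a, b)\<in>#M. a < b"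
  shows "dmul x (Suc x) (pd (Suc x) (gen M))
    = (\<Sum>e\<in>#right_arcs x M. gen (repl x e M) - gen M) - real (count M (x, Suc x)) *\<^sub>R gen M"
  using assms
proof (induction M)
  case empty
  show ?case by (simp add: right_arcs_def dmul_simps)
next
  case (add d M)
  obtain a b where d: "d = (a, b)" by force
  have ab: "a < b" using add.prems d by simp
  have sum: "(\<Sum>e\<in>#right_arcs x M. gen (repl x e (add_mset d M)) - gen (add_mset d M))
     = dmul a b (\<Sum>e\<in>#right_arcs x M. gen (repl x e M) - gen M)"
    unfolding linear_sum_mset[OF linear_dmul]
    by (rule sum_mset_cong) (simp add: right_arcs_def repl_add d gen_add dmul_simps)
  have "dmul x (Suc x) (pd (Suc x) (gen (add_mset d M)))
     = dmul a b (dmul x (Suc x) (pd (Suc x) (gen M)))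
       + dmul x (Suc x) ((if Suc x = a then gen M else 0) - (if Suc x = b then gen M else 0))"
    by (simp add: d gen_add pd_dmul dmul_simps dmul_commute)
  also have "dmul a b (dmul x (Suc x) (pd (Suc x) (gen M)))
     = (\<Sum>e\<in>#right_arcs x M. gen (repl x e (add_mset d M)) - gen (add_mset d M))
       - real (count M (x, Suc x)) *\<^sub>R gen (add_mset d M)"
    using add unfolding sum by (simp add: d dmul_simps gen_add)
  finally have *: "dmul x (Suc x) (pd (Suc x) (gen (add_mset d M)))
     = (\<Sum>e\<in>#right_arcs x M. gen (repl x e (add_mset d M)) - gen (add_mset d M))
       - real (count M (x, Suc x)) *\<^sub>R gen (add_mset d M)
       + dmul x (Suc x) ((if Suc x = a then gen M else 0) - (if Suc x = b then gen M else 0))" .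
  consider "d = (x, Suc x)" | "b = Suc x" "a \<noteq> x" | "a = Suc x" | "a \<noteq> Suc x" "b \<noteq> Suc x" using d by blast
  then show ?case
  proof cases
    case 1
    then have "right_arcs x (add_mset d M) = right_arcs x M" by (simp add: right_arcs_def touches_def)
    then show ?thesis unfolding * using 1 d by (simp add: gen_add dmul_simps algebra_simps)
  next
    case 2
    then have "right_arcs x (add_mset d M) = add_mset d (right_arcs x M)"
      using ab d by (simp add: right_arcs_def touches_def)
    moreover have "repl x d (add_mset d M) = add_mset (a, x) M"
      using 2 ab d by (simp add: repl_def move_def swap_site_def)
    ultimately show ?thesis unfolding * using 2 ab d
      by (simp add: gen_add dmul_simps dmul_def[of _ _ "gen M"])
  next
    case 3
    then have "right_arcs x (add_mset d M) = add_mset d (right_arcs x M)"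
      using ab d by (simp add: right_arcs_def touches_def)
    moreover have "repl x d (add_mset d M) = add_mset (x, b) M"
      using 3 ab d by (simp add: repl_def move_def swap_site_def)
    ultimately show ?thesis unfolding * using 3 ab d by (simp add: gen_add dmul_def[of _ _ "gen M"])
  next
    case 4
    then have "right_arcs x (add_mset d M) = right_arcs x M"
      using d by (simp add: right_arcs_def touches_def)
    then show ?thesis unfolding * using 4 d by (simp add: dmul_simps)
  qed
qed

lemma move_less: "fst e < snd e \<Longrightarrow> e \<noteq> (x, Suc x) \<Longrightarrow> fst (move x e) < snd (move x e)"
  by (cases e) (auto simp: move_def swap_site_def)

lemma repl_less:
  assumes "\<forall>(a, b)\<in>#M. a < b" "e \<in># M" "e \<noteq> (x, Suc x)"
  shows "\<forall>(a, b)\<in>#repl x e M. a < b"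
  using assms move_less[of e x] by (auto simp: repl_def dest: in_diffD)

lemma left_arcs_repl:
  "e \<in># right_arcs x M \<Longrightarrow> left_arcs x (repl x e M) = add_mset (move x e) (left_arcs x M)"
proof -
  assume e: "e \<in># right_arcs x M"
  then have "filter_mset (\<lambda>e. touches x e \<and> \<not> touches (Suc x) e) (M - {#e#}) = left_arcs x M"
    by (auto simp: left_arcs_def right_arcs_def)
  then show ?thesis using e
    by (auto simp: left_arcs_def right_arcs_def repl_def touches_move swap_site_def)
qed

lemma count_direct_repl:
  "e \<in># right_arcs x M \<Longrightarrow> count (repl x e M) (x, Suc x) = count M (x, Suc x)"
  by (cases e) (auto simp: right_arcs_def repl_def touches_def move_def swap_site_def)

text \<open>The commutator of d/dz_x with z_x - z_{x+1} is 1, so the second-order term is the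
  product of the two first-order operators minus a first-order one.\<close>

lemma dmul_dmul_pd_pd:
  assumes M: "\<forall>(a, b)\<in>#M. a < b"
  shows "dmul x (Suc x) (dmul x (Suc x) (pd x (pd (Suc x) (gen M))))
    = (\<Sum>e\<in>#right_arcs x M. dmul x (Suc x) (pd x (gen (repl x e M))) - dmul x (Suc x) (pd x (gen M)))
      - real (count M (x, Suc x)) *\<^sub>R dmul x (Suc x) (pd x (gen M))
      - dmul x (Suc x) (pd (Suc x) (gen M))"
proof -
  have "dmul x (Suc x) (pd x (dmul x (Suc x) (pd (Suc x) (gen M))))
     = dmul x (Suc x) (dmul x (Suc x) (pd x (pd (Suc x) (gen M)))) + dmul x (Suc x) (pd (Suc x) (gen M))"
    by (simp add: pd_dmul dmul_simps)
  moreover have "dmul x (Suc x) (pd x (dmul x (Suc x) (pd (Suc x) (gen M))))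
     = (\<Sum>e\<in>#right_arcs x M. dmul x (Suc x) (pd x (gen (repl x e M))) - dmul x (Suc x) (pd x (gen M)))
       - real (count M (x, Suc x)) *\<^sub>R dmul x (Suc x) (pd x (gen M))"
    unfolding dmul_pd_right[OF M]
    by (simp add: dmul_simps op_simps linear_sum_mset[OF linear_dmul] linear_sum_mset[OF linear_pd])
  ultimately show ?thesis by (simp add: algebra_simps)
qed

lemma dmul_dmul_pd_pd_gen:
  fixes x :: nat
  assumes M: "\<forall>(a, b)\<in>#M. a < b"
  defines "r \<equiv> right_arcs x M" and "l \<equiv> left_arcs x M" and "p \<equiv> real (count M (x, Suc x))"
  shows "dmul x (Suc x) (dmul x (Suc x) (pd x (pd (Suc x) (gen M))))
    = (real (size l) + p) *\<^sub>R (\<Sum>e\<in>#r. gen (repl x e M)) + (real (size r) + p) *\<^sub>R (\<Sum>e\<in>#l. gen (repl x e M))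
      - (\<Sum>e\<in>#r. \<Sum>e'\<in>#l. gen (repl x e' (repl x e M)))
      - ((real (size l) + p) * (real (size r) + p) - p) *\<^sub>R gen M"
proof -
  \<comment> \<open>The moved arc has become a left arc of the new diagram. It accounts for the
    additional 1, and moving it back gives the term \<open>gen M\<close>.\<close>
  have rep: "dmul x (Suc x) (pd x (gen (repl x e M)))
     = (real (size l) + 1 + p) *\<^sub>R gen (repl x e M) - (\<Sum>e'\<in>#l. gen (repl x e' (repl x e M))) - gen M"
    if e: "e \<in># r" for e
  proof -
    have eM: "e \<in># M" "e \<noteq> (x, Suc x)" using e by (auto simp: r_def right_arcs_def touches_def)
    show ?thesis
      using e unfolding dmul_pd_left[OF repl_less[OF M eM]] r_def l_def p_def
      by (simp add: left_arcs_repl count_direct_repl repl_repl_move[OF eM(1)] sum_mset_diff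
          sum_mset_const algebra_simps)
  qed
  have "(\<Sum>e\<in>#r. dmul x (Suc x) (pd x (gen (repl x e M))) - dmul x (Suc x) (pd x (gen M)))
    = (\<Sum>e\<in>#r. (real (size l) + 1 + p) *\<^sub>R gen (repl x e M) - (\<Sum>e'\<in>#l. gen (repl x e' (repl x e M))) - gen M)
      - real (size r) *\<^sub>R dmul x (Suc x) (pd x (gen M))"
    unfolding sum_mset_diff[of _ "\<lambda>_. dmul x (Suc x) (pd x (gen M))"] sum_mset_const
    by (intro arg_cong2[where f = "(-)"] sum_mset_cong rep refl)
  also have "\<dots> = (real (size l) + 1 + p) *\<^sub>R (\<Sum>e\<in>#r. gen (repl x e M))
      - (\<Sum>e\<in>#r. \<Sum>e'\<in>#l. gen (repl x e' (repl x e M))) - real (size r) *\<^sub>R gen M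
      - real (size r) *\<^sub>R dmul x (Suc x) (pd x (gen M))"
    by (simp add: sum_mset_diff sum_mset_const sum_mset_scale)
  finally show ?thesis
    unfolding dmul_dmul_pd_pd[OF M] dmul_pd_left[OF M] dmul_pd_right[OF M] r_def l_def p_def
    by (simp add: sum_mset_diff sum_mset_const algebra_simps)
qed

text \<open>A bond acts on a product of differences by exchanging, in all possible ways, an end at \<open>x\<close>
  (possibly a free one) with an end at \<open>x + 1\<close>.\<close>

lemma bond_gen:
  assumes M: "\<forall>(a, b)\<in>#M. a < b"
  shows "bond N x (gen M)
    = (real (N x) - real (deg M x)) *\<^sub>R (\<Sum>e\<in>#right_arcs x M. gen (repl x e M))
      + (real (N (Suc x)) - real (deg M (Suc x))) *\<^sub>R (\<Sum>e\<in>#left_arcs x M. gen (repl x e M))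
      + (\<Sum>e\<in>#right_arcs x M. \<Sum>e'\<in>#left_arcs x M. gen (repl x e' (repl x e M)))
      - (real (N x) * real (deg M (Suc x)) + real (N (Suc x)) * real (deg M x)
          - real (deg M x) * real (deg M (Suc x)) + real (count M (x, Suc x))) *\<^sub>R gen M"
  unfolding bond_def dmul_dmul_pd_pd_gen[OF M] dmul_pd_left[OF M] dmul_pd_right[OF M]
    size_deg_left[OF M, of x] size_deg_right[OF M, of x]
  by (simp add: sum_mset_diff sum_mset_const algebra_simps)

section \<open>Positivity of a bond with respect to the cone\<close>

definition kcone :: "nat \<Rightarrow> (nat \<Rightarrow> nat) \<Rightarrow> nat \<Rightarrow> pol set" where
  "kcone L N n = cone_of (arcs L N n) gen"

lemma kcone_gen: "M \<in> arcs L N n \<Longrightarrow> gen M \<in> kcone L N n"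
  unfolding kcone_def by (rule cone_gen[OF finite_arcs])

lemma arcs_less: "M \<in> arcs L N n \<Longrightarrow> \<forall>(a, b)\<in>#M. a < b"
  by (auto simp: arcs_def)

text \<open>Stated additively to avoid truncated subtraction.\<close>

lemma deg_repl: "e \<in># M \<Longrightarrow> deg (repl x e M) z + (if touches z e then 1 else 0)
    = deg M z + (if touches (swap_site x z) e then 1 else 0)"
  by (auto simp: deg_touches repl_def touches_move dest!: multi_member_split)

lemma repl_arcs:
  assumes M: "size M = n" "\<forall>(a, b)\<in>#M. 1 \<le> a \<and> a < b \<and> b \<le> L"
    and x: "x \<in> {1..<L}" and e: "e \<in># M" "e \<noteq> (x, Suc x)"
    and deg: "\<forall>z\<in>{1..L}. deg M z + (if touches (swap_site x z) e then 1 else 0)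
      \<le> N z + (if touches z e then 1 else 0)"
  shows "repl x e M \<in> arcs L N n"
proof -
  have "\<forall>(a, b)\<in>#repl x e M. 1 \<le> a \<and> a < b \<and> b \<le> L"
  proof -
    have "1 \<le> fst (move x e) \<and> snd (move x e) \<le> L"
      using M(2) e x by (cases e) (auto simp: move_def swap_site_def)
    moreover have "fst (move x e) < snd (move x e)"
      using move_less[of e x] M(2) e by auto
    ultimately show ?thesis using M(2) by (auto simp: repl_def dest: in_diffD)
  qed
  moreover have "size (repl x e M) = n"
    using M(1) e(1) by (auto simp: repl_def dest!: multi_member_split)
  moreover have "\<forall>z\<in>{1..L}. deg (repl x e M) z \<le> N z"
  proof
    fix z assume "z \<in> {1..L}"
    with deg have "deg M z + (if touches (swap_site x z) e then 1 else 0)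
      \<le> N z + (if touches z e then 1 else 0)" by blast
    with deg_repl[OF e(1), of x z] show "deg (repl x e M) z \<le> N z" by linarith
  qed
  ultimately show ?thesis by (simp add: arcs_def)
qed

lemma right_arc_move:
  assumes M: "M \<in> arcs L N n" and x: "x \<in> {1..<L}" and e: "e \<in># right_arcs x M" and free: "deg M x < N x"
  shows "repl x e M \<in> arcs L N n"
proof (rule repl_arcs[OF _ _ x])
  show "\<forall>z\<in>{1..L}. deg M z + (if touches (swap_site x z) e then 1 else 0)
      \<le> N z + (if touches z e then 1 else 0)"
  proof
    fix z assume "z \<in> {1..L}"
    then have "deg M z \<le> N z" using M by (simp add: arcs_def)
    then show "deg M z + (if touches (swap_site x z) e then 1 else 0)
      \<le> N z + (if touches z e then 1 else 0)"
      using e free by (auto simp: right_arcs_def swap_site_def)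
  qed
qed (use M e in \<open>auto simp: arcs_def right_arcs_def touches_def\<close>)

lemma left_arc_move:
  assumes M: "M \<in> arcs L N n" and x: "x \<in> {1..<L}" and e: "e \<in># left_arcs x M"
    and free: "deg M (Suc x) < N (Suc x)"
  shows "repl x e M \<in> arcs L N n"
proof (rule repl_arcs[OF _ _ x])
  show "\<forall>z\<in>{1..L}. deg M z + (if touches (swap_site x z) e then 1 else 0)
      \<le> N z + (if touches z e then 1 else 0)"
  proof
    fix z assume "z \<in> {1..L}"
    then have "deg M z \<le> N z" using M by (simp add: arcs_def)
    then show "deg M z + (if touches (swap_site x z) e then 1 else 0)
      \<le> N z + (if touches z e then 1 else 0)"
      using e free by (auto simp: left_arcs_def swap_site_def)
  qed
qed (use M e in \<open>auto simp: arcs_def left_arcs_def touches_def\<close>)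

text \<open>The two sites trade one end each, so the valences are unchanged and no free place is
  involved.\<close>

lemma arc_exchange:
  assumes M: "M \<in> arcs L N n" and x: "x \<in> {1..<L}"
    and e: "e \<in># right_arcs x M" and e': "e' \<in># left_arcs x M"
  shows "repl x e' (repl x e M) \<in> arcs L N n"
proof (rule repl_arcs[OF _ _ x])
  have eM: "e \<in># M" "e \<noteq> (x, Suc x)" using e by (auto simp: right_arcs_def touches_def)
  show "size (repl x e M) = n"
    using M eM by (auto simp: repl_def arcs_def dest!: multi_member_split)
  have "1 \<le> fst (move x e) \<and> snd (move x e) \<le> L"
    using M eM x by (cases e) (auto simp: move_def swap_site_def arcs_def)
  moreover have "fst (move x e) < snd (move x e)"
    using move_less[of e x] M eM by (auto simp: arcs_def)
  ultimately show "\<forall>(a, b)\<in>#repl x e M. 1 \<le> a \<and> a < b \<and> b \<le> L"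
    using M by (auto simp: repl_def arcs_def dest: in_diffD)
  have "e' \<noteq> e" using e e' by (auto simp: right_arcs_def left_arcs_def)
  then show "e' \<in># repl x e M" using e' by (auto simp: repl_def left_arcs_def in_diff_count)
  show "e' \<noteq> (x, Suc x)" using e' by (auto simp: left_arcs_def touches_def)
  show "\<forall>z\<in>{1..L}. deg (repl x e M) z + (if touches (swap_site x z) e' then 1 else 0)
      \<le> N z + (if touches z e' then 1 else 0)"
  proof
    fix z assume z: "z \<in> {1..L}"
    have "deg M z \<le> N z" using M z by (simp add: arcs_def)
    then show "deg (repl x e M) z + (if touches (swap_site x z) e' then 1 else 0)
      \<le> N z + (if touches z e' then 1 else 0)"
      using deg_repl[OF eM(1), of x z] e e'
      by (cases "z = x"; cases "z = Suc x") (auto simp: left_arcs_def right_arcs_def swap_site_def split: if_splits)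
  qed
qed

lemma sum_mset_member: "e \<in># A \<Longrightarrow> (\<Sum>d\<in>#A. f d) = f e + (\<Sum>d\<in>#A - {#e#}. f d :: 'v::real_vector)"
  by (auto dest!: multi_member_split)

text \<open>The diagrams that occur in \<open>bond_gen\<close> with a positive coefficient, together
  with the original one, which acquires a positive coefficient once a constant is added.\<close>

inductive hop :: "(nat \<Rightarrow> nat) \<Rightarrow> nat \<Rightarrow> (nat \<times> nat) multiset \<Rightarrow> (nat \<times> nat) multiset \<Rightarrow> bool"
  for N x M where
  stay: "hop N x M M"
| right: "e \<in># right_arcs x M \<Longrightarrow> deg M x < N x \<Longrightarrow> hop N x M (repl x e M)"
| left: "e \<in># left_arcs x M \<Longrightarrow> deg M (Suc x) < N (Suc x) \<Longrightarrow> hop N x M (repl x e M)"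
| exchange: "e \<in># right_arcs x M \<Longrightarrow> e' \<in># left_arcs x M \<Longrightarrow> hop N x M (repl x e' (repl x e M))"

lemma hop_arcs: "hop N x M M' \<Longrightarrow> M \<in> arcs L N n \<Longrightarrow> x \<in> {1..<L} \<Longrightarrow> M' \<in> arcs L N n"
  by (induction rule: hop.cases) (auto intro: right_arc_move left_arc_move arc_exchange)

text \<open>The diagonal term of \<open>bond_gen\<close> subtracts at most 2 N N' copies of
  \<open>gen M\<close>, and the 1 leaves a further copy for \<open>stay\<close>. The other
  coefficients are natural numbers, so a positive one is at least 1 and a whole
  \<open>gen M'\<close> can be split off.\<close>

lemma bond_gen_dominates:
  assumes M: "M \<in> arcs L N n" and x: "x \<in> {1..<L}" and hop: "hop N x M M'"
    and c: "c \<ge> 2 * real (N x) * real (N (Suc x)) + 1"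
  shows "bond N x (gen M) + c *\<^sub>R gen M - gen M' \<in> kcone L N n"
proof -
  define R where "R = (real (N x) - real (deg M x)) *\<^sub>R (\<Sum>e\<in>#right_arcs x M. gen (repl x e M))"
  define S where "S = (real (N (Suc x)) - real (deg M (Suc x))) *\<^sub>R (\<Sum>e\<in>#left_arcs x M. gen (repl x e M))"
  define E where "E = (\<Sum>e\<in>#right_arcs x M. \<Sum>e'\<in>#left_arcs x M. gen (repl x e' (repl x e M)))"
  define q where "q = c - 1 - (real (N x) * real (deg M (Suc x)) + real (N (Suc x)) * real (deg M x)
          - real (deg M x) * real (deg M (Suc x)) + real (count M (x, Suc x)))"
  note less = arcs_less[OF M]
  have d: "deg M x \<le> N x" "deg M (Suc x) \<le> N (Suc x)" using M x by (auto simp: arcs_def)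
  have q: "q \<ge> 0"
  proof -
    have "real (N x) * real (deg M (Suc x)) \<le> real (N x) * real (N (Suc x))"
      "real (N (Suc x)) * real (deg M x) \<le> real (N (Suc x)) * real (N x)"
      using d by (auto intro: mult_left_mono)
    \<comment> \<open>The number of direct arcs is absorbed by the product of the two valences,
      which enters the diagonal with the favourable sign.\<close>
    moreover have "count M (x, Suc x) \<le> deg M x * deg M (Suc x)"
    proof (cases "count M (x, Suc x) = 0")
      case False
      then have "1 \<le> count M (x, Suc x)" by linarith
      then have "count M (x, Suc x) \<le> deg M x" "1 \<le> deg M (Suc x)"
        using size_deg_left[OF less, of x] size_deg_right[OF less, of x] by linarith+
      then show ?thesis using mult_le_mono by fastforce
    qed simp
    then have "real (count M (x, Suc x)) \<le> real (deg M x) * real (deg M (Suc x))"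
      by (metis of_nat_le_iff of_nat_mult)
    ultimately show ?thesis using c by (simp add: q_def algebra_simps)
  qed
  have K: "kcone L N n = cone_of (arcs L N n) gen" by (simp add: kcone_def)
  have bond: "bond N x (gen M) + c *\<^sub>R gen M = R + S + E + q *\<^sub>R gen M + gen M"
    unfolding bond_gen[OF less] R_def S_def E_def q_def by (simp add: algebra_simps)
  have Rg: "(real (N x) - real (deg M x)) *\<^sub>R gen (repl x e M) \<in> kcone L N n" if "e \<in># right_arcs x M" for e
    using right_arc_move[OF M x that] d unfolding K
    by (cases "deg M x < N x") (auto intro!: cone_scale cone_gen finite_arcs)
  have Sg: "(real (N (Suc x)) - real (deg M (Suc x))) *\<^sub>R gen (repl x e M) \<in> kcone L N n"
    if "e \<in># left_arcs x M" for e
    using left_arc_move[OF M x that] d unfolding K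
    by (cases "deg M (Suc x) < N (Suc x)") (auto intro!: cone_scale cone_gen finite_arcs)
  have RK: "R \<in> kcone L N n"
    using Rg unfolding K R_def sum_mset_scale[symmetric] by (intro cone_sum_mset) auto
  have SK: "S \<in> kcone L N n"
    using Sg unfolding K S_def sum_mset_scale[symmetric] by (intro cone_sum_mset) auto
  have Eg: "gen (repl x e' (repl x e M)) \<in> kcone L N n"
    if "e \<in># right_arcs x M" "e' \<in># left_arcs x M" for e e'
    using arc_exchange[OF M x that] by (rule kcone_gen)
  have EK: "E \<in> kcone L N n"
    using Eg unfolding K E_def by (intro cone_sum_mset) auto
  have gK: "gen M \<in> kcone L N n" using kcone_gen[OF M] .
  have qK: "q *\<^sub>R gen M \<in> kcone L N n" using gK q unfolding K by (rule cone_scale)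
  note add = cone_add[of _ "arcs L N n" gen, folded kcone_def]
  show ?thesis
    using hop
  proof cases
    case stay
    then show ?thesis unfolding bond using RK SK EK qK by (simp add: add)
  next
    case (right e)
    have "R - gen (repl x e M) = (\<Sum>d\<in>#right_arcs x M - {#e#}. (real (N x) - real (deg M x)) *\<^sub>R gen (repl x d M))
       + (real (N x) - real (deg M x) - 1) *\<^sub>R gen (repl x e M)"
      unfolding R_def sum_mset_scale sum_mset_member[OF right(2)] by (simp add: algebra_simps)
    moreover have "\<dots> \<in> kcone L N n"
    proof (rule add)
      show "(\<Sum>d\<in>#right_arcs x M - {#e#}. (real (N x) - real (deg M x)) *\<^sub>R gen (repl x d M)) \<in> kcone L N n"
        unfolding K by (rule cone_sum_mset, rule Rg[unfolded K]) (auto dest: in_diffD)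
      show "(real (N x) - real (deg M x) - 1) *\<^sub>R gen (repl x e M) \<in> kcone L N n"
        using right kcone_gen[OF right_arc_move[OF M x right(2,3)]] unfolding K
        by (intro cone_scale) auto
    qed
    ultimately have "(R - gen (repl x e M)) + S + E + q *\<^sub>R gen M + gen M \<in> kcone L N n"
      using SK EK qK gK by (intro add) auto
    then show ?thesis unfolding bond right(1) by (simp add: algebra_simps)
  next
    case (left e)
    have "S - gen (repl x e M) = (\<Sum>d\<in>#left_arcs x M - {#e#}. (real (N (Suc x)) - real (deg M (Suc x))) *\<^sub>R gen (repl x d M))
       + (real (N (Suc x)) - real (deg M (Suc x)) - 1) *\<^sub>R gen (repl x e M)"
      unfolding S_def sum_mset_scale sum_mset_member[OF left(2)] by (simp add: algebra_simps)
    moreover have "\<dots> \<in> kcone L N n"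
    proof (rule add)
      show "(\<Sum>d\<in>#left_arcs x M - {#e#}. (real (N (Suc x)) - real (deg M (Suc x))) *\<^sub>R gen (repl x d M))
        \<in> kcone L N n"
        unfolding K by (rule cone_sum_mset, rule Sg[unfolded K]) (auto dest: in_diffD)
      show "(real (N (Suc x)) - real (deg M (Suc x)) - 1) *\<^sub>R gen (repl x e M) \<in> kcone L N n"
        using left kcone_gen[OF left_arc_move[OF M x left(2,3)]] unfolding K
        by (intro cone_scale) auto
    qed
    ultimately have "R + (S - gen (repl x e M)) + E + q *\<^sub>R gen M + gen M \<in> kcone L N n"
      using RK EK qK gK by (intro add) auto
    then show ?thesis unfolding bond left(1) by (simp add: algebra_simps)
  next
    case (exchange e e')
    have "E - gen (repl x e' (repl x e M))
       = (\<Sum>d\<in>#right_arcs x M - {#e#}. \<Sum>d'\<in>#left_arcs x M. gen (repl x d' (repl x d M)))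
       + (\<Sum>d'\<in>#left_arcs x M - {#e'#}. gen (repl x d' (repl x e M)))"
      unfolding E_def sum_mset_member[OF exchange(2)]
        sum_mset_member[OF exchange(3), of "\<lambda>d'. gen (repl x d' (repl x e M))"] by (simp add: algebra_simps)
    moreover have "\<dots> \<in> kcone L N n"
      unfolding K
      by (intro cone_add cone_sum_mset; rule Eg[unfolded K]) (use exchange(2) in \<open>blast dest: in_diffD\<close>)+
    ultimately have "R + S + (E - gen (repl x e' (repl x e M))) + q *\<^sub>R gen M + gen M \<in> kcone L N n"
      using RK SK qK gK by (intro add) auto
    then show ?thesis unfolding bond exchange(1) by (simp add: algebra_simps)
  qed
qed

section \<open>Irreducibility\<close>

text \<open>Bonds between occupied sites must connect all of them, which is what irreducibility
  rests on; the sites beyond m are still to be opened.\<close>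

definition left_packed :: "nat \<Rightarrow> nat \<Rightarrow> (nat \<Rightarrow> nat) \<Rightarrow> bool" where
  "left_packed L m N \<longleftrightarrow> m \<le> L \<and> (\<forall>x\<in>{1..L}. 1 \<le> N x \<longleftrightarrow> x \<le> m)"

text \<open>The configurations on which none of the elementary exchanges that increase \<open>spread\<close> is possible.\<close>

definition sorted_arcs :: "nat \<Rightarrow> (nat \<Rightarrow> nat) \<Rightarrow> (nat \<times> nat) multiset \<Rightarrow> bool" where
  "sorted_arcs m N M \<longleftrightarrow> (\<forall>x. 1 \<le> x \<and> Suc x \<le> m \<longrightarrow>
     \<not> ((\<exists>a. (a, x) \<in># M) \<and> (\<exists>b. (Suc x, b) \<in># M)) \<and>
     \<not> (deg M x < N x \<and> (\<exists>b. (Suc x, b) \<in># M)) \<and>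
     \<not> ((\<exists>a. (a, x) \<in># M) \<and> deg M (Suc x) < N (Suc x)) \<and>
     \<not> (\<exists>b b'. (x, b) \<in># M \<and> (Suc x, b') \<in># M \<and> b' < b))"

text \<open>An arc of length l contributes l (2 L - l), which increases up to l = L and is strictly
  concave. Lengthening an arc raises the sum, and so does bringing the lengths of two nested arcs
  closer to each other.\<close>

definition spread :: "nat \<Rightarrow> (nat \<times> nat) multiset \<Rightarrow> int" where
  "spread L M = (\<Sum>(a, b)\<in>#M. (int b - int a) * (2 * int L - (int b - int a)))"

text \<open>A three-term relation, like \<open>dmul_swap_nested\<close>. The right-hand sides are
  again products of differences with the correct sign, so the exchanges used for sorting move
  upwards in the cone order.\<close>

lemma dmul_swap_cross: "dmul a y (dmul x d f) - dmul a x (dmul y d f) = dmul a d (dmul x y f)"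
  unfolding dmul_def by (simp add: op_simps zmul_commute algebra_simps)

lemma dmul_swap_nested: "dmul x b' (dmul y b f) - dmul x b (dmul y b' f) = dmul x y (dmul b' b f)"
  unfolding dmul_def by (simp add: op_simps zmul_commute algebra_simps)

lemma dmul_chain: "dmul a c f - dmul a b f = dmul b c f" "dmul a c f - dmul b c f = dmul a b f"
  by (simp_all add: dmul_def)

lemma arcs_memberD:
  "M \<in> arcs L N n \<Longrightarrow> (a, b) \<in># M \<Longrightarrow> 1 \<le> a \<and> a < b \<and> b \<le> L \<and> 1 \<le> N a \<and> 1 \<le> N b"
proof -
  assume M: "M \<in> arcs L N n" and e: "(a, b) \<in># M"
  then have ab: "1 \<le> a \<and> a < b \<and> b \<le> L" by (auto simp: arcs_def)
  have "1 \<le> deg M a" "1 \<le> deg M b"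
    using e by (auto simp: deg_add dest!: multi_member_split)
  moreover have "deg M a \<le> N a" "deg M b \<le> N b" using M ab by (auto simp: arcs_def)
  ultimately show ?thesis using ab by linarith
qed

lemma arcs_replace:
  assumes "A + M \<in> arcs L N n" "size B = size A"
    and "\<forall>(a, b)\<in>#B. 1 \<le> a \<and> a < b \<and> b \<le> L"
    and "\<forall>x\<in>{1..L}. deg (B + M) x \<le> N x"
  shows "B + M \<in> arcs L N n"
  using assms by (auto simp: arcs_def)

text \<open>Each of the four violations is removed by one exchange that adds a single generator. The
  growth of \<open>spread\<close> makes repeated exchanges stop.\<close>

lemma unsorted_step:
  assumes M: "M \<in> arcs L N n" and left_packed: "left_packed L m N" and unsorted: "\<not> sorted_arcs m N M"
  shows "\<exists>x M'. x \<in> {1..<L} \<and> Suc x \<le> m \<and> hop N x M M' \<and> gen M' - gen M \<in> kcone L N n \<and> spread L M < spread L M'"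
proof -
  from unsorted obtain x where x: "1 \<le> x" "Suc x \<le> m"
    and cases: "((\<exists>a. (a, x) \<in># M) \<and> (\<exists>b. (Suc x, b) \<in># M)) \<or>
     (deg M x < N x \<and> (\<exists>b. (Suc x, b) \<in># M)) \<or>
     ((\<exists>a. (a, x) \<in># M) \<and> deg M (Suc x) < N (Suc x)) \<or>
     (\<exists>b b'. (x, b) \<in># M \<and> (Suc x, b') \<in># M \<and> b' < b)"
    unfolding sorted_arcs_def by blast
  have xL: "x \<in> {1..<L}" using x left_packed by (auto simp: left_packed_def)
  have arc: "1 \<le> a \<and> a < b \<and> b \<le> L" if "(a, b) \<in># M" for a b using arcs_memberD[OF M that] by simp
  have degM: "deg M z \<le> N z" if "z \<in> {1..L}" for z using M that by (simp add: arcs_def)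
  consider (1) a d where "(a, x) \<in># M" "(Suc x, d) \<in># M"
    | (2) d where "deg M x < N x" "(Suc x, d) \<in># M"
    | (3) a where "(a, x) \<in># M" "deg M (Suc x) < N (Suc x)"
    | (4) b b' where "(x, b) \<in># M" "(Suc x, b') \<in># M" "b' < b"
    using cases by blast
  then show ?thesis
  proof cases
    case 1
    obtain R where MR: "M = add_mset (Suc x, d) (add_mset (a, x) R)"
    proof -
      obtain R1 where R1: "M = add_mset (Suc x, d) R1" using 1 by (blast dest: multi_member_split)
      then have "(a, x) \<in># R1" using 1 arc by fastforce
      then show ?thesis using that R1 by (blast dest: multi_member_split)
    qed
    have ad: "1 \<le> a" "a < x" "Suc x < d" "d \<le> L" using arc 1 by auto
    have e: "(Suc x, d) \<in># right_arcs x M" "(a, x) \<in># left_arcs x M"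
      using 1 ad by (auto simp: right_arcs_def left_arcs_def touches_def)
    have M': "repl x (a, x) (repl x (Suc x, d) M) = add_mset (a, Suc x) (add_mset (x, d) R)"
      using ad unfolding MR by (auto simp: repl_def move_def swap_site_def)
    have "{#(a, d), (x, Suc x)#} + R \<in> arcs L N n"
    proof (rule arcs_replace[of "{#(Suc x, d), (a, x)#}"])
      show "\<forall>z\<in>{1..L}. deg ({#(a, d), (x, Suc x)#} + R) z \<le> N z"
      proof
        fix z assume z: "z \<in> {1..L}"
        show "deg ({#(a, d), (x, Suc x)#} + R) z \<le> N z"
          using degM[OF z] ad unfolding MR by (auto simp: deg_add split: if_splits)
      qed
    qed (use M MR ad x xL in auto)
    from kcone_gen[OF this] have "gen (repl x (a, x) (repl x (Suc x, d) M)) - gen M \<in> kcone L N n"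
      using dmul_swap_cross[of a "Suc x" x d "gen R"] unfolding M'
      by (simp add: MR gen_add dmul_commute)
    moreover have "spread L M < spread L (repl x (a, x) (repl x (Suc x, d) M))"
    proof -
      \<comment> \<open>The increase of \<open>spread\<close> when the lengths x - a and d - x - 1
        both grow by one.\<close>
      have "0 < 4 * int L - 2 * (int x - int a) - 2 * (int d - int x)" using ad x xL by auto
      then show ?thesis unfolding M' by (simp add: spread_def MR algebra_simps)
    qed
    ultimately show ?thesis using xL x hop.exchange[of _ x M _ N, OF e] by blast
  next
    case 2
    define R where "R = M - {#(Suc x, d)#}"
    have MR: "M = add_mset (Suc x, d) R" using 2 unfolding R_def by simp
    have d: "Suc x < d" "d \<le> L" using arc 2 by auto
    have e: "(Suc x, d) \<in># right_arcs x M" using 2 d by (auto simp: right_arcs_def touches_def)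
    have M': "repl x (Suc x, d) M = add_mset (x, d) R"
      using d unfolding MR by (auto simp: repl_def move_def swap_site_def)
    have "{#(x, Suc x)#} + R \<in> arcs L N n"
    proof (rule arcs_replace[of "{#(Suc x, d)#}"])
      show "\<forall>z\<in>{1..L}. deg ({#(x, Suc x)#} + R) z \<le> N z"
      proof
        fix z assume z: "z \<in> {1..L}"
        show "deg ({#(x, Suc x)#} + R) z \<le> N z"
          using degM[OF z] d 2(1) unfolding MR by (auto simp: deg_add split: if_splits)
      qed
    qed (use M MR d x xL in auto)
    from kcone_gen[OF this] have "gen (repl x (Suc x, d) M) - gen M \<in> kcone L N n"
      using dmul_chain(2)[of x d "gen R" "Suc x"] unfolding M' by (simp add: MR gen_add)
    moreover have "spread L M < spread L (repl x (Suc x, d) M)"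
      using d x xL unfolding M' by (simp add: spread_def MR algebra_simps)
    ultimately show ?thesis using xL x hop.right[of _ x M N, OF e] 2(1) by blast
  next
    case 3
    define R where "R = M - {#(a, x)#}"
    have MR: "M = add_mset (a, x) R" using 3 unfolding R_def by simp
    have a: "1 \<le> a" "a < x" using arc 3 by auto
    have e: "(a, x) \<in># left_arcs x M" using 3 a by (auto simp: left_arcs_def touches_def)
    have M': "repl x (a, x) M = add_mset (a, Suc x) R"
      using a unfolding MR by (auto simp: repl_def move_def swap_site_def)
    have "{#(x, Suc x)#} + R \<in> arcs L N n"
    proof (rule arcs_replace[of "{#(a, x)#}"])
      show "\<forall>z\<in>{1..L}. deg ({#(x, Suc x)#} + R) z \<le> N z"
      proof
        fix z assume z: "z \<in> {1..L}"
        show "deg ({#(x, Suc x)#} + R) z \<le> N z"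
          using degM[OF z] a 3(2) unfolding MR by (auto simp: deg_add split: if_splits)
      qed
    qed (use M MR a x xL in auto)
    from kcone_gen[OF this] have "gen (repl x (a, x) M) - gen M \<in> kcone L N n"
      using dmul_chain(1)[of a "Suc x" "gen R" x] unfolding M' by (simp add: MR gen_add)
    moreover have "spread L M < spread L (repl x (a, x) M)"
      using a x xL unfolding M' by (simp add: spread_def MR algebra_simps)
    ultimately show ?thesis using xL x hop.left[of _ x M N, OF e] 3(2) by blast
  next
    case 4
    obtain R where MR: "M = add_mset (Suc x, b') (add_mset (x, b) R)"
    proof -
      obtain R1 where R1: "M = add_mset (Suc x, b') R1" using 4 by (blast dest: multi_member_split)
      then have "(x, b) \<in># R1" using 4 by auto
      then show ?thesis using that R1 by (blast dest: multi_member_split)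
    qed
    have bb: "Suc x < b'" "b' < b" "b \<le> L" using arc 4 by auto
    have e: "(Suc x, b') \<in># right_arcs x M" "(x, b) \<in># left_arcs x M"
      using 4 bb by (auto simp: right_arcs_def left_arcs_def touches_def)
    have M': "repl x (x, b) (repl x (Suc x, b') M) = add_mset (Suc x, b) (add_mset (x, b') R)"
      using bb unfolding MR by (auto simp: repl_def move_def swap_site_def)
    have "{#(x, Suc x), (b', b)#} + R \<in> arcs L N n"
    proof (rule arcs_replace[of "{#(Suc x, b'), (x, b)#}"])
      show "\<forall>z\<in>{1..L}. deg ({#(x, Suc x), (b', b)#} + R) z \<le> N z"
      proof
        fix z assume z: "z \<in> {1..L}"
        show "deg ({#(x, Suc x), (b', b)#} + R) z \<le> N z"
          using degM[OF z] bb unfolding MR by (auto simp: deg_add split: if_splits)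
      qed
    qed (use M MR bb x xL in auto)
    from kcone_gen[OF this] have "gen (repl x (x, b) (repl x (Suc x, b') M)) - gen M \<in> kcone L N n"
      using dmul_swap_nested[of x b' "Suc x" b "gen R"] unfolding M'
      by (simp add: MR gen_add dmul_commute)
    moreover have "spread L M < spread L (repl x (x, b) (repl x (Suc x, b') M))"
      using bb x xL unfolding M' by (simp add: spread_def MR algebra_simps)
    ultimately show ?thesis using xL x hop.exchange[of _ x M _ N, OF e] by blast
  qed
qed

section \<open>Uniqueness of the sorted configuration\<close>

lemma deg_split: "\<forall>(a, b)\<in>#M. a < b \<Longrightarrow>
    deg M x = size (filter_mset (\<lambda>e. fst e = x) M) + size (filter_mset (\<lambda>e. snd e = x) M)"
  by (induction M) (auto simp: deg_add split: if_splits)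

lemma size_filter_sum:
  "finite A \<Longrightarrow> size (filter_mset (\<lambda>e. f e \<in> A) M) = (\<Sum>x\<in>A. size (filter_mset (\<lambda>e. f e = x) M))"
proof (induction M)
  case (add d M)
  have "(\<Sum>x\<in>A. size (filter_mset (\<lambda>e. f e = x) (add_mset d M)))
    = (\<Sum>x\<in>A. size (filter_mset (\<lambda>e. f e = x) M) + (if f d = x then 1 else 0))"
    by (intro sum.cong) auto
  then show ?case using add by (simp add: sum.distrib sum.delta)
qed simp

lemma filter_mset_empty_iff: "filter_mset P M = {#} \<longleftrightarrow> (\<forall>x\<in>#M. \<not> P x)"
  by (induction M) auto

lemma deg_pos: "1 \<le> deg M x \<Longrightarrow> \<exists>e\<in>#M. fst e = x \<or> snd e = x"
  by (induction M) (auto simp: deg_add split: if_splits)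

lemma size_filter_compl: "size (filter_mset P M) + size (filter_mset (\<lambda>e. \<not> P e) M) = size M"
  by (induction M) auto

text \<open>Inclusion-exclusion: the multiplicity of an arc is determined by the numbers of arcs in
  four rectangles.\<close>

lemma count_rectangles:
  "size (filter_mset (\<lambda>e. fst e < Suc a \<and> snd e < Suc b) M) + size (filter_mset (\<lambda>e. fst e < a \<and> snd e < b) M)
   = size (filter_mset (\<lambda>e. fst e < a \<and> snd e < Suc b) M) + size (filter_mset (\<lambda>e. fst e < Suc a \<and> snd e < b) M)
     + count M (a, b)"
  by (induction M) auto

context
  fixes L m n :: nat and N :: "nat \<Rightarrow> nat" and M :: "(nat \<times> nat) multiset"
  assumes M: "M \<in> arcs L N n" and left_packed: "left_packed L m N" and sorted: "sorted_arcs m N M"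
begin

lemma arc_site: "(a, b) \<in># M \<Longrightarrow> 1 \<le> a \<and> a < b \<and> b \<le> m"
  using arcs_memberD[OF M, of a b] left_packed by (auto simp: left_packed_def)

text \<open>If an arc starts at y, then site y - 1 is full and no arc ends there. As it is occupied,
  an arc starts there too, and the argument descends.\<close>

lemma sorted_left_full:
  "e \<in># M \<Longrightarrow> fst e = y \<Longrightarrow> 1 \<le> x \<Longrightarrow> x < y \<Longrightarrow> (\<forall>d\<in>#M. snd d \<noteq> x) \<and> deg M x = N x"
proof (induction y arbitrary: e)
  case (Suc y)
  have y: "1 \<le> y" "Suc y \<le> m" using Suc.prems arc_site[of "fst e" "snd e"] by (metis Suc_leI le_less_trans less_Suc_eq_le
      less_imp_le order.trans prod.collapse)+
  then have yL: "y \<in> {1..L}" using left_packed by (auto simp: left_packed_def)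
  have yy: "(\<forall>d\<in>#M. snd d \<noteq> y) \<and> deg M y = N y"
  proof -
    have "(Suc y, snd e) \<in># M" using Suc.prems by (metis prod.collapse)
    moreover have "deg M y \<le> N y" using M yL by (simp add: arcs_def)
    ultimately show ?thesis
      using sorted y unfolding sorted_arcs_def by (metis le_neq_implies_less prod.collapse)
  qed
  show ?case
  proof (cases "x = y")
    case False
    have "1 \<le> N y" using left_packed y yL by (auto simp: left_packed_def)
    then obtain d where "d \<in># M" "fst d = y" using yy deg_pos[of M y] by auto
    then show ?thesis using Suc.IH[of d] Suc.prems False by auto
  qed (use yy in simp)
qed simp

text \<open>The mirror argument, ascending from the end of an arc.\<close>

lemma sorted_right_full:
  "e \<in># M \<Longrightarrow> snd e < x \<Longrightarrow> x \<le> m \<Longrightarrow> (\<forall>d\<in>#M. fst d \<noteq> x) \<and> deg M x = N x"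
proof (induction x)
  case (Suc x)
  have x: "1 \<le> x" using Suc.prems arc_site[of "fst e" "snd e"] by auto
  then have xL: "x \<in> {1..L}" "Suc x \<in> {1..L}" using Suc.prems left_packed by (auto simp: left_packed_def)
  have "\<exists>a. (a, x) \<in># M"
  proof (cases "snd e = x")
    case False
    then have xx: "(\<forall>d\<in>#M. fst d \<noteq> x) \<and> deg M x = N x" using Suc by auto
    have "1 \<le> N x" using left_packed Suc.prems xL by (auto simp: left_packed_def)
    then obtain d where "d \<in># M" "snd d = x" using xx deg_pos[of M x] by auto
    then show ?thesis by (metis prod.collapse)
  next
    case True
    then show ?thesis using Suc.prems(1) by (metis prod.collapse)
  qed
  moreover have "deg M (Suc x) \<le> N (Suc x)" using M xL by (simp add: arcs_def)
  ultimately show ?case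
    using sorted Suc.prems(3) x unfolding sorted_arcs_def by (metis le_neq_implies_less prod.collapse)
qed simp

text \<open>Nesting is excluded; crossings may remain. By \<open>sorted_left_full\<close> an arc
  starts at every site between a and a', so the condition on neighbouring starts can be
  chained.\<close>

lemma sorted_noncrossing:
  "(a, b) \<in># M \<Longrightarrow> (a', b') \<in># M \<Longrightarrow> a < a' \<Longrightarrow> b \<le> b'"
proof (induction a' arbitrary: b')
  case (Suc y)
  have y: "1 \<le> y" "Suc y \<le> m" using Suc.prems arc_site[of a b] arc_site[of "Suc y" b'] by auto
  show ?case
  proof (cases "a = y")
    case True
    then show ?thesis using sorted Suc.prems y unfolding sorted_arcs_def by (meson not_less)
  next
    case False
    have yy: "(\<forall>d\<in>#M. snd d \<noteq> y) \<and> deg M y = N y"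
      using sorted_left_full[OF Suc.prems(2), of "Suc y" y] y by simp
    have "1 \<le> N y" using left_packed y by (auto simp: left_packed_def)
    then obtain d where "d \<in># M" "fst d = y" using yy deg_pos[of M y] by auto
    then obtain b'' where b'': "(y, b'') \<in># M" by (metis prod.collapse)
    have "b \<le> b''" using Suc.IH[OF Suc.prems(1) b''] Suc.prems False by simp
    moreover have "b'' \<le> b'" using sorted b'' Suc.prems(2) y unfolding sorted_arcs_def by (meson not_less)
    ultimately show ?thesis by simp
  qed
qed simp

text \<open>If some arc starts at s or later, all places before s are taken by starts; otherwise all
  n arcs start before s. In both cases the count depends on \<open>N\<close> and n alone.\<close>

lemma sorted_count_fst:
  assumes "s \<le> Suc L"
  shows "size (filter_mset (\<lambda>e. fst e < s) M) = min n (\<Sum>x\<in>{1..<s}. N x)"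
proof -
  have "filter_mset (\<lambda>e. fst e < s) M = filter_mset (\<lambda>e. fst e \<in> {1..<s}) M"
    by (rule filter_mset_cong) (use arc_site in auto)
  then have eq: "size (filter_mset (\<lambda>e. fst e < s) M) = (\<Sum>x\<in>{1..<s}. size (filter_mset (\<lambda>e. fst e = x) M))"
    by (simp only: size_filter_sum[OF finite_atLeastLessThan])
  have le: "size (filter_mset (\<lambda>e. fst e = x) M) \<le> N x" if "x \<in> {1..<s}" for x
  proof -
    have "deg M x \<le> N x" using M that assms by (simp add: arcs_def)
    then show ?thesis using deg_split[OF arcs_less[OF M], of x] by linarith
  qed
  have n: "size M = n" using M by (simp add: arcs_def)
  show ?thesis
  proof (cases "\<exists>e\<in>#M. s \<le> fst e")
    case True
    then obtain e where e: "e \<in># M" "s \<le> fst e" by blast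
    have "size (filter_mset (\<lambda>e. fst e = x) M) = N x" if x: "x \<in> {1..<s}" for x
    proof -
      have xx: "(\<forall>d\<in>#M. snd d \<noteq> x) \<and> deg M x = N x"
        using sorted_left_full[OF e(1) refl, of x] x e by simp
      then have "size (filter_mset (\<lambda>e. snd e = x) M) = 0" by (auto simp: filter_mset_empty_iff)
      then show ?thesis using xx deg_split[OF arcs_less[OF M], of x] by linarith
    qed
    then have "size (filter_mset (\<lambda>e. fst e < s) M) = (\<Sum>x\<in>{1..<s}. N x)" unfolding eq by simp
    moreover have "size (filter_mset (\<lambda>e. fst e < s) M) \<le> n"
      using size_filter_mset_lesseq n by metis
    ultimately show ?thesis by simp
  next
    case False
    then have "filter_mset (\<lambda>e. fst e < s) M = M"
      using filter_mset_eq_conv[of "\<lambda>e. fst e < s" M M] by auto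
    then have "size (filter_mset (\<lambda>e. fst e < s) M) = n" using n by simp
    moreover have "size (filter_mset (\<lambda>e. fst e < s) M) \<le> (\<Sum>x\<in>{1..<s}. N x)"
      unfolding eq using le by (rule sum_mono)
    ultimately show ?thesis by simp
  qed
qed

lemma sorted_count_snd:
  assumes "1 \<le> t"
  shows "size (filter_mset (\<lambda>e. \<not> snd e < t) M) = min n (\<Sum>x\<in>{t..L}. N x)"
proof -
  have "snd e \<in> {t..L} \<longleftrightarrow> \<not> snd e < t" if "e \<in># M" for e
    using arcs_memberD[OF M, of "fst e" "snd e"] that by auto
  then have "filter_mset (\<lambda>e. \<not> snd e < t) M = filter_mset (\<lambda>e. snd e \<in> {t..L}) M"
    by (intro filter_mset_cong) auto
  then have eq: "size (filter_mset (\<lambda>e. \<not> snd e < t) M) = (\<Sum>x\<in>{t..L}. size (filter_mset (\<lambda>e. snd e = x) M))"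
    by (simp only: size_filter_sum[OF finite_atLeastAtMost])
  have le: "size (filter_mset (\<lambda>e. snd e = x) M) \<le> N x" if "x \<in> {t..L}" for x
  proof -
    have "deg M x \<le> N x" using M that assms by (simp add: arcs_def)
    then show ?thesis using deg_split[OF arcs_less[OF M], of x] by linarith
  qed
  have n: "size M = n" using M by (simp add: arcs_def)
  show ?thesis
  proof (cases "\<exists>e\<in>#M. snd e < t")
    case True
    then obtain e where e: "e \<in># M" "snd e < t" by blast
    have "size (filter_mset (\<lambda>e. snd e = x) M) = N x" if x: "x \<in> {t..L}" for x
    proof (cases "x \<le> m")
      case True
      have xx: "(\<forall>d\<in>#M. fst d \<noteq> x) \<and> deg M x = N x"
        using sorted_right_full[OF e(1), of x] x e True by simp
      then have "size (filter_mset (\<lambda>e. fst e = x) M) = 0" by (auto simp: filter_mset_empty_iff)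
      then show ?thesis using xx deg_split[OF arcs_less[OF M], of x] by linarith
    next
      case False
      then have "N x = 0" using left_packed x assms by (auto simp: left_packed_def)
      then show ?thesis using le[OF x] by simp
    qed
    then have "size (filter_mset (\<lambda>e. \<not> snd e < t) M) = (\<Sum>x\<in>{t..L}. N x)" unfolding eq by simp
    moreover have "size (filter_mset (\<lambda>e. \<not> snd e < t) M) \<le> n"
      using size_filter_mset_lesseq n by metis
    ultimately show ?thesis by simp
  next
    case False
    then have "filter_mset (\<lambda>e. \<not> snd e < t) M = M"
      using filter_mset_eq_conv[of "\<lambda>e. \<not> snd e < t" M M] by auto
    then have "size (filter_mset (\<lambda>e. \<not> snd e < t) M) = n" using n by simp
    moreover have "size (filter_mset (\<lambda>e. \<not> snd e < t) M) \<le> (\<Sum>x\<in>{t..L}. N x)"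
      unfolding eq using le by (rule sum_mono)
    ultimately show ?thesis by simp
  qed
qed

text \<open>Ends increase weakly with starts, so of the arcs starting before s and the arcs ending
  before t one collection contains the other, and the smaller one is counted.\<close>

lemma sorted_count_rectangle:
  assumes "s \<le> Suc L" "1 \<le> t"
  shows "size (filter_mset (\<lambda>e. fst e < s \<and> snd e < t) M)
    = min (min n (\<Sum>x\<in>{1..<s}. N x)) (n - min n (\<Sum>x\<in>{t..L}. N x))"
proof -
  let ?F = "filter_mset (\<lambda>e. fst e < s) M" and ?G = "filter_mset (\<lambda>e. snd e < t) M"
  let ?C = "filter_mset (\<lambda>e. fst e < s \<and> snd e < t) M"
  have G: "size ?G = n - min n (\<Sum>x\<in>{t..L}. N x)"
    using size_filter_compl[of "\<lambda>e. snd e < t" M] sorted_count_snd[OF assms(2)] M by (simp add: arcs_def)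
  have "?C = filter_mset (\<lambda>e. snd e < t) ?F" "?C = filter_mset (\<lambda>e. fst e < s) ?G"
    by (simp_all add: filter_filter_mset conj_commute)
  then have CF: "size ?C \<le> size ?F" "size ?C \<le> size ?G" by (metis size_filter_mset_lesseq)+
  have "size ?C = min (size ?F) (size ?G)"
  proof (cases "\<forall>e\<in>#M. fst e < s \<longrightarrow> snd e < t")
    case True
    then have "?C = ?F" by (intro filter_mset_cong) auto
    then show ?thesis using CF(2) by simp
  next
    case False
    then obtain e where e: "e \<in># M" "fst e < s" "\<not> snd e < t" by blast
    have "fst d < s" if d: "d \<in># M" "snd d < t" for d
    proof (rule ccontr)
      assume "\<not> fst d < s"
      then have "fst e < fst d" using e by simp
      then have "snd e \<le> snd d"
        using sorted_noncrossing[of "fst e" "snd e" "fst d" "snd d"] e d by simp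
      then show False using e d by simp
    qed
    then have "?C = ?G" by (intro filter_mset_cong) auto
    then show ?thesis using CF(1) by simp
  qed
  then show ?thesis unfolding G sorted_count_fst[OF assms(1)] .
qed

end

lemma sorted_arcs_unique:
  assumes "M \<in> arcs L N n" "M' \<in> arcs L N n" "left_packed L m N" "sorted_arcs m N M" "sorted_arcs m N M'"
  shows "M = M'"
proof (rule multiset_eqI)
  fix e :: "nat \<times> nat"
  obtain a b where e: "e = (a, b)" by force
  show "count M e = count M' e"
  proof (cases "1 \<le> a \<and> 1 \<le> b \<and> a \<le> L")
    case True
    note eq = sorted_count_rectangle[OF assms(1,3,4)] sorted_count_rectangle[OF assms(2,3,5)]
    have "size (filter_mset (\<lambda>e. fst e < s \<and> snd e < t) M) = size (filter_mset (\<lambda>e. fst e < s \<and> snd e < t) M')"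
      if "s \<le> Suc L" "1 \<le> t" for s t
      using eq that by simp
    then show ?thesis
      using count_rectangles[of a b M] count_rectangles[of a b M'] True unfolding e by simp
  next
    case False
    then have "e \<notin># M" "e \<notin># M'"
      using arcs_memberD[OF assms(1), of a b] arcs_memberD[OF assms(2), of a b] unfolding e by auto
    then show ?thesis by (simp add: not_in_iff)
  qed
qed

section \<open>The shifted Hamiltonian on the cone\<close>

text \<open>The constants of \<open>bond_gen_dominates\<close>, weighted as the bonds in
  \<open>ham\<close>; the leading 1 makes \<open>shifted\<close> dominate the identity.\<close>

definition shift_const :: "nat \<Rightarrow> (nat \<Rightarrow> nat) \<Rightarrow> (nat \<Rightarrow> real) \<Rightarrow> real" where
  "shift_const L N J = 1 + (\<Sum>x\<in>{1..<L}. 2 * J x / (real (N x) * real (N (Suc x))) * (2 * real (N x) * real (N (Suc x)) + 1))"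

definition shifted :: "nat \<Rightarrow> (nat \<Rightarrow> nat) \<Rightarrow> (nat \<Rightarrow> real) \<Rightarrow> real \<Rightarrow> pol \<Rightarrow> pol" where
  "shifted L N J c f = c *\<^sub>R f + (- 1) *\<^sub>R ham L N J f"

lemma linear_shifted: "linear (shifted L N J c)"
  unfolding shifted_def by (intro linearI) (simp_all add: tot_simps algebra_simps)

lemma linear_shifted_funpow: "linear (shifted L N J c ^^ j)"
proof (induction j)
  case 0
  show ?case by (auto intro: linearI)
next
  case (Suc j)
  then show ?case using linear_compose[OF Suc linear_shifted] by (simp add: o_def)
qed

lemma kcone_add: "f \<in> kcone L N n \<Longrightarrow> g \<in> kcone L N n \<Longrightarrow> f + g \<in> kcone L N n"
  unfolding kcone_def by (rule cone_add)

lemma kcone_scale: "f \<in> kcone L N n \<Longrightarrow> 0 \<le> r \<Longrightarrow> r *\<^sub>R f \<in> kcone L N n"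
  unfolding kcone_def by (rule cone_scale)

lemma kcone_sum: "(\<And>i. i \<in> A \<Longrightarrow> f i \<in> kcone L N n) \<Longrightarrow> sum f A \<in> kcone L N n"
  unfolding kcone_def by (rule cone_sum)

context
  fixes L n :: nat and N :: "nat \<Rightarrow> nat" and J :: "nat \<Rightarrow> real" and c :: real
  assumes J: "\<forall>x\<in>{1..<L}. J x > 0" and c: "c \<ge> shift_const L N J"
begin

text \<open>Each bond is made positive by its own share of the constant. The bond at x yields
  \<open>gen M'\<close> in addition, and the 1 in \<open>shift_const\<close> yields
  \<open>gen M\<close>.\<close>

lemma shifted_hop:
  assumes M: "M \<in> arcs L N n" and x: "x \<in> {1..<L}" and hop: "hop N x M M'"
  shows "shifted L N J c (gen M) - (2 * J x / (real (N x) * real (N (Suc x)))) *\<^sub>R gen M' - gen M \<in> kcone L N n"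
proof -
  define k where "k x = 2 * J x / (real (N x) * real (N (Suc x)))" for x
  define b where "b x = 2 * real (N x) * real (N (Suc x)) + 1" for x
  have k: "k y \<ge> 0" if "y \<in> {1..<L}" for y
  proof -
    have "J y > 0" using J that by blast
    then show ?thesis by (simp add: k_def)
  qed
  have bond_pos: "k y *\<^sub>R (bond N y (gen M) + b y *\<^sub>R gen M) \<in> kcone L N n" if y: "y \<in> {1..<L}" for y
  proof -
    have "(bond N y (gen M) + b y *\<^sub>R gen M - gen M) + gen M \<in> kcone L N n"
      using bond_gen_dominates[OF M y hop.stay, of "b y"] kcone_gen[OF M]
      by (intro kcone_add) (auto simp: b_def)
    then show ?thesis using k[OF y] by (intro kcone_scale) auto
  qed
  have "shifted L N J c (gen M) = c *\<^sub>R gen M + (\<Sum>y\<in>{1..<L}. k y *\<^sub>R bond N y (gen M))"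
    by (simp add: shifted_def ham_def k_def)
  also have "\<dots> = (c - (\<Sum>y\<in>{1..<L}. k y * b y)) *\<^sub>R gen M + (\<Sum>y\<in>{1..<L}. k y *\<^sub>R (bond N y (gen M) + b y *\<^sub>R gen M))"
    by (simp add: algebra_simps sum.distrib scaleR_sum_left)
  also have "(\<Sum>y\<in>{1..<L}. k y *\<^sub>R (bond N y (gen M) + b y *\<^sub>R gen M))
     = k x *\<^sub>R (bond N x (gen M) + b x *\<^sub>R gen M) + (\<Sum>y\<in>{1..<L} - {x}. k y *\<^sub>R (bond N y (gen M) + b y *\<^sub>R gen M))"
    using x by (simp add: sum.remove)
  finally have eq: "shifted L N J c (gen M) - k x *\<^sub>R gen M' - gen M
     = (c - (\<Sum>y\<in>{1..<L}. k y * b y) - 1) *\<^sub>R gen M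
       + (k x *\<^sub>R (bond N x (gen M) + b x *\<^sub>R gen M - gen M')
         + (\<Sum>y\<in>{1..<L} - {x}. k y *\<^sub>R (bond N y (gen M) + b y *\<^sub>R gen M)))"
    by (simp add: algebra_simps)
  have "\<dots> \<in> kcone L N n"
  proof (intro kcone_add kcone_sum)
    show "(c - (\<Sum>y\<in>{1..<L}. k y * b y) - 1) *\<^sub>R gen M \<in> kcone L N n"
      using c kcone_gen[OF M] by (intro kcone_scale) (auto simp: shift_const_def k_def b_def)
    show "k x *\<^sub>R (bond N x (gen M) + b x *\<^sub>R gen M - gen M') \<in> kcone L N n"
      using bond_gen_dominates[OF M x hop, of "b x"] k[OF x] by (intro kcone_scale) (auto simp: b_def)
  qed (use bond_pos in auto)
  then show ?thesis using eq by (simp add: k_def)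
qed

lemma shifted_gen: "M \<in> arcs L N n \<Longrightarrow> shifted L N J c (gen M) - gen M \<in> kcone L N n"
proof (cases "{1..<L} = {}")
  case True
  assume M: "M \<in> arcs L N n"
  have "shifted L N J c (gen M) - gen M = (c - 1) *\<^sub>R gen M"
    using True by (simp add: shifted_def ham_def algebra_simps)
  moreover have "c - 1 \<ge> 0" using c True by (simp add: shift_const_def)
  ultimately show ?thesis using kcone_scale[OF kcone_gen[OF M]] by simp
next
  case False
  assume M: "M \<in> arcs L N n"
  obtain x where x: "x \<in> {1..<L}" using False by blast
  have "J x > 0" using J x by blast
  then have "(shifted L N J c (gen M) - (2 * J x / (real (N x) * real (N (Suc x)))) *\<^sub>R gen M - gen M)
     + (2 * J x / (real (N x) * real (N (Suc x)))) *\<^sub>R gen M \<in> kcone L N n"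
    using shifted_hop[OF M x hop.stay] kcone_gen[OF M]
    by (intro kcone_add kcone_scale) auto
  then show ?thesis by simp
qed

text \<open>The iterates therefore increase: a weight once gained is never lost, and different
  numbers of steps can be made equal.\<close>

lemma shifted_increasing: "f \<in> kcone L N n \<Longrightarrow> shifted L N J c f - f \<in> kcone L N n"
proof -
  assume f: "f \<in> kcone L N n"
  have "linear (\<lambda>f. shifted L N J c f - f)"
    by (intro linear_compose_sub linear_shifted) (auto intro: linearI)
  then show ?thesis
    using cone_linear_image[of "\<lambda>f. shifted L N J c f - f" "arcs L N n" gen "arcs L N n" gen f]
      shifted_gen f unfolding kcone_def by blast
qed

lemma shifted_kcone: "f \<in> kcone L N n \<Longrightarrow> shifted L N J c f \<in> kcone L N n"
  using kcone_add[OF shifted_increasing, of f f] by simp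

lemma shifted_funpow_kcone: "f \<in> kcone L N n \<Longrightarrow> (shifted L N J c ^^ j) f \<in> kcone L N n"
  by (induction j) (auto intro: shifted_kcone)

lemma shifted_funpow_increasing: "f \<in> kcone L N n \<Longrightarrow> (shifted L N J c ^^ j) f - f \<in> kcone L N n"
proof (induction j)
  case 0
  then show ?case unfolding kcone_def by simp
next
  case (Suc j)
  have "(shifted L N J c ((shifted L N J c ^^ j) f) - (shifted L N J c ^^ j) f)
    + ((shifted L N J c ^^ j) f - f) \<in> kcone L N n"
    using Suc by (intro kcone_add shifted_increasing shifted_funpow_kcone) auto
  then show ?case by simp
qed

text \<open>Order and dynamics are carried along together because the same climb along increasing
  \<open>spread\<close> establishes both.\<close>

definition reaches :: "(nat \<times> nat) multiset \<Rightarrow> (nat \<times> nat) multiset \<Rightarrow> bool" where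
  "reaches M M' \<longleftrightarrow> M' \<in> arcs L N n \<and> gen M' - gen M \<in> kcone L N n \<and>
     (\<exists>j. \<exists>\<epsilon>>0. (shifted L N J c ^^ j) (gen M) - \<epsilon> *\<^sub>R gen M' \<in> kcone L N n)"

lemma reaches_refl: "M \<in> arcs L N n \<Longrightarrow> reaches M M"
proof -
  have "(shifted L N J c ^^ 0) (gen M) - 1 *\<^sub>R gen M = 0" by simp
  moreover have "0 \<in> kcone L N n" by (simp add: kcone_def)
  ultimately have "\<exists>j. \<exists>\<epsilon>>0. (shifted L N J c ^^ j) (gen M) - \<epsilon> *\<^sub>R gen M \<in> kcone L N n"
    by (metis zero_less_one)
  moreover assume "M \<in> arcs L N n"
  ultimately show ?thesis unfolding reaches_def by (simp add: kcone_def)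
qed

text \<open>Both sites must be occupied: by x / 0 = 0 the bond would otherwise have coefficient
  0.\<close>

lemma reaches_step:
  assumes M: "reaches M M'" and x: "x \<in> {1..<L}" and N: "1 \<le> N x" "1 \<le> N (Suc x)"
    and hop: "hop N x M' M''" and le: "gen M'' - gen M' \<in> kcone L N n"
  shows "reaches M M''"
proof -
  from M obtain j \<epsilon> where M': "M' \<in> arcs L N n" "gen M' - gen M \<in> kcone L N n"
    and \<epsilon>: "\<epsilon> > 0" "(shifted L N J c ^^ j) (gen M) - \<epsilon> *\<^sub>R gen M' \<in> kcone L N n"
    unfolding reaches_def by blast
  define k where "k = 2 * J x / (real (N x) * real (N (Suc x)))"
  have k: "k > 0" using J x N by (simp add: k_def)
  have "(shifted L N J c (gen M') - k *\<^sub>R gen M'' - gen M') + gen M' \<in> kcone L N n"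
    using shifted_hop[OF M'(1) x hop] kcone_gen[OF M'(1)] unfolding k_def by (intro kcone_add)
  then have "shifted L N J c ((shifted L N J c ^^ j) (gen M) - \<epsilon> *\<^sub>R gen M')
     + \<epsilon> *\<^sub>R (shifted L N J c (gen M') - k *\<^sub>R gen M'') \<in> kcone L N n"
    using \<epsilon> by (intro kcone_add shifted_kcone kcone_scale) auto
  then have "(shifted L N J c ^^ Suc j) (gen M) - (\<epsilon> * k) *\<^sub>R gen M'' \<in> kcone L N n"
    using linear_shifted[of L N J c] by (simp add: linear_diff linear_scale algebra_simps)
  moreover have "gen M'' - gen M \<in> kcone L N n" using kcone_add[OF le M'(2)] by simp
  moreover have "M'' \<in> arcs L N n" by (rule hop_arcs[OF hop M'(1) x])
  ultimately show ?thesis unfolding reaches_def using \<epsilon> k by (metis mult_pos_pos)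
qed

text \<open>A reachable diagram of maximal \<open>spread\<close> admits no further exchange.\<close>

lemma reaches_sorted:
  assumes left_packed: "left_packed L m N" and M: "M \<in> arcs L N n"
  shows "\<exists>M'. reaches M M' \<and> sorted_arcs m N M'"
proof -
  let ?S = "{M'. reaches M M'}"
  have fin: "finite ?S" by (rule finite_subset[OF _ finite_arcs]) (auto simp: reaches_def)
  have ne: "?S \<noteq> {}" using reaches_refl[OF M] by blast
  have "Max (spread L ` ?S) \<in> spread L ` ?S" using fin ne by (intro Max_in) auto
  then obtain M' where M': "reaches M M'" "spread L M' = Max (spread L ` ?S)" by auto
  have "sorted_arcs m N M'"
  proof (rule ccontr)
    assume "\<not> sorted_arcs m N M'"
    then obtain x M'' where x: "x \<in> {1..<L}" "Suc x \<le> m" and hop: "hop N x M' M''"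
      and le: "gen M'' - gen M' \<in> kcone L N n" and lt: "spread L M' < spread L M''"
      using unsorted_step[OF _ left_packed, of M' n] M'(1) unfolding reaches_def by blast
    have "1 \<le> N x" "1 \<le> N (Suc x)" using left_packed x by (auto simp: left_packed_def)
    then have "reaches M M''" by (intro reaches_step[OF M'(1) x(1) _ _ hop le])
    then have "spread L M'' \<le> spread L M'" unfolding M'(2) using fin by (intro Max_ge) auto
    then show False using lt by simp
  qed
  then show ?thesis using M' by blast
qed

text \<open>The sorted configuration serves both as an order unit of the cone and as the state that every
  generator reaches: this is the irreducibility of the shifted Hamiltonian on the cone.\<close>

lemma hub_exists:
  assumes left_packed: "left_packed L m N" and ne: "arcs L N n \<noteq> {}"
  shows "\<exists>h\<in>arcs L N n. (\<forall>M\<in>arcs L N n. gen h - gen M \<in> kcone L N n) \<and>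
    (\<exists>j. \<exists>\<epsilon>>0. \<forall>M\<in>arcs L N n. (shifted L N J c ^^ j) (gen M) - \<epsilon> *\<^sub>R gen h \<in> kcone L N n)"
proof -
  obtain M0 where M0: "M0 \<in> arcs L N n" using ne by blast
  obtain h where h: "reaches M0 h" "sorted_arcs m N h" using reaches_sorted[OF left_packed M0] by blast
  then have hA: "h \<in> arcs L N n" by (simp add: reaches_def)
  have all: "reaches M h" if "M \<in> arcs L N n" for M
    using reaches_sorted[OF left_packed that] sorted_arcs_unique[OF _ hA left_packed _ h(2)] unfolding reaches_def by metis
  then have "\<forall>M\<in>arcs L N n. \<exists>j. \<exists>\<epsilon>>0. (shifted L N J c ^^ j) (gen M) - \<epsilon> *\<^sub>R gen h \<in> kcone L N n"
    unfolding reaches_def by blast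
  then obtain j \<epsilon> where je: "\<And>M. M \<in> arcs L N n \<Longrightarrow> \<epsilon> M > 0"
    "\<And>M. M \<in> arcs L N n \<Longrightarrow> (shifted L N J c ^^ j M) (gen M) - \<epsilon> M *\<^sub>R gen h \<in> kcone L N n"
    by metis
  \<comment> \<open>A common exponent suffices because additional steps only raise the weight of
    \<open>gen h\<close>.\<close>
  define j' where "j' = Max (j ` arcs L N n)"
  define \<epsilon>' where "\<epsilon>' = Min (\<epsilon> ` arcs L N n)"
  have j': "j M \<le> j'" if "M \<in> arcs L N n" for M
    unfolding j'_def using that finite_arcs by (intro Max_ge) auto
  have \<epsilon>': "\<epsilon>' \<le> \<epsilon> M" if "M \<in> arcs L N n" for M
    unfolding \<epsilon>'_def using that finite_arcs by (intro Min_le) auto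
  have pos: "\<epsilon>' > 0" unfolding \<epsilon>'_def using ne finite_arcs je(1) by (subst Min_gr_iff) auto
  have "(shifted L N J c ^^ j') (gen M) - \<epsilon>' *\<^sub>R gen h \<in> kcone L N n" if M: "M \<in> arcs L N n" for M
  proof -
    define i where "i = j' - j M"
    have i: "(shifted L N J c ^^ j') f = (shifted L N J c ^^ i) ((shifted L N J c ^^ j M) f)" for f
      using j'[OF M] funpow_add[of i "j M" "shifted L N J c"] by (simp add: i_def)
    have "(shifted L N J c ^^ i) ((shifted L N J c ^^ j M) (gen M) - \<epsilon> M *\<^sub>R gen h)
       + (\<epsilon> M *\<^sub>R ((shifted L N J c ^^ i) (gen h) - gen h) + (\<epsilon> M - \<epsilon>') *\<^sub>R gen h) \<in> kcone L N n"
      using je[OF M] \<epsilon>'[OF M] kcone_gen[OF hA]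
      by (intro kcone_add kcone_scale shifted_funpow_kcone shifted_funpow_increasing) auto
    then show ?thesis unfolding i
      using linear_shifted_funpow[where j = i] by (simp add: linear_diff linear_scale algebra_simps)
  qed
  then show ?thesis using hA all pos unfolding reaches_def by blast
qed

end

section \<open>Splitting off a half-spin\<close>

text \<open>Together with \<open>intercept\<close> this is polarisation in z_y: z^k becomes (1 - k /
  (N + 1)) z^k + k / (N + 1) z^(k - 1) w, the embedding of spin (N + 1) / 2 as the symmetric part of
  spin N / 2 and a half-spin.\<close>

definition slope :: "(nat \<Rightarrow> nat) \<Rightarrow> nat \<Rightarrow> pol \<Rightarrow> pol" where
  "slope N y f = (1 / real (Suc (N y))) *\<^sub>R pd y f"

definition intercept :: "(nat \<Rightarrow> nat) \<Rightarrow> nat \<Rightarrow> pol \<Rightarrow> pol" where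
  "intercept N y f = f - zmul y (slope N y f)"

lemma coef_slope: "coef (slope N y f) c = real (Suc (c y)) / real (Suc (N y)) * coef f (c(y := Suc (c y)))"
  by (simp add: slope_def coef_pd)

lemma coef_intercept: "coef (intercept N y f) c = (1 - real (c y) / real (Suc (N y))) * coef f c"
proof -
  have "coef (zmul y (slope N y f)) c = real (c y) / real (Suc (N y)) * coef f c"
    using coef_zmul_pd[of y f c] by (simp add: slope_def op_simps)
  then show ?thesis by (simp add: intercept_def algebra_simps)
qed

text \<open>Splitting one half-spin off the spin at \<open>y\<close>: a polynomial of degree at most \<open>N y + 1\<close> in \<open>z\<^sub>y\<close>
  becomes \<open>A + w B\<close>, where \<open>w\<close> is the variable of the half-spin. Symmetrisation sets \<open>w = z\<^sub>y\<close>.\<close>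

context
  fixes L :: nat and N :: "nat \<Rightarrow> nat" and y :: nat and N' :: "nat \<Rightarrow> nat"
  assumes y: "y \<in> {1..L}" and N': "N' = N(y := Suc (N y))"
begin

lemma conf_mono: "conf L N \<subseteq> conf L N'"
  unfolding conf_def N' by (auto simp: le_Suc_eq)

lemma conf_Suc_site: "c(y := Suc (c y)) \<in> conf L N' \<longleftrightarrow> c \<in> conf L N"
proof
  assume c: "c(y := Suc (c y)) \<in> conf L N'"
  have "(z \<in> {1..L} \<longrightarrow> c z \<le> N z) \<and> (z \<notin> {1..L} \<longrightarrow> c z = 0)" for z
    using c y unfolding conf_def N' by (cases "z = y") (auto dest!: spec[of _ z])
  then show "c \<in> conf L N" by (simp add: conf_def)
qed (use y in \<open>auto simp: conf_def N'\<close>)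

lemma conf_top_site: "c \<in> conf L N' \<Longrightarrow> c \<notin> conf L N \<Longrightarrow> c y = Suc (N y)"
proof -
  assume c: "c \<in> conf L N'" "c \<notin> conf L N"
  then obtain z where z: "z \<in> {1..L}" "\<not> c z \<le> N z" unfolding conf_def by blast
  then have "c z \<le> N' z" using c by (simp add: conf_def)
  then show ?thesis using z unfolding N' by (auto split: if_splits)
qed

lemma supp_slope: "f \<in> chain.supp L N' \<Longrightarrow> slope N y f \<in> chain.supp L N"
  unfolding chain_supp_iff coef_slope using conf_Suc_site by auto

lemma supp_intercept: "f \<in> chain.supp L N' \<Longrightarrow> intercept N y f \<in> chain.supp L N"
  unfolding chain_supp_iff coef_intercept
proof (intro allI impI)
  fix c assume f: "\<forall>c. c \<notin> conf L N' \<longrightarrow> coef f c = 0" and c: "c \<notin> conf L N"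
  show "(1 - real (c y) / real (Suc (N y))) * coef f c = 0"
  proof (cases "c \<in> conf L N'")
    case True
    then have "c y = Suc (N y)" using conf_top_site c by blast
    then show ?thesis by simp
  qed (use f in simp)
qed

lemma dtot_zmul: "dtot L (zmul y f) = zmul y (dtot L f) + f"
proof -
  have "dtot L (zmul y f) = (\<Sum>x\<in>{1..L}. zmul y (pd x f) + (if x = y then f else 0))"
    unfolding dtot_def by (intro sum.cong) (auto simp: pd_zmul_same pd_zmul_other)
  then show ?thesis using y by (simp add: sum.distrib dtot_def op_simps)
qed

lemma dtot_slope: "dtot L (slope N y f) = slope N y (dtot L f)"
  by (simp add: slope_def dtot_def op_simps scaleR_sum_right pd_commute)

lemma slope_hw:
  assumes "F \<in> hw L N' k" shows "slope N y F \<in> hw L N (k - 1)"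
proof -
  have "dtot L (slope N y F) = 0"
    using assms unfolding dtot_slope by (simp add: hw_def slope_def op_simps)
  moreover have "homog L (k - 1) (slope N y F)"
    unfolding slope_def using assms y by (intro homog_scale homog_pd) (auto simp: hw_def)
  ultimately show ?thesis using assms supp_slope by (simp add: hw_def)
qed

text \<open>Translation of A + w B also acts on w, so invariance means \<open>dtot\<close> A + B = 0
  and \<open>dtot\<close> B = 0: the slope has highest weight, the intercept in general does
  not.\<close>

lemma intercept_supp_homog:
  assumes "F \<in> hw L N' k"
  shows "intercept N y F \<in> chain.supp L N" "homog L k (intercept N y F)" "dtot L (intercept N y F) = - slope N y F"
proof -
  show "intercept N y F \<in> chain.supp L N" using assms supp_intercept by (simp add: hw_def)
  have "homog L (k - 1 + 1) (zmul y (slope N y F))"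
    using slope_hw[OF assms] y by (intro homog_zmul) (auto simp: hw_def)
  then show "homog L k (intercept N y F)"
    unfolding intercept_def using assms by (intro homog_diff) (auto simp: hw_def)
  show "dtot L (intercept N y F) = - slope N y F"
    using assms slope_hw[OF assms] by (simp add: intercept_def hw_def tot_simps dtot_zmul op_simps)
qed

text \<open>The weights of the longer spin are those of the shorter one times the factor of
  \<open>intercept\<close>; in \<open>wt_above\<close> the factor of \<open>slope\<close> appears.
  This is why polarisation is isometric.\<close>

lemma wt_below:
  assumes "c \<in> conf L N"
  shows "wt L N' c = wt L N c * (1 - real (c y) / real (Suc (N y)))"
proof -
  have rest: "(\<Prod>z\<in>{1..L} - {y}. 1 / real (N' z choose c z)) = (\<Prod>z\<in>{1..L} - {y}. 1 / real (N z choose c z))"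
    by (intro prod.cong) (auto simp: N')
  have split: "wt L N c = 1 / real (N y choose c y) * (\<Prod>z\<in>{1..L} - {y}. 1 / real (N z choose c z))"
    "wt L N' c = 1 / real (Suc (N y) choose c y) * (\<Prod>z\<in>{1..L} - {y}. 1 / real (N z choose c z))"
    using prod.remove[of "{1..L}" y "\<lambda>z. 1 / real (N z choose c z)"]
      prod.remove[of "{1..L}" y "\<lambda>z. 1 / real (N' z choose c z)"] y rest
    by (simp_all add: wt_def N')
  have cy: "c y \<le> N y" using assms y by (auto simp: conf_def)
  have "(Suc (N y) - c y) * (Suc (N y) choose c y) = Suc (N y) * (N y choose c y)"
    using binomial_absorb_comp[of "Suc (N y)" "c y"] by simp
  then have "(real (Suc (N y)) - real (c y)) * real (Suc (N y) choose c y) = real (Suc (N y)) * real (N y choose c y)"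
    using cy by (metis le_SucI of_nat_diff of_nat_mult)
  moreover have "real (Suc (N y) choose c y) > 0" "real (N y choose c y) > 0" using cy by simp_all
  ultimately have "1 / real (Suc (N y) choose c y)
      = 1 / real (N y choose c y) * (1 - real (c y) / real (Suc (N y)))"
    by (simp add: field_simps del: of_nat_Suc binomial_Suc_Suc)
  then show ?thesis unfolding split by simp
qed

lemma wt_above:
  assumes "c \<in> conf L N"
  shows "wt L N' (c(y := Suc (c y))) = wt L N c * (real (Suc (c y)) / real (Suc (N y)))"
proof -
  have rest: "(\<Prod>z\<in>{1..L} - {y}. 1 / real (N' z choose (c(y := Suc (c y))) z))
     = (\<Prod>z\<in>{1..L} - {y}. 1 / real (N z choose c z))"
    by (intro prod.cong) (auto simp: N')
  have split: "wt L N c = 1 / real (N y choose c y) * (\<Prod>z\<in>{1..L} - {y}. 1 / real (N z choose c z))"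
    "wt L N' (c(y := Suc (c y))) = 1 / real (Suc (N y) choose Suc (c y)) * (\<Prod>z\<in>{1..L} - {y}. 1 / real (N z choose c z))"
    using prod.remove[of "{1..L}" y "\<lambda>z. 1 / real (N z choose c z)"]
      prod.remove[of "{1..L}" y "\<lambda>z. 1 / real (N' z choose (c(y := Suc (c y))) z)"] y rest
    by (simp_all add: wt_def N' del: binomial_Suc_Suc)
  have cy: "c y \<le> N y" using assms y by (auto simp: conf_def)
  have "Suc (c y) * (Suc (N y) choose Suc (c y)) = Suc (N y) * (N y choose c y)"
    by (rule Suc_times_binomial)
  then have "real (Suc (c y)) * real (Suc (N y) choose Suc (c y)) = real (Suc (N y)) * real (N y choose c y)"
    by (metis of_nat_mult)
  moreover have "real (Suc (N y) choose Suc (c y)) > 0" "real (N y choose c y) > 0"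
    using cy by (simp_all del: binomial_Suc_Suc)
  ultimately have "1 / real (Suc (N y) choose Suc (c y))
      = 1 / real (N y choose c y) * (real (Suc (c y)) / real (Suc (N y)))"
    by (simp add: field_simps del: of_nat_Suc binomial_Suc_Suc)
  then show ?thesis unfolding split by simp
qed

text \<open>The adjoint of polarisation is symmetrisation, A + w B to A + z_y B. Taking A and B from
  F itself gives the isometry.\<close>

lemma ip_split:
  assumes A: "A \<in> chain.supp L N" and B: "B \<in> chain.supp L N"
  shows "chain.ip L N' F (A + zmul y B) = chain.ip L N (intercept N y F) A + chain.ip L N (slope N y F) B"
proof -
  have "chain.ip L N' F A = (\<Sum>c\<in>conf L N. wt L N' c * coef F c * coef A c)"
    unfolding chain.ip_def
    by (rule sum.mono_neutral_right[OF finite_conf conf_mono]) (use A in \<open>auto simp: chain.supp_def\<close>)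
  also have "\<dots> = chain.ip L N (intercept N y F) A"
    unfolding chain.ip_def by (intro sum.cong) (auto simp: wt_below coef_intercept)
  finally have 1: "chain.ip L N' F A = chain.ip L N (intercept N y F) A" .
  have "chain.ip L N' F (zmul y B) = (\<Sum>c\<in>{c \<in> conf L N'. c y \<noteq> 0}. wt L N' c * coef F c * coef (zmul y B) c)"
    unfolding chain.ip_def by (rule sum.mono_neutral_right[OF finite_conf]) (auto simp: coef_zmul)
  also have "\<dots> = (\<Sum>c\<in>conf L N. wt L N c * coef (slope N y F) c * coef B c)"
  proof (rule sum.reindex_bij_witness[of _ "\<lambda>c. c(y := Suc (c y))" "\<lambda>c. c(y := c y - 1)"])
    fix c assume c: "c \<in> {c \<in> conf L N'. c y \<noteq> 0}"
    show upd: "c(y := c y - 1, y := Suc ((c(y := c y - 1)) y)) = c" using c by simp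
    then show cN: "c(y := c y - 1) \<in> conf L N"
      using c conf_Suc_site[of "c(y := c y - 1)"] by simp
    show "wt L N (c(y := c y - 1)) * coef (slope N y F) (c(y := c y - 1)) * coef B (c(y := c y - 1))
      = wt L N' c * coef F c * coef (zmul y B) c"
      using wt_above[OF cN] c by (simp add: coef_slope coef_zmul)
  next
    fix c assume c: "c \<in> conf L N"
    show "c(y := Suc (c y), y := (c(y := Suc (c y))) y - 1) = c" by simp
    show "c(y := Suc (c y)) \<in> {c \<in> conf L N'. c y \<noteq> 0}" using c conf_Suc_site by simp
  qed
  also have "\<dots> = chain.ip L N (slope N y F) B" by (simp add: chain.ip_def)
  finally show ?thesis using 1 by (simp add: chain.ip_add_right)
qed

lemma ip_split_self:
  assumes "F \<in> chain.supp L N'"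
  shows "chain.ip L N' F F = chain.ip L N (intercept N y F) (intercept N y F)
    + chain.ip L N (slope N y F) (slope N y F)"
  using ip_split[OF supp_intercept[OF assms] supp_slope[OF assms], of F] by (simp add: intercept_def)

end

section \<open>Highest weight vectors are spanned by products of differences\<close>

lemma dtot_smintot_hw:
  assumes "B \<in> hw L N k"
  shows "dtot L (smintot L N B) = (real (\<Sum>x\<in>{1..L}. N x) - 2 * of_int k) *\<^sub>R B"
  using assms sum_sz_homog[of L k B N] by (simp add: dtot_smintot hw_def tot_simps)

text \<open>Clebsch-Gordan for a half-spin: S+ S- B = \<sigma> B, where \<sigma> is twice the spin
  of B, so S- B / \<sigma> repairs \<open>dtot\<close> A = - B. For \<sigma> \<le> 0 the squared
  norm \<sigma> (B, B) of S- B leaves only S- B = 0, and then (B, B) = - (A, S- B) = 0.\<close>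

lemma correction:
  assumes A: "A \<in> chain.supp L N" "homog L (k + 1) A" "dtot L A = - B" and B: "B \<in> hw L N k"
  defines "\<sigma> \<equiv> real (\<Sum>x\<in>{1..L}. N x) - 2 * of_int k"
  shows "\<sigma> \<le> 0 \<Longrightarrow> B = 0" "A + (1 / \<sigma>) *\<^sub>R smintot L N B \<in> hw L N (k + 1)"
proof -
  have Bs: "B \<in> chain.supp L N" "smintot L N B \<in> chain.supp L N"
    using B supp_smintot by (auto simp: hw_def)
  show zero: "B = 0" if "\<sigma> \<le> 0"
  proof -
    have "chain.ip L N (smintot L N B) (smintot L N B) = \<sigma> * chain.ip L N B B"
      using ip_dtot[OF Bs(2), of B] dtot_smintot_hw[OF B] by (simp add: \<sigma>_def chain.ip_simps)
    also have "\<dots> \<le> 0" using that chain.ip_self_nonneg[of L N B] by (rule mult_nonpos_nonneg)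
    finally have "smintot L N B = 0"
      using chain.ip_self_zero[OF Bs(2)] chain.ip_self_nonneg[of L N "smintot L N B"] by linarith
    then have "chain.ip L N B B = 0"
      using ip_dtot[OF A(1), of B] A(3) by (simp add: chain.ip_simps)
    then show "B = 0" using chain.ip_self_zero[OF Bs(1)] by simp
  qed
  have "homog L (k + 1) (A + (1 / \<sigma>) *\<^sub>R smintot L N B)"
    using A B by (intro homog_add homog_scale homog_smintot) (auto simp: hw_def)
  moreover have "A + (1 / \<sigma>) *\<^sub>R smintot L N B \<in> chain.supp L N"
    using A Bs by (intro supp_subspace_intros)
  moreover have "dtot L (A + (1 / \<sigma>) *\<^sub>R smintot L N B) = 0"
  proof (cases "\<sigma> > 0")
    case True
    have "dtot L (smintot L N B) = \<sigma> *\<^sub>R B" using dtot_smintot_hw[OF B] unfolding \<sigma>_def .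
    then show ?thesis using True by (simp add: tot_simps A(3))
  \<comment> \<open>Here B = 0, so the value of 1 / \<sigma> does not matter.\<close>
  qed (use zero A(3) in \<open>simp add: tot_simps\<close>)
  ultimately show "A + (1 / \<sigma>) *\<^sub>R smintot L N B \<in> hw L N (k + 1)" by (simp add: hw_def)
qed

text \<open>The sum of z_x^2 d/dz_x multiplies a factor z_a - z_b by (z_a^2 - z_b^2) / (z_a - z_b) =
  z_a + z_b, hence the whole product by the sum of z_x over all arc ends.\<close>

lemma smintot_gen:
  assumes "\<forall>(a, b)\<in>#M. 1 \<le> a \<and> a < b \<and> b \<le> L"
  shows "smintot L N (gen M) = (\<Sum>x\<in>{1..L}. (real (N x) - real (deg M x)) *\<^sub>R zmul x (gen M))"
proof -
  have "(\<Sum>x\<in>{1..L}. zmul x (zmul x (pd x (gen M)))) = (\<Sum>x\<in>{1..L}. real (deg M x) *\<^sub>R zmul x (gen M))"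
    using assms
  proof (induction M)
    case (add e M)
    obtain a b where e: "e = (a, b)" by force
    have ab: "a \<in> {1..L}" "b \<in> {1..L}" "a \<noteq> b" using add.prems e by auto
    have comm: "zmul x (dmul a b f) = dmul a b (zmul x f)" for x f
      by (simp add: dmul_def op_simps zmul_commute)
    have "(\<Sum>x\<in>{1..L}. zmul x (zmul x (pd x (gen (add_mset e M)))))
       = (\<Sum>x\<in>{1..L}. dmul a b (zmul x (zmul x (pd x (gen M))))
           + ((if x = a then zmul a (zmul a (gen M)) else 0) - (if x = b then zmul b (zmul b (gen M)) else 0)))"
      unfolding e gen_add by (intro sum.cong) (auto simp: pd_dmul op_simps comm)
    also have "\<dots> = dmul a b (\<Sum>x\<in>{1..L}. zmul x (zmul x (pd x (gen M))))
        + (zmul a (zmul a (gen M)) - zmul b (zmul b (gen M)))"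
      using ab by (simp add: sum.distrib sum_subtractf dmul_simps)
    also have "\<dots> = (\<Sum>x\<in>{1..L}. real (deg M x) *\<^sub>R zmul x (dmul a b (gen M)))
        + (zmul a (dmul a b (gen M)) + zmul b (dmul a b (gen M)))"
      using add by (simp add: dmul_simps comm) (simp add: dmul_def op_simps zmul_commute)
    also have "\<dots> = (\<Sum>x\<in>{1..L}. real (deg M x) *\<^sub>R zmul x (dmul a b (gen M))
        + ((if x = a then zmul a (dmul a b (gen M)) else 0) + (if x = b then zmul b (dmul a b (gen M)) else 0)))"
      using ab by (simp add: sum.distrib)
    also have "\<dots> = (\<Sum>x\<in>{1..L}. real (deg (add_mset e M) x) *\<^sub>R zmul x (gen (add_mset e M)))"
      unfolding e gen_add using ab by (intro sum.cong) (auto simp: deg_add algebra_simps)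
    finally show ?case .
  qed (simp add: op_simps)
  then show ?thesis
    unfolding smintot_def smin_def by (simp add: sum_subtractf algebra_simps)
qed

lemma sum_deg:
  assumes "\<forall>(a, b)\<in>#M. 1 \<le> a \<and> a < b \<and> b \<le> L"
  shows "(\<Sum>x\<in>{1..L}. deg M x) = 2 * size M"
  using assms
proof (induction M)
  case (add e M)
  obtain a b where e: "e = (a, b)" by force
  have ab: "a \<in> {1..L}" "b \<in> {1..L}" "a \<noteq> b" using add.prems e by auto
  have "(\<Sum>x\<in>{1..L}. deg (add_mset e M) x)
      = (\<Sum>x\<in>{1..L}. deg M x + ((if x = a then 1 else 0) + (if x = b then 1 else 0)))"
    unfolding e using ab by (intro sum.cong) (auto simp: deg_add)
  then show ?case using add ab by (simp add: sum.distrib)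
qed simp

lemma arcs_mono: "M \<in> arcs L N n \<Longrightarrow> (\<And>x. x \<in> {1..L} \<Longrightarrow> N x \<le> N' x) \<Longrightarrow> M \<in> arcs L N' n"
  unfolding arcs_def by (auto intro: order.trans)

lemma linear_span_image:
  assumes "linear T" "\<And>g. g \<in> G \<Longrightarrow> T g \<in> span H" "x \<in> span G"
  shows "T x \<in> span H"
  using assms(3)
proof (induction rule: span_induct_alt)
  case base
  show ?case by (simp add: linear_0[OF assms(1)] span_zero)
next
  case (step c g x)
  then show ?case using assms
    by (simp add: linear_add linear_scale span_add span_scale)
qed

text \<open>The numbers of free places add up to \<sigma>, so subtracting \<sigma> z_y turns each
  z_x into z_x - z_y: an arc between a free place at x and the additional place at y.\<close>

lemma smintot_gen_span:
  assumes M: "M \<in> arcs L N n" and y: "y \<in> {1..L}" and N': "N' = N(y := Suc (N y))"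
  defines "\<sigma> \<equiv> real (\<Sum>x\<in>{1..L}. N x) - 2 * real n"
  shows "smintot L N (gen M) - \<sigma> *\<^sub>R zmul y (gen M) \<in> span (gen ` arcs L N' (Suc n))"
proof -
  have arc: "\<forall>(a, b)\<in>#M. 1 \<le> a \<and> a < b \<and> b \<le> L" and size: "size M = n"
    using M by (auto simp: arcs_def)
  have "real (\<Sum>x\<in>{1..L}. deg M x) = 2 * real n" using sum_deg[OF arc] size by simp
  then have \<sigma>: "\<sigma> = (\<Sum>x\<in>{1..L}. real (N x) - real (deg M x))" by (simp add: \<sigma>_def sum_subtractf)
  have "smintot L N (gen M) - \<sigma> *\<^sub>R zmul y (gen M)
     = (\<Sum>x\<in>{1..L}. (real (N x) - real (deg M x)) *\<^sub>R dmul x y (gen M))"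
    unfolding smintot_gen[OF arc] \<sigma> scaleR_sum_left sum_subtractf[symmetric] dmul_def scaleR_diff_right ..
  also have "\<dots> \<in> span (gen ` arcs L N' (Suc n))"
  proof (intro span_sum)
    fix x assume x: "x \<in> {1..L}"
    show "(real (N x) - real (deg M x)) *\<^sub>R dmul x y (gen M) \<in> span (gen ` arcs L N' (Suc n))"
    proof (cases "deg M x < N x \<and> x \<noteq> y")
      case True
      have deg: "\<forall>z\<in>{1..L}. deg M z + (if x = z \<or> y = z then 1 else 0) \<le> N' z"
        using M True by (auto simp: arcs_def N')
      have "dmul x y (gen M) \<in> span (gen ` arcs L N' (Suc n))"
      proof (cases "x < y")
        case True
        then have "add_mset (x, y) M \<in> arcs L N' (Suc n)"
          using M x y deg by (auto simp: arcs_def deg_add)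
        then show ?thesis unfolding gen_add[symmetric] by (intro span_base imageI)
      next
        case False
        then have "add_mset (y, x) M \<in> arcs L N' (Suc n)"
          using M x y deg True by (auto simp: arcs_def deg_add disj_commute)
        moreover have "dmul x y (gen M) = - gen (add_mset (y, x) M)"
          by (simp add: gen_add dmul_def)
        ultimately show ?thesis by (simp add: span_neg span_base)
      qed
      then show ?thesis by (rule span_scale)
    next
      case False
      then have "(real (N x) - real (deg M x)) *\<^sub>R dmul x y (gen M) = 0"
      proof (cases "x = y")
        case False
        have "deg M x \<le> N x" using M x by (simp add: arcs_def)
        then show ?thesis using False \<open>\<not> (deg M x < N x \<and> x \<noteq> y)\<close> by simp
      qed (simp add: dmul_def)
      then show ?thesis by (simp only: span_zero)
    qed
  qed
  finally show ?thesis .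
qed

text \<open>Induction on the number of half-spins. F equals A0 - (S- B - \<sigma> z_y B) / \<sigma>
  with highest weight vectors A0 and B of the smaller chain; the bracket is covered by
  \<open>smintot_gen_span\<close>.\<close>

lemma hw_subset_span: "F \<in> hw L N (int n) \<Longrightarrow> F \<in> span (gen ` arcs L N n)"
proof (induction "\<Sum>x\<in>{1..L}. N x" arbitrary: N n F)
  case 0
  note F = 0(2)
  have Fs: "coef F c = 0" if "c \<notin> conf L N" for c using F that by (auto simp: hw_def chain.supp_def)
  have conf: "conf L N = {\<lambda>_. 0}" using 0(1) by (auto simp: conf_def fun_eq_iff)
  show ?case
  proof (cases n)
    case 0
    have "F = coef F (\<lambda>_. 0) *\<^sub>R one_pol"
      using Fs conf by (auto simp: vec_eq_iff one_pol_def)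
    moreover have "{#} \<in> arcs L N 0" by (simp add: arcs_def)
    then have "one_pol \<in> span (gen ` arcs L N 0)" by (metis gen_empty image_eqI span_base)
    ultimately show ?thesis using 0 by (metis span_scale)
  next
    case (Suc n')
    have "coef F c = 0" for c
    proof (cases "c \<in> conf L N")
      case True
      then have "(\<Sum>x\<in>{1..L}. c x) = 0" using conf by simp
      then show ?thesis using F Suc unfolding hw_def homog_def by force
    qed (rule Fs)
    then have "F = 0" by (simp add: vec_eq_iff)
    then show ?thesis by (simp add: span_zero)
  qed
next
  case (Suc S)
  note F = Suc(3)
  show ?case
  proof (cases n)
    case 0
    have "coef F c = coef F (\<lambda>_. 0) * coef one_pol c" for c
    proof (cases "c = (\<lambda>_. 0)")
      case False
      then obtain x where x: "c x \<noteq> 0" by (auto simp: fun_eq_iff)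
      have "coef F c = 0"
      proof (rule ccontr)
        assume nz: "coef F c \<noteq> 0"
        then have "c \<in> conf L N" using F by (auto simp: hw_def chain.supp_def)
        moreover have "int (\<Sum>x\<in>{1..L}. c x) = int n" using nz F unfolding hw_def homog_def by blast
        then have "(\<Sum>x\<in>{1..L}. c x) = 0" using 0 by linarith
        then have "\<forall>z\<in>{1..L}. c z = 0" by simp
        ultimately show False using x unfolding conf_def by (cases "x \<in> {1..L}") auto
      qed
      then show ?thesis using False by (simp add: one_pol_def)
    qed (simp add: one_pol_def)
    then have "F = coef F (\<lambda>_. 0) *\<^sub>R one_pol" unfolding vec_eq_iff coef_simps by blast
    moreover have "{#} \<in> arcs L N 0" by (simp add: arcs_def)
    then have "one_pol \<in> span (gen ` arcs L N 0)" by (metis gen_empty image_eqI span_base)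
    ultimately show ?thesis using 0 by (metis span_scale)
  next
    case (Suc n')
    obtain y where y: "y \<in> {1..L}" "1 \<le> N y"
    proof -
      have "(\<Sum>x\<in>{1..L}. N x) \<noteq> 0" using Suc.hyps(2) by linarith
      then obtain y where "y \<in> {1..L}" "N y \<noteq> 0" by (meson sum.neutral)
      then show ?thesis using that[of y] by simp
    qed
    define N0 where "N0 = N(y := N y - 1)"
    have N: "N = N0(y := Suc (N0 y))" using y by (auto simp: N0_def)
    have S: "S = (\<Sum>x\<in>{1..L}. N0 x)"
    proof -
      have "(\<Sum>x\<in>{1..L}. N x) = Suc (\<Sum>x\<in>{1..L}. N0 x)"
        using sum_upd_Suc[OF y(1), of N0] N by simp
      then show ?thesis using Suc.hyps(2) by simp
    qed
    define A B where "A = intercept N0 y F" and "B = slope N0 y F"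
    have B: "B \<in> hw L N0 (int n')"
      using slope_hw[OF y(1) N, of F "int n"] F Suc by (simp add: B_def)
    have A: "A \<in> chain.supp L N0" "homog L (int n' + 1) A" "dtot L A = - B"
      using intercept_supp_homog[OF y(1) N, of F "int n"] F Suc unfolding A_def B_def
      by (simp_all add: add.commute)
    define \<sigma> where "\<sigma> = real (\<Sum>x\<in>{1..L}. N0 x) - 2 * of_int (int n')"
    define A0 where "A0 = A + (1 / \<sigma>) *\<^sub>R smintot L N0 B"
    have A0: "A0 \<in> hw L N0 (int n)"
      using correction(2)[OF A B] Suc unfolding A0_def \<sigma>_def by (simp add: add.commute)
    have zero: "\<sigma> \<le> 0 \<Longrightarrow> B = 0" using correction(1)[OF A B] unfolding \<sigma>_def .
    have le: "N0 x \<le> N x" for x by (simp add: N0_def)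
    have "A0 \<in> span (gen ` arcs L N0 n)" using Suc.hyps(1)[OF S A0] .
    then have A0s: "A0 \<in> span (gen ` arcs L N n)"
      by (rule span_mono[THEN subsetD, rotated]) (auto intro: arcs_mono le)
    define T where "T f = smintot L N0 f - \<sigma> *\<^sub>R zmul y f" for f
    have "linear T"
      unfolding T_def by (intro linearI) (simp_all add: tot_simps op_simps algebra_simps)
    moreover have "B \<in> span (gen ` arcs L N0 n')" using Suc.hyps(1)[OF S B] .
    moreover have "T g \<in> span (gen ` arcs L N n)" if "g \<in> gen ` arcs L N0 n'" for g
      using that smintot_gen_span[OF _ y(1) N] Suc unfolding T_def \<sigma>_def by auto
    ultimately have TB: "T B \<in> span (gen ` arcs L N n)" using linear_span_image by blast
    have "F = A + zmul y B" by (simp add: A_def B_def intercept_def)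
    also have "\<dots> = A0 - (1 / \<sigma>) *\<^sub>R T B"
    proof (cases "\<sigma> > 0")
      case True
      then show ?thesis by (simp add: A0_def T_def algebra_simps)
    qed (use zero in \<open>simp add: A0_def T_def op_simps tot_simps\<close>)
    also have "\<dots> \<in> span (gen ` arcs L N n)"
      using A0s TB by (intro span_diff span_scale)
    finally show ?thesis .
  qed
qed

lemma hw_nonzero_iff: "(\<exists>v\<in>hw L N (int n). v \<noteq> 0) \<longleftrightarrow> arcs L N n \<noteq> {}"
proof
  assume "\<exists>v\<in>hw L N (int n). v \<noteq> 0"
  then show "arcs L N n \<noteq> {}" using hw_subset_span by fastforce
next
  assume "arcs L N n \<noteq> {}"
  then show "\<exists>v\<in>hw L N (int n). v \<noteq> 0" using gen_hw gen_nonzero by blast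
qed

section \<open>Energy bounds under compression\<close>

text \<open>On the symmetric part, the operators of spin N / 2 act as N / (N + 1) times those of
  spin (N + 1) / 2. The coupling J / (s s') changes by the same factor, so the two effects
  match.\<close>

lemma zmul_bond_top:
  assumes N': "N' = N(Suc x := Suc (N (Suc x)))"
  shows "real (Suc (N (Suc x))) *\<^sub>R (bond N x (intercept N (Suc x) F) + zmul (Suc x) (bond N x (slope N (Suc x) F)))
    = real (N (Suc x)) *\<^sub>R bond N' x F"
proof -
  let ?m = "real (Suc (N (Suc x)))"
  define G where "G = pd (Suc x) F"
  have comm: "zmul (Suc x) (bond N x f) - bond N x (zmul (Suc x) f)
      = dmul x (Suc x) (dmul x (Suc x) (pd x f)) - real (N x) *\<^sub>R dmul x (Suc x) f" for f
    unfolding bond_def dmul_def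
    by (simp add: weyl_simps zmul_commute pd_commute) (simp add: vec_eq_iff algebra_simps)
  have "?m *\<^sub>R (bond N x (intercept N (Suc x) F) + zmul (Suc x) (bond N x (slope N (Suc x) F)))
     = ?m *\<^sub>R bond N x F + (zmul (Suc x) (bond N x G) - bond N x (zmul (Suc x) G))"
    unfolding intercept_def slope_def G_def by (simp add: bond_simps op_simps algebra_simps)
  also have "\<dots> = real (N (Suc x)) *\<^sub>R bond N' x F"
    unfolding comm unfolding bond_def G_def N'
    by (simp add: dmul_simps) (simp add: vec_eq_iff algebra_simps)
  finally show ?thesis .
qed

text \<open>With a half-spin the bond takes only two values: 0 for total spin s + 1/2 and
  -(\<open>N x\<close> + 1) for s - 1/2. Concretely, \<open>bond N x F\<close> is (z_x - z_{x+1}) X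
  with X free of z_{x+1}, and the bond is scalar on such products.\<close>

lemma bond_square:
  assumes F: "F \<in> chain.supp L N" and x: "x \<in> {1..<L}" and one: "N (Suc x) = 1"
  shows "bond N x (bond N x F) = - (real (N x) + 1) *\<^sub>R bond N x F"
proof -
  have pp: "pd (Suc x) (pd (Suc x) F) = 0"
  proof -
    have "coef F (c(Suc x := Suc (Suc (c (Suc x))))) = 0" for c
    proof -
      have "c(Suc x := Suc (Suc (c (Suc x)))) \<notin> conf L N" using x one by (auto simp: conf_def)
      then show ?thesis using F by (auto simp: chain.supp_def)
    qed
    then show ?thesis by (simp add: vec_eq_iff coef_pd)
  qed
  define A where "A = F - zmul (Suc x) (pd (Suc x) F)"
  define B where "B = pd (Suc x) F"
  have A: "pd (Suc x) A = 0" by (simp add: A_def weyl_simps pp)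
  have B: "pd (Suc x) B = 0" by (simp add: B_def pp)
  define X where "X = real (N x) *\<^sub>R B - pd x A - zmul x (pd x B)"
  have X: "pd (Suc x) X = 0"
    unfolding X_def by (simp add: weyl_simps B pd_commute[of "Suc x" x] A)
  have "F = A + zmul (Suc x) B" by (simp add: A_def B_def)
  then have F: "bond N x F = dmul x (Suc x) X"
    unfolding bond_def dmul_def one X_def
    by (simp add: weyl_simps A B pd_commute[of x "Suc x"] zmul_commute[of "Suc x" x]) (simp add: vec_eq_iff algebra_simps)
  show ?thesis unfolding F
    unfolding bond_def dmul_def one
    by (simp add: weyl_simps X pd_commute[of x "Suc x"] zmul_commute[of "Suc x" x]) (simp add: vec_eq_iff algebra_simps)
qed

text \<open>By symmetry, -(\<open>N x\<close> + 1) times this form is the squared norm of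
  \<open>bond N x F\<close>.\<close>

lemma ip_bond_half_nonpos:
  assumes F: "F \<in> chain.supp L N" and x: "x \<in> {1..<L}" and one: "N (Suc x) = 1"
  shows "chain.ip L N F (bond N x F) \<le> 0"
proof -
  have "chain.ip L N (bond N x F) (bond N x F) = chain.ip L N F (bond N x (bond N x F))"
    using ip_bond[OF F supp_bond[OF F x] x] by simp
  also have "\<dots> = - ((real (N x) + 1) * chain.ip L N F (bond N x F))"
    unfolding bond_square[OF F x one] chain.ip_scale_right by (rule minus_mult_left[symmetric])
  finally have "(real (N x) + 1) * chain.ip L N F (bond N x F) \<le> 0"
    using chain.ip_self_nonneg[of L N "bond N x F"] by linarith
  then show ?thesis by (simp add: mult_le_0_iff)
qed

text \<open>The variational half of \<open>gse\<close>, which makes sense on a zero space as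
  well.\<close>

definition lower_bound :: "nat \<Rightarrow> (nat \<Rightarrow> nat) \<Rightarrow> (nat \<Rightarrow> real) \<Rightarrow> int \<Rightarrow> real \<Rightarrow> bool" where
  "lower_bound L N J k e \<longleftrightarrow> (\<forall>u\<in>hw L N k. e * chain.ip L N u u \<le> chain.ip L N u (ham L N J u))"

text \<open>The Hamiltonian with a longer last spin is a compression of the original one, up to a
  nonnegative term when a new site is opened.\<close>

lemma ip_ham_split:
  assumes y: "y \<in> {1..L}" and N': "N' = N(y := Suc (N y))" and J: "\<forall>x\<in>{1..<L}. J x > 0"
    and last: "y < L \<Longrightarrow> N (Suc y) = 0" and F: "F \<in> chain.supp L N'"
  shows "chain.ip L N (intercept N y F) (ham L N J (intercept N y F))
      + chain.ip L N (slope N y F) (ham L N J (slope N y F)) \<le> chain.ip L N' F (ham L N' J F)"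
proof -
  define A B where "A = intercept N y F" and "B = slope N y F"
  define k where "k N x = 2 * J x / (real (N x) * real (N (Suc x)))" for N :: "nat \<Rightarrow> nat" and x
  have AB: "A \<in> chain.supp L N" "B \<in> chain.supp L N"
    using supp_intercept[OF y N' F] supp_slope[OF y N' F] by (auto simp: A_def B_def)
  have FAB: "F = A + zmul y B" by (simp add: A_def B_def intercept_def)
  have "k N' x * chain.ip L N' F (bond N' x F)
      \<le> k N x * (chain.ip L N A (bond N x A) + chain.ip L N B (bond N x B))" if x: "x \<in> {1..<L}" for x
  proof -
    have sup: "bond N x A \<in> chain.supp L N" "bond N x B \<in> chain.supp L N"
      using AB x by (auto intro: supp_bond)
    have split: "chain.ip L N A (bond N x A) + chain.ip L N B (bond N x B)
        = chain.ip L N' F (bond N x A + zmul y (bond N x B))"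
      using ip_split[OF y N' sup, of F] by (simp add: A_def B_def)
    \<comment> \<open>To the right of y nothing is coupled. Opening a new site costs nonnegative
      energy, and only there can equality fail. For \<open>N y > 0\<close> the bond is handled by
      \<open>zmul_bond_top\<close>; all other bonds commute with z_y.\<close>
    consider "x = y" | "Suc x = y" "N y = 0" | "Suc x = y" "N y > 0" | "x \<noteq> y" "Suc x \<noteq> y" by blast
    then show ?thesis
    proof cases
      case 1
      then show ?thesis using last x by (simp add: k_def N')
    next
      case 2
      then have "chain.ip L N' F (bond N' x F) \<le> 0"
        using F x by (intro ip_bond_half_nonpos) (auto simp: N')
      moreover have "J x > 0" using J x by blast
      then have "k N' x \<ge> 0" by (simp add: k_def)
      moreover have "k N x = 0" using 2 by (simp add: k_def)
      ultimately show ?thesis by (simp add: mult_nonneg_nonpos)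
    next
      case 3
      have "real (Suc (N y)) * (chain.ip L N A (bond N x A) + chain.ip L N B (bond N x B))
          = chain.ip L N' F (real (Suc (N y)) *\<^sub>R (bond N x A + zmul y (bond N x B)))"
        unfolding split chain.ip_scale_right ..
      also have "\<dots> = real (N y) * chain.ip L N' F (bond N' x F)"
        using zmul_bond_top[of N' N x F] 3(1) N' unfolding A_def B_def by (simp add: chain.ip_scale_right)
      finally have r1: "real (N y) * chain.ip L N' F (bond N' x F)
        = real (Suc (N y)) * (chain.ip L N A (bond N x A) + chain.ip L N B (bond N x B))" ..
      have r2: "k N' x * real (Suc (N y)) = k N x * real (N y)"
        using 3 by (auto simp: k_def N')
      have "k1 * I = k0 * S" if "n * I = m * S" "k1 * m = k0 * n" "m \<noteq> 0" for n m I S k0 k1 :: real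
      proof -
        have "m * (k1 * I) = m * (k0 * S)" using that by algebra
        then show ?thesis using that(3) by simp
      qed
      from this[OF r1 r2] show ?thesis by simp
    next
      case 4
      have "bond N' x f = bond N x f" for f using 4 by (simp add: bond_def N')
      moreover have "bond N x F = bond N x A + zmul y (bond N x B)"
        using 4 by (subst FAB) (simp add: bond_simps zmul_bond_other)
      moreover have "k N' x = k N x" using 4 by (simp add: k_def N')
      ultimately show ?thesis using split by simp
    qed
  qed
  then have "(\<Sum>x\<in>{1..<L}. k N' x * chain.ip L N' F (bond N' x F))
      \<le> (\<Sum>x\<in>{1..<L}. k N x * (chain.ip L N A (bond N x A) + chain.ip L N B (bond N x B)))"
    by (rule sum_mono)
  then show ?thesis
    unfolding A_def[symmetric] B_def[symmetric] ham_def
    by (simp add: chain.ip_simps chain.ip_sum_right k_def[symmetric] distrib_left sum.distrib)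
qed

text \<open>The polarised vector consists of a part built from A0 and a part built from B, of
  different total spin. The Hamiltonian does not mix them, so bounds at the levels k + 1 and k of
  the shorter chain add up.\<close>

lemma lower_bound_step:
  assumes y: "y \<in> {1..L}" and N': "N' = N(y := Suc (N y))" and J: "\<forall>x\<in>{1..<L}. J x > 0"
    and last: "y < L \<Longrightarrow> N (Suc y) = 0"
    and lb: "lower_bound L N J (k + 1) e" "lower_bound L N J k e"
  shows "lower_bound L N' J (k + 1) e"
  unfolding lower_bound_def
proof
  fix F assume F: "F \<in> hw L N' (k + 1)"
  then have Fs: "F \<in> chain.supp L N'" by (simp add: hw_def)
  define A B where "A = intercept N y F" and "B = slope N y F"
  have B: "B \<in> hw L N k" using slope_hw[OF y N' F] by (simp add: B_def)
  have A: "A \<in> chain.supp L N" "homog L (k + 1) A" "dtot L A = - B"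
    using intercept_supp_homog[OF y N' F] unfolding A_def B_def by simp_all
  define \<sigma> where "\<sigma> = real (\<Sum>x\<in>{1..L}. N x) - 2 * of_int k"
  define A0 where "A0 = A + (1 / \<sigma>) *\<^sub>R smintot L N B"
  have A0: "A0 \<in> hw L N (k + 1)" using correction(2)[OF A B] unfolding A0_def \<sigma>_def .
  have zero: "\<sigma> \<le> 0 \<Longrightarrow> B = 0" using correction(1)[OF A B] unfolding \<sigma>_def .
  have sup: "A0 \<in> chain.supp L N" "B \<in> chain.supp L N" "smintot L N B \<in> chain.supp L N"
    using A0 B supp_smintot by (auto simp: hw_def)
  have D: "dtot L A0 = 0" "dtot L B = 0" "dtot L (ham L N J A0) = 0"
    using A0 B ham_hw by (auto simp: hw_def)
  have DD: "dtot L (smintot L N B) = \<sigma> *\<^sub>R B" using dtot_smintot_hw[OF B] by (simp add: \<sigma>_def)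
  define P where "P = smintot L N B"
  have hamP: "ham L N J P \<in> chain.supp L N" using sup supp_ham by (simp add: P_def)
  have ip1: "chain.ip L N f P = chain.ip L N (dtot L f) B" if "f \<in> chain.supp L N" for f
    using ip_dtot[OF that, of B] by (simp add: P_def)
  \<comment> \<open>S- B is orthogonal to everything annihilated by S+, and the Hamiltonian commutes
    with S+.\<close>
  have cross: "chain.ip L N A0 P = 0" "chain.ip L N P A0 = 0" "chain.ip L N P (ham L N J A0) = 0"
      "chain.ip L N A0 (ham L N J P) = 0"
  proof -
    show 1: "chain.ip L N A0 P = 0" using ip1[OF sup(1)] D by simp
    then show "chain.ip L N P A0 = 0" by (simp add: chain.ip_commute)
    have "chain.ip L N (ham L N J A0) P = 0" using ip1[OF supp_ham[OF sup(1)]] D by simp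
    then show "chain.ip L N P (ham L N J A0) = 0" by (simp add: chain.ip_commute)
    then show "chain.ip L N A0 (ham L N J P) = 0"
      using ip_ham[of A0 L N P J] sup by (simp add: P_def chain.ip_commute)
  qed
  have PP: "chain.ip L N P P = \<sigma> * chain.ip L N B B"
    using ip1[of P] sup DD by (simp add: P_def chain.ip_simps)
  have PHP: "chain.ip L N P (ham L N J P) = \<sigma> * chain.ip L N B (ham L N J B)"
    using ip1[OF hamP] DD
    by (simp add: dtot_ham P_def tot_simps chain.ip_simps chain.ip_commute)
  have AA: "A = A0 - (1 / \<sigma>) *\<^sub>R P" by (simp add: A0_def P_def)
  \<comment> \<open>Also true for \<sigma> = 0, where both sides are 0.\<close>
  have s: "(1 / \<sigma>) * (1 / \<sigma>) * \<sigma> = 1 / \<sigma>" by simp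
  have 1: "chain.ip L N A A = chain.ip L N A0 A0 + (1 / \<sigma>) * chain.ip L N B B"
    unfolding AA using s by (simp add: chain.ip_simps cross PP)
  have 2: "chain.ip L N A (ham L N J A) = chain.ip L N A0 (ham L N J A0) + (1 / \<sigma>) * chain.ip L N B (ham L N J B)"
    unfolding AA using s by (simp add: tot_simps chain.ip_simps cross PHP)
  have lbB: "e * chain.ip L N B B \<le> chain.ip L N B (ham L N J B)"
    using lb(2) B by (simp add: lower_bound_def)
  have lbA: "e * chain.ip L N A0 A0 \<le> chain.ip L N A0 (ham L N J A0)"
    using lb(1) A0 by (simp add: lower_bound_def)
  have lbB': "(1 / \<sigma>) * (e * chain.ip L N B B) \<le> (1 / \<sigma>) * chain.ip L N B (ham L N J B)"
  proof (cases "\<sigma> \<le> 0")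
    case True
    then show ?thesis using zero by (simp add: tot_simps)
  qed (use lbB in \<open>simp add: divide_right_mono\<close>)
  have "e * chain.ip L N' F F = e * chain.ip L N A A + e * chain.ip L N B B"
    unfolding ip_split_self[OF y N' Fs] A_def B_def by (simp add: distrib_left)
  also have "\<dots> \<le> chain.ip L N A (ham L N J A) + chain.ip L N B (ham L N J B)"
    unfolding 1 2 using lbA lbB lbB' by (simp add: algebra_simps)
  also have "\<dots> \<le> chain.ip L N' F (ham L N' J F)"
    using ip_ham_split[OF y N' J last Fs] by (simp add: A_def B_def)
  finally show "e * chain.ip L N' F F \<le> chain.ip L N' F (ham L N' J F)" .
qed

section \<open>Ground states inside the cone\<close>

lemma symmetric_shifted:
  "symmetric_operator (conf L N) (wt L N) (shifted L N J c) (hw L N k)"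
proof -
  have "shifted L N J c = (\<lambda>f. c *\<^sub>R f + (- 1) *\<^sub>R ham L N J f)" by (simp add: fun_eq_iff shifted_def)
  then show ?thesis using symmetric_ham[of L N c "- 1" J k] by simp
qed

lemma ham_bound: "\<exists>B. \<forall>u\<in>hw L N k. \<bar>chain.ip L N u (ham L N J u)\<bar> \<le> B * chain.ip L N u u"
  using symmetric_operator.form_bound[OF symmetric_ham[of L N 0 1 J k]] by (auto simp: hw_def)

text \<open>As c bounds the form of \<open>ham\<close>, the form of the shifted operator lies
  between 0 and c - e, and \<open>norm_bound\<close> applies.\<close>

lemma shifted_norm_bound:
  assumes gse: "gse L N J k e" and c: "c \<ge> e"
    and B: "\<And>u. u \<in> hw L N k \<Longrightarrow> \<bar>chain.ip L N u (ham L N J u)\<bar> \<le> c * chain.ip L N u u"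
    and u: "u \<in> hw L N k"
  shows "chain.ip L N (shifted L N J c u) (shifted L N J c u) \<le> (c - e)\<^sup>2 * chain.ip L N u u"
proof (rule symmetric_operator.norm_bound[OF symmetric_shifted _ _ _ u])
  show "0 \<le> chain.ip L N u (shifted L N J c u)" if "u \<in> hw L N k" for u
    using B[OF that] by (simp add: shifted_def chain.ip_simps)
  show "chain.ip L N u (shifted L N J c u) \<le> (c - e) * chain.ip L N u u" if "u \<in> hw L N k" for u
    using gse that by (simp add: shifted_def chain.ip_simps gse_def algebra_simps)
qed (use c in simp)

lemma cone_nonzero_member:
  assumes "finite I" "f \<in> cone_of I g" "f \<noteq> 0"
  shows "\<exists>i\<in>I. \<exists>a>0. f - a *\<^sub>R g i \<in> cone_of I g"
proof -
  obtain a where a: "\<forall>i\<in>I. 0 \<le> a i" "f = (\<Sum>i\<in>I. a i *\<^sub>R g i)"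
    using assms(2) unfolding cone_of_def by blast
  have "\<exists>i\<in>I. a i \<noteq> 0"
  proof (rule ccontr)
    assume "\<not> ?thesis"
    then show False using a(2) assms(3) by simp
  qed
  then obtain i where i: "i \<in> I" "a i > 0" using a(1) by (metis less_eq_real_def)
  have "f - a i *\<^sub>R g i = (\<Sum>j\<in>I - {i}. a j *\<^sub>R g j)"
    unfolding a(2) using assms(1) i(1) by (simp add: sum.remove)
  also have "\<dots> \<in> cone_of I g"
    using a assms(1) by (intro cone_sum cone_scale cone_gen) auto
  finally show ?thesis using i by blast
qed

lemma kcone_hw: "f \<in> kcone L N n \<Longrightarrow> f \<in> hw L N (int n)"
  unfolding kcone_def using cone_subset_subspace[OF subspace_hw, of "arcs L N n" gen L N "int n" f] gen_hw by blast

lemma kcone_ev_pos: "f \<in> kcone L N n \<Longrightarrow> f \<noteq> 0 \<Longrightarrow> 0 < ev L N f"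
  unfolding kcone_def by (rule cone_functional_pos[OF linear_ev ev_gen_pos])

lemma hub_dominates:
  assumes h: "h \<in> arcs L N n" "\<forall>M\<in>arcs L N n. gen h - gen M \<in> kcone L N n" and f: "f \<in> hw L N (int n)"
  shows "\<exists>\<tau>\<ge>0. \<tau> *\<^sub>R gen h - f \<in> kcone L N n \<and> \<tau> *\<^sub>R gen h + f \<in> kcone L N n"
  unfolding kcone_def
proof (rule span_dominated[OF _ finite_arcs hw_subset_span[OF f]])
  fix M assume "M \<in> arcs L N n"
  then have "1 *\<^sub>R gen h - gen M \<in> cone_of (arcs L N n) gen" using h(2) by (simp add: kcone_def)
  then show "\<exists>c\<ge>0. c *\<^sub>R gen h - gen M \<in> cone_of (arcs L N n) gen" by (metis zero_le_one)
qed

text \<open>The order unit \<open>gen h\<close> dominates an arbitrary ground state with both signs,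
  which is the input of \<open>cone_eigenvector\<close>.\<close>

lemma ground_state_in_cone:
  assumes left_packed: "left_packed L m N" and J: "\<forall>x\<in>{1..<L}. J x > 0" and gse: "gse L N J (int n) e"
  shows "\<exists>\<psi>\<in>kcone L N n. \<psi> \<noteq> 0 \<and> ham L N J \<psi> = e *\<^sub>R \<psi>"
proof -
  obtain v where v: "v \<in> hw L N (int n)" "v \<noteq> 0" "ham L N J v = e *\<^sub>R v"
    using gse by (auto simp: gse_def)
  then have ne: "arcs L N n \<noteq> {}" using hw_nonzero_iff by blast
  obtain B where B: "\<And>u. u \<in> hw L N (int n) \<Longrightarrow> \<bar>chain.ip L N u (ham L N J u)\<bar> \<le> B * chain.ip L N u u"
    using ham_bound by blast
  \<comment> \<open>Three demands: the cone is preserved, the shifted form is nonnegative, and the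
    eigenvalue c - e is positive.\<close>
  define c where "c = max (shift_const L N J) (max B (e + 1))"
  have c: "c \<ge> shift_const L N J" "c \<ge> B" "c \<ge> e + 1" by (auto simp: c_def)
  have Bc: "\<bar>chain.ip L N u (ham L N J u)\<bar> \<le> c * chain.ip L N u u" if "u \<in> hw L N (int n)" for u
    using B[OF that] mult_right_mono[OF c(2) chain.ip_self_nonneg[of L N u]] by linarith
  obtain h where h: "h \<in> arcs L N n" "\<forall>M\<in>arcs L N n. gen h - gen M \<in> kcone L N n"
    using hub_exists[OF J c(1) left_packed ne] by blast
  obtain \<tau> where \<tau>: "\<tau> *\<^sub>R gen h - v \<in> kcone L N n" "\<tau> *\<^sub>R gen h + v \<in> kcone L N n"
    using hub_dominates[OF h v(1)] by blast
  have "\<exists>\<psi>\<in>cone_of (arcs L N n) gen. \<psi> \<noteq> 0 \<and> shifted L N J c \<psi> = (c - e) *\<^sub>R \<psi>"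
  proof (rule symmetric_operator.cone_eigenvector[OF symmetric_shifted _ _ linear_ev ev_gen_pos finite_arcs])
    show "chain.ip L N (shifted L N J c u) (shifted L N J c u) \<le> (c - e)\<^sup>2 * chain.ip L N u u"
      if "u \<in> hw L N (int n)" for u
      using c(3) Bc that by (intro shifted_norm_bound[OF gse]) auto
    show "shifted L N J c (gen M) \<in> cone_of (arcs L N n) gen" if "M \<in> arcs L N n" for M
      using shifted_kcone[OF J c(1) kcone_gen[OF that]] by (simp add: kcone_def)
    show "gen h \<in> cone_of (arcs L N n) gen" "\<tau> *\<^sub>R gen h + v \<in> cone_of (arcs L N n) gen"
      "\<tau> *\<^sub>R gen h - v \<in> cone_of (arcs L N n) gen"
      using kcone_gen[OF h(1)] \<tau> by (auto simp: kcone_def)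
    show "shifted L N J c v = (c - e) *\<^sub>R v" using v(3) by (simp add: shifted_def algebra_simps)
  qed (use v c gen_hw in auto)
  then obtain \<psi> where \<psi>: "\<psi> \<in> kcone L N n" "\<psi> \<noteq> 0" "shifted L N J c \<psi> = (c - e) *\<^sub>R \<psi>"
    by (auto simp: kcone_def)
  then have "ham L N J \<psi> = e *\<^sub>R \<psi>" by (simp add: shifted_def algebra_simps)
  then show ?thesis using \<psi> by blast
qed

lemma hub_reached:
  assumes J: "\<forall>x\<in>{1..<L}. J x > 0" and c: "c \<ge> shift_const L N J"
    and \<epsilon>: "\<epsilon> > 0" "\<forall>M\<in>arcs L N n. (shifted L N J c ^^ j) (gen M) - \<epsilon> *\<^sub>R gen h \<in> kcone L N n"
    and f: "f \<in> kcone L N n" "f \<noteq> 0"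
  shows "\<exists>\<delta>>0. (shifted L N J c ^^ j) f - \<delta> *\<^sub>R gen h \<in> kcone L N n"
proof -
  obtain M a where M: "M \<in> arcs L N n" "a > 0" "f - a *\<^sub>R gen M \<in> kcone L N n"
    using cone_nonzero_member[OF finite_arcs] f unfolding kcone_def by blast
  have "(shifted L N J c ^^ j) (f - a *\<^sub>R gen M)
      + a *\<^sub>R ((shifted L N J c ^^ j) (gen M) - \<epsilon> *\<^sub>R gen h) \<in> kcone L N n"
    using M \<epsilon> by (intro kcone_add kcone_scale shifted_funpow_kcone[OF J c]) auto
  then have "(shifted L N J c ^^ j) f - (a * \<epsilon>) *\<^sub>R gen h \<in> kcone L N n"
    using linear_shifted_funpow[where j = j] by (simp add: linear_diff linear_scale algebra_simps)
  then show ?thesis using M(2) \<epsilon>(1) by (metis mult_pos_pos)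
qed

text \<open>On an eigenvector the power of the shifted operator is a positive multiple. Reaching
  \<open>gen h\<close> therefore means lying above a multiple of it, and \<open>gen h\<close> lies
  above every generator.\<close>

lemma ground_state_interior:
  assumes left_packed: "left_packed L m N" and J: "\<forall>x\<in>{1..<L}. J x > 0"
    and \<psi>: "\<psi> \<in> kcone L N n" "\<psi> \<noteq> 0" "ham L N J \<psi> = e *\<^sub>R \<psi>" and M: "M \<in> arcs L N n"
  shows "\<exists>\<epsilon>>0. \<psi> - \<epsilon> *\<^sub>R gen M \<in> kcone L N n"
proof -
  define c where "c = max (shift_const L N J) (e + 1)"
  have c: "c \<ge> shift_const L N J" "c - e > 0" by (auto simp: c_def)
  obtain h j \<epsilon> where h: "h \<in> arcs L N n" "\<forall>M\<in>arcs L N n. gen h - gen M \<in> kcone L N n"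
    and \<epsilon>: "\<epsilon> > 0" "\<forall>M\<in>arcs L N n. (shifted L N J c ^^ j) (gen M) - \<epsilon> *\<^sub>R gen h \<in> kcone L N n"
    using hub_exists[OF J c(1) left_packed, of n] M by blast
  obtain \<delta> where \<delta>: "\<delta> > 0" "(shifted L N J c ^^ j) \<psi> - \<delta> *\<^sub>R gen h \<in> kcone L N n"
    using hub_reached[OF J c(1) \<epsilon> \<psi>(1,2)] by blast
  have "shifted L N J c \<psi> = (c - e) *\<^sub>R \<psi>" using \<psi>(3) by (simp add: shifted_def algebra_simps)
  then have pow: "(shifted L N J c ^^ j) \<psi> = (c - e) ^ j *\<^sub>R \<psi>"
    by (induction j) (simp_all add: linear_scale[OF linear_shifted])
  have pos: "(c - e) ^ j > 0" using c(2) by simp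
  have "(1 / (c - e) ^ j) *\<^sub>R (((shifted L N J c ^^ j) \<psi> - \<delta> *\<^sub>R gen h) + \<delta> *\<^sub>R (gen h - gen M)) \<in> kcone L N n"
    using \<delta> h M pos by (intro kcone_add kcone_scale) auto
  then have "\<psi> - (\<delta> / (c - e) ^ j) *\<^sub>R gen M \<in> kcone L N n"
    unfolding pow using c(2) by (simp add: algebra_simps)
  then show ?thesis using \<delta>(1) pos by (intro exI[of _ "\<delta> / (c - e) ^ j"]) auto
qed

section \<open>Comparison of the Hamiltonians when the last spin grows\<close>

context
  fixes L x n :: nat and N N' :: "nat \<Rightarrow> nat" and J :: "nat \<Rightarrow> real" and M :: "(nat \<times> nat) multiset"
  assumes M: "M \<in> arcs L N n" and x: "x \<in> {1..<L}" and N': "N' = N(Suc x := Suc (N (Suc x)))"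
    and J: "\<forall>x\<in>{1..<L}. J x > 0" and Nx: "1 \<le> N x" and last: "\<And>z. Suc x < z \<Longrightarrow> z \<le> L \<Longrightarrow> N z = 0"
begin

text \<open>Nothing is occupied beyond x + 1, so no arc starts there. The signs of the differences
  below depend on this.\<close>

lemma end_arc: "(a, b) \<in># M \<Longrightarrow> 1 \<le> a \<and> a < b \<and> b \<le> Suc x"
proof -
  assume "(a, b) \<in># M"
  from arcs_memberD[OF M this] show ?thesis using last[of b] by (cases "Suc x < b") auto
qed

lemma right_arc_form: "e \<in># right_arcs x M \<Longrightarrow> e \<in># M \<and> (\<exists>a. e = (a, Suc x) \<and> 1 \<le> a \<and> a < x)"
  using end_arc by (cases e) (fastforce simp: right_arcs_def touches_def)

lemma left_arc_form: "e \<in># left_arcs x M \<Longrightarrow> e \<in># M \<and> (\<exists>b. e = (b, x) \<and> 1 \<le> b \<and> b < x)"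
  using end_arc by (cases e) (fastforce simp: left_arcs_def touches_def)

lemma deg_le: "z \<in> {1..L} \<Longrightarrow> deg M z \<le> N z"
  using M by (simp add: arcs_def)

text \<open>(z_a - z_{x+1}) - (z_a - z_x) = z_x - z_{x+1}: the difference is a direct arc, which
  takes the free place at x.\<close>

lemma right_diff:
  assumes e: "e \<in># right_arcs x M" and free: "deg M x < N x"
  shows "gen M - gen (repl x e M) \<in> gen ` arcs L N' n"
proof -
  obtain a where a: "e = (a, Suc x)" "1 \<le> a" "a < x" "e \<in># M" using right_arc_form[OF e] by blast
  then obtain R where R: "M = add_mset (a, Suc x) R" by (blast dest: multi_member_split)
  have "{#(x, Suc x)#} + R \<in> arcs L N' n"
  proof (rule arcs_replace[of "{#(a, Suc x)#}"])
    show "\<forall>z\<in>{1..L}. deg ({#(x, Suc x)#} + R) z \<le> N' z"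
    proof
      fix z assume z: "z \<in> {1..L}"
      show "deg ({#(x, Suc x)#} + R) z \<le> N' z"
        using deg_le[OF z] free a unfolding R N' by (auto simp: deg_add split: if_splits)
    qed
    show "{#(a, Suc x)#} + R \<in> arcs L N' n" using arcs_mono[OF M, of N'] R by (simp add: N')
  qed (use x in auto)
  moreover have "gen M - gen (repl x e M) = gen ({#(x, Suc x)#} + R)"
    using a dmul_chain(1)[of a "Suc x" "gen R" x] unfolding R
    by (simp add: repl_def move_def swap_site_def gen_add)
  ultimately show ?thesis by auto
qed

lemma left_repl:
  assumes e: "e \<in># left_arcs x M"
  shows "repl x e M \<in> arcs L N' n"
proof -
  obtain b where b: "e = (b, x)" "1 \<le> b" "b < x" "e \<in># M" using left_arc_form[OF e] by blast
  have "M \<in> arcs L N' n" using arcs_mono[OF M, of N'] by (simp add: N')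
  moreover have "deg M (Suc x) \<le> N (Suc x)" using deg_le x by auto
  ultimately show ?thesis using e by (intro left_arc_move[OF _ x]) (auto simp: N')
qed

text \<open>Again a direct arc; its end at x + 1 takes the place that \<open>N'\<close>
  adds.\<close>

lemma left_diff:
  assumes e: "e \<in># left_arcs x M"
  shows "gen (repl x e M) - gen M \<in> gen ` arcs L N' n"
proof -
  obtain b where b: "e = (b, x)" "1 \<le> b" "b < x" "e \<in># M" using left_arc_form[OF e] by blast
  then obtain R where R: "M = add_mset (b, x) R" by (blast dest: multi_member_split)
  have "{#(x, Suc x)#} + R \<in> arcs L N' n"
  proof (rule arcs_replace[of "{#(b, x)#}"])
    show "\<forall>z\<in>{1..L}. deg ({#(x, Suc x)#} + R) z \<le> N' z"
    proof
      fix z assume z: "z \<in> {1..L}"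
      show "deg ({#(x, Suc x)#} + R) z \<le> N' z"
        using deg_le[OF z] b unfolding R N' by (auto simp: deg_add split: if_splits)
    qed
    show "{#(b, x)#} + R \<in> arcs L N' n" using arcs_mono[OF M, of N'] R by (simp add: N')
  qed (use x in auto)
  moreover have "gen (repl x e M) - gen M = gen ({#(x, Suc x)#} + R)"
    using b dmul_chain(1)[of b "Suc x" "gen R" x] unfolding R
    by (simp add: repl_def move_def swap_site_def gen_add)
  ultimately show ?thesis by auto
qed

text \<open>e' is moved in both terms, so only the move of e is compared. The result uses the place
  that \<open>N'\<close> adds at x + 1.\<close>

lemma exchange_diff:
  assumes e: "e \<in># right_arcs x M" and e': "e' \<in># left_arcs x M"
  shows "gen (repl x e' M) - gen (repl x e' (repl x e M)) \<in> gen ` arcs L N' n"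
proof -
  obtain a where a: "e = (a, Suc x)" "1 \<le> a" "a < x" "e \<in># M" using right_arc_form[OF e] by blast
  obtain b where b: "e' = (b, x)" "1 \<le> b" "b < x" "e' \<in># M" using left_arc_form[OF e'] by blast
  obtain R where R: "M = add_mset (a, Suc x) (add_mset (b, x) R)"
  proof -
    obtain R1 where R1: "M = add_mset (a, Suc x) R1" using a by (blast dest: multi_member_split)
    then have "(b, x) \<in># R1" using a b by auto
    then show ?thesis using that R1 by (blast dest: multi_member_split)
  qed
  have "{#(b, Suc x), (x, Suc x)#} + R \<in> arcs L N' n"
  proof (rule arcs_replace[of "{#(a, Suc x), (b, x)#}"])
    show "\<forall>z\<in>{1..L}. deg ({#(b, Suc x), (x, Suc x)#} + R) z \<le> N' z"
    proof
      fix z assume z: "z \<in> {1..L}"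
      show "deg ({#(b, Suc x), (x, Suc x)#} + R) z \<le> N' z"
        using deg_le[OF z] a b unfolding R N' by (auto simp: deg_add split: if_splits)
    qed
    show "{#(a, Suc x), (b, x)#} + R \<in> arcs L N' n" using arcs_mono[OF M, of N'] R by (simp add: N')
  qed (use x b in auto)
  moreover have "gen (repl x e' M) - gen (repl x e' (repl x e M)) = gen ({#(b, Suc x), (x, Suc x)#} + R)"
  proof -
    have "repl x e' M = add_mset (b, Suc x) (add_mset (a, Suc x) R)"
      using a b unfolding R by (auto simp: repl_def move_def swap_site_def)
    moreover have "repl x e' (repl x e M) = add_mset (b, Suc x) (add_mset (a, x) R)"
      using a b unfolding R by (auto simp: repl_def move_def swap_site_def)
    ultimately show ?thesis
      using dmul_chain(1)[of a "Suc x" "gen R" x] by (simp add: gen_add dmul_simps[symmetric])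
  qed
  ultimately show ?thesis by auto
qed

text \<open>The bond to the right of x + 1 has coefficient 0 in both chains, and the bonds to the
  left of x do not involve the spin at x + 1.\<close>

lemma ham_diff:
  "ham L N J f - ham L N' J f
    = (2 * J x / (real (N x) * real (Suc (N (Suc x))))) *\<^sub>R bond N' x f
      - (2 * J x / (real (N x) * real (N (Suc x)))) *\<^sub>R bond N x f"
proof -
  define k where "k N z = 2 * J z / (real (N z) * real (N (Suc z)))" for N :: "nat \<Rightarrow> nat" and z
  have "k N' z *\<^sub>R bond N' z f - k N z *\<^sub>R bond N z f = 0" if z: "z \<in> {1..<L} - {x}" for z
  proof (cases "z = Suc x")
    case True
    then have "N (Suc z) = 0" using last[of "Suc z"] z by auto
    then show ?thesis using True by (simp add: k_def N')
  next
    case False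
    then show ?thesis using z by (simp add: k_def N' bond_def)
  qed
  then have "(\<Sum>z\<in>{1..<L}. k N' z *\<^sub>R bond N' z f - k N z *\<^sub>R bond N z f)
     = k N' x *\<^sub>R bond N' x f - k N x *\<^sub>R bond N x f"
    using x by (subst sum.remove[of _ x]) auto
  then show ?thesis by (simp add: ham_def k_def[symmetric] sum_subtractf) (simp add: k_def N')
qed

lemma kcone_gen_image: "f \<in> gen ` arcs L N' n \<Longrightarrow> f \<in> kcone L N' n"
  using kcone_gen by blast

lemma kcone_sum_mset: "(\<And>e. e \<in># A \<Longrightarrow> f e \<in> kcone L N' n) \<Longrightarrow> (\<Sum>e\<in>#A. f e) \<in> kcone L N' n"
  unfolding kcone_def by (rule cone_sum_mset)

lemma M_arcs': "M \<in> arcs L N' n"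
  using arcs_mono[OF M, of N'] by (simp add: N')

text \<open>What the change of the coefficients in \<open>bond_gen\<close> under \<open>N (x + 1) \<mapsto> N (x + 1) + 1\<close> leaves, up to
  a positive factor, of the difference of the two Hamiltonians on \<open>gen M\<close>.\<close>

definition excess :: pol where
  "excess = (real (N x) - real (deg M x)) *\<^sub>R (\<Sum>e\<in>#right_arcs x M. gen M - gen (repl x e M))
    + (\<Sum>e\<in>#right_arcs x M. \<Sum>e'\<in>#left_arcs x M. gen (repl x e' M) - gen (repl x e' (repl x e M)))
    + real (count M (x, Suc x)) *\<^sub>R (\<Sum>e\<in>#left_arcs x M. gen (repl x e M))
    + (real (count M (x, Suc x)) * (real (N x) - real (deg M x) + 1)) *\<^sub>R gen M"

text \<open>With n the old number of half-spins at x + 1, the terms with n (n + 1) cancel in n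
  \<open>bond N'\<close> - (n + 1) \<open>bond N\<close>, and the remaining operator no longer
  contains n.\<close>

lemma ham_diff_excess:
  assumes "1 \<le> N (Suc x)"
  shows "ham L N J (gen M) - ham L N' J (gen M)
    = (2 * J x / (real (N x) * real (N (Suc x)) * real (Suc (N (Suc x))))) *\<^sub>R excess"
proof -
  let ?n = "real (N (Suc x))" and ?m = "real (Suc (N (Suc x)))"
  let ?g = "gen M"
  have "?n *\<^sub>R bond N' x ?g - ?m *\<^sub>R bond N x ?g
      = dmul x (Suc x) (dmul x (Suc x) (pd x (pd (Suc x) ?g))) - real (N x) *\<^sub>R dmul x (Suc x) (pd (Suc x) ?g)"
    unfolding bond_def N' by (simp add: algebra_simps)
  also have "\<dots> = excess"
    unfolding dmul_dmul_pd_pd_gen[OF arcs_less[OF M]] dmul_pd_right[OF arcs_less[OF M]] excess_def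
      size_deg_left[OF arcs_less[OF M], of x]
    by (simp add: sum_mset_diff sum_mset_const algebra_simps)
  finally have ex: "excess = ?n *\<^sub>R bond N' x ?g - ?m *\<^sub>R bond N x ?g" ..
  have n: "?n \<noteq> 0" "?m \<noteq> 0" using assms by auto
  show ?thesis
    unfolding ham_diff ex using n by (simp add: scaleR_diff_right mult.assoc del: of_nat_Suc)
qed

lemma excess_terms_kcone:
  "(real (N x) - real (deg M x)) *\<^sub>R (\<Sum>e\<in>#right_arcs x M. gen M - gen (repl x e M)) \<in> kcone L N' n"
  "(\<Sum>e\<in>#right_arcs x M. \<Sum>e'\<in>#left_arcs x M. gen (repl x e' M) - gen (repl x e' (repl x e M))) \<in> kcone L N' n"
  "real (count M (x, Suc x)) *\<^sub>R (\<Sum>e\<in>#left_arcs x M. gen (repl x e M)) \<in> kcone L N' n"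
  "(real (count M (x, Suc x)) * (real (N x) - real (deg M x) + 1)) *\<^sub>R gen M \<in> kcone L N' n"
proof -
  have d: "deg M x \<le> N x" using deg_le x by simp
  show "(real (N x) - real (deg M x)) *\<^sub>R (\<Sum>e\<in>#right_arcs x M. gen M - gen (repl x e M)) \<in> kcone L N' n"
  proof (cases "deg M x < N x")
    case True
    then show ?thesis using right_diff
      by (intro kcone_scale kcone_sum_mset kcone_gen_image) auto
  next
    case False
    then have "deg M x = N x" using d by simp
    then show ?thesis by (simp add: kcone_def)
  qed
  show "(\<Sum>e\<in>#right_arcs x M. \<Sum>e'\<in>#left_arcs x M. gen (repl x e' M) - gen (repl x e' (repl x e M)))
      \<in> kcone L N' n"
    using exchange_diff by (intro kcone_sum_mset kcone_gen_image) auto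
  show "real (count M (x, Suc x)) *\<^sub>R (\<Sum>e\<in>#left_arcs x M. gen (repl x e M)) \<in> kcone L N' n"
    using left_repl by (intro kcone_scale kcone_sum_mset kcone_gen) auto
  show "(real (count M (x, Suc x)) * (real (N x) - real (deg M x) + 1)) *\<^sub>R gen M \<in> kcone L N' n"
    using d by (intro kcone_scale kcone_gen[OF M_arcs']) auto
qed

lemma excess_kcone: "excess \<in> kcone L N' n"
  unfolding excess_def by (intro kcone_add excess_terms_kcone)

text \<open>Either a direct arc is present, or some right arc can move to a free place at x, or x is
  full and, being occupied, offers a left arc for an exchange. Each case exhibits a generator inside
  \<open>excess\<close>.\<close>

lemma excess_ge:
  assumes deg: "1 \<le> deg M (Suc x)"
  shows "\<exists>M'\<in>arcs L N' n. excess - gen M' \<in> kcone L N' n"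
proof -
  have d: "deg M x \<le> N x" using deg_le x by simp
  define X1 where "X1 = (real (N x) - real (deg M x)) *\<^sub>R (\<Sum>e\<in>#right_arcs x M. gen M - gen (repl x e M))"
  define X2 where "X2 = (\<Sum>e\<in>#right_arcs x M. \<Sum>e'\<in>#left_arcs x M. gen (repl x e' M) - gen (repl x e' (repl x e M)))"
  define X3 where "X3 = real (count M (x, Suc x)) *\<^sub>R (\<Sum>e\<in>#left_arcs x M. gen (repl x e M))"
  define X4 where "X4 = (real (count M (x, Suc x)) * (real (N x) - real (deg M x) + 1)) *\<^sub>R gen M"
  have ex: "excess = X1 + X2 + X3 + X4" unfolding excess_def X1_def X2_def X3_def X4_def ..
  have inner: "(\<Sum>e'\<in>#left_arcs x M. gen (repl x e' M) - gen (repl x e' (repl x e M))) \<in> kcone L N' n"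
    if "e \<in># right_arcs x M" for e
    using exchange_diff[OF that] by (intro kcone_sum_mset kcone_gen_image)
  have X: "X1 \<in> kcone L N' n" "X2 \<in> kcone L N' n" "X3 \<in> kcone L N' n" "X4 \<in> kcone L N' n"
    unfolding X1_def X2_def X3_def X4_def by (rule excess_terms_kcone)+
  consider (direct) "count M (x, Suc x) \<ge> 1" | (free) e where "e \<in># right_arcs x M" "deg M x < N x"
    | (full) e e' where "e \<in># right_arcs x M" "e' \<in># left_arcs x M"
  proof (cases "count M (x, Suc x) = 0")
    case True
    then have "size (right_arcs x M) \<noteq> 0" using deg size_deg_right[OF arcs_less[OF M], of x] by linarith
    then obtain e where e: "e \<in># right_arcs x M" by (metis multiset_nonemptyE size_empty)
    show ?thesis
    proof (cases "deg M x < N x")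
      case False
      then have "size (left_arcs x M) \<noteq> 0"
        using True Nx size_deg_left[OF arcs_less[OF M], of x] by linarith
      then obtain e' where "e' \<in># left_arcs x M" by (metis multiset_nonemptyE size_empty)
      then show ?thesis using full e by blast
    qed (use free e in blast)
  qed (use direct in linarith)
  then show ?thesis
  proof cases
    case direct
    have "1 * 1 \<le> real (count M (x, Suc x)) * (real (N x) - real (deg M x) + 1)"
      using direct d by (intro mult_mono) auto
    then have "X1 + X2 + X3 + (real (count M (x, Suc x)) * (real (N x) - real (deg M x) + 1) - 1) *\<^sub>R gen M \<in> kcone L N' n"
      using X by (intro kcone_add kcone_scale kcone_gen[OF M_arcs']) auto
    moreover have "X1 + X2 + X3 + (real (count M (x, Suc x)) * (real (N x) - real (deg M x) + 1) - 1) *\<^sub>R gen M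
        = excess - gen M"
      unfolding ex X4_def by (simp only: scaleR_diff_left scaleR_one) (simp add: algebra_simps)
    ultimately show ?thesis using M_arcs' by metis
  next
    case free
    obtain M' where M': "M' \<in> arcs L N' n" "gen M - gen (repl x e M) = gen M'"
      using right_diff[OF free] by blast
    define r where "r = real (N x) - real (deg M x)"
    have r: "r \<ge> 1" using free by (simp add: r_def)
    define S where "S = (\<Sum>d\<in>#right_arcs x M - {#e#}. gen M - gen (repl x d M))"
    have S: "S \<in> kcone L N' n"
      unfolding S_def using right_diff[OF _ free(2)]
      by (intro kcone_sum_mset kcone_gen_image) (meson in_diffD)
    have "X1 - gen M' = r *\<^sub>R S + (r - 1) *\<^sub>R gen M'"
      unfolding X1_def sum_mset_member[OF free(1)] M'(2) r_def[symmetric] S_def[symmetric]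
      by (simp add: algebra_simps)
    then have "excess - gen M' = (r *\<^sub>R S + (r - 1) *\<^sub>R gen M') + X2 + X3 + X4"
      unfolding ex by (simp add: algebra_simps)
    moreover have "\<dots> \<in> kcone L N' n"
      using S r X kcone_gen[OF M'(1)] by (intro kcone_add kcone_scale) auto
    ultimately show ?thesis using M'(1) by metis
  next
    case full
    obtain M' where M': "M' \<in> arcs L N' n"
        "gen (repl x e' M) - gen (repl x e' (repl x e M)) = gen M'"
      using exchange_diff[OF full] by blast
    define S1 where "S1 = (\<Sum>d\<in>#right_arcs x M - {#e#}. \<Sum>e'\<in>#left_arcs x M. gen (repl x e' M) - gen (repl x e' (repl x d M)))"
    define S2 where "S2 = (\<Sum>d\<in>#left_arcs x M - {#e'#}. gen (repl x d M) - gen (repl x d (repl x e M)))"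
    have S1: "S1 \<in> kcone L N' n"
      unfolding S1_def using inner by (rule kcone_sum_mset) (meson in_diffD)
    have S2: "S2 \<in> kcone L N' n"
      unfolding S2_def using exchange_diff[OF full(1)]
      by (intro kcone_sum_mset kcone_gen_image) (meson in_diffD)
    have "X2 = S1 + S2 + gen M'"
      unfolding X2_def sum_mset_member[OF full(1)]
        sum_mset_member[OF full(2), of "\<lambda>d. gen (repl x d M) - gen (repl x d (repl x e M))"]
        M'(2) S1_def[symmetric] S2_def[symmetric] by (simp add: algebra_simps)
    then have "excess - gen M' = X1 + S1 + S2 + X3 + X4" unfolding ex by (simp add: algebra_simps)
    moreover have "\<dots> \<in> kcone L N' n" using S1 S2 X by (intro kcone_add)
    ultimately show ?thesis using M'(1) by metis
  qed
qed

text \<open>Without places at x + 1 there are neither right nor direct arcs, and the old bond has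
  coefficient 0.\<close>

lemma ham_diff_new_site:
  assumes "N (Suc x) = 0"
  shows "ham L N J (gen M) - ham L N' J (gen M)
    = (2 * J x / real (N x)) *\<^sub>R (\<Sum>e\<in>#left_arcs x M. gen (repl x e M) - gen M)"
proof -
  have "deg M (Suc x) = 0" using deg_le[of "Suc x"] x assms by auto
  then have r: "size (right_arcs x M) = 0" "count M (x, Suc x) = 0"
    using size_deg_right[OF arcs_less[OF M], of x] by linarith+
  then have "right_arcs x M = {#}" by simp
  then have "bond N' x (gen M) = (\<Sum>e\<in>#left_arcs x M. gen (repl x e M) - gen M)"
    unfolding bond_gen[OF arcs_less[OF M]] sum_mset_diff sum_mset_const
    using size_deg_left[OF arcs_less[OF M], of x] r \<open>deg M (Suc x) = 0\<close> by (simp add: N' assms)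
  then show ?thesis unfolding ham_diff using assms by simp
qed

lemma ham_decreases: "ham L N J (gen M) - ham L N' J (gen M) \<in> kcone L N' n"
proof (cases "N (Suc x) = 0")
  case True
  have "J x > 0" using J x by blast
  then show ?thesis unfolding ham_diff_new_site[OF True]
    using left_diff by (intro kcone_scale kcone_sum_mset kcone_gen_image) auto
next
  case False
  have "J x > 0" using J x by blast
  then show ?thesis using False ham_diff_excess kcone_scale[OF excess_kcone] by simp
qed

text \<open>The conditional is the last occupied site of the old chain: arcs touching it are the
  ones affected by the added half-spin.\<close>

lemma ham_strictly_decreases:
  assumes "1 \<le> deg M (if N (Suc x) = 0 then x else Suc x)"
  shows "\<exists>M'\<in>arcs L N' n. \<exists>\<epsilon>>0. ham L N J (gen M) - ham L N' J (gen M) - \<epsilon> *\<^sub>R gen M' \<in> kcone L N' n"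
proof (cases "N (Suc x) = 0")
  case True
  have "deg M (Suc x) = 0" using deg_le[of "Suc x"] x True by auto
  then have "count M (x, Suc x) = 0"
    using size_deg_right[OF arcs_less[OF M], of x] by linarith
  moreover have "1 \<le> deg M x" using assms True by simp
  ultimately have "size (left_arcs x M) \<noteq> 0"
    using size_deg_left[OF arcs_less[OF M], of x] by linarith
  then obtain e where e: "e \<in># left_arcs x M" by (metis multiset_nonemptyE size_empty)
  obtain M' where M': "M' \<in> arcs L N' n" "gen (repl x e M) - gen M = gen M'"
    using left_diff[OF e] by blast
  define \<epsilon> where "\<epsilon> = 2 * J x / real (N x)"
  have "J x > 0" using J x by blast
  then have \<epsilon>: "\<epsilon> > 0" using Nx by (simp add: \<epsilon>_def)
  have "ham L N J (gen M) - ham L N' J (gen M) - \<epsilon> *\<^sub>R gen M'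
      = \<epsilon> *\<^sub>R (\<Sum>d\<in>#left_arcs x M - {#e#}. gen (repl x d M) - gen M)"
    unfolding ham_diff_new_site[OF True] sum_mset_member[OF e] M'(2) \<epsilon>_def[symmetric]
    by (simp add: scaleR_add_right)
  moreover have "\<dots> \<in> kcone L N' n"
    using \<epsilon> left_diff by (intro kcone_scale kcone_sum_mset kcone_gen_image) (auto dest: in_diffD)
  ultimately show ?thesis using M'(1) \<epsilon> by metis
next
  case False
  then have N1: "1 \<le> N (Suc x)" by simp
  obtain M' where M': "M' \<in> arcs L N' n" "excess - gen M' \<in> kcone L N' n"
    using excess_ge assms False by auto
  define \<epsilon> where "\<epsilon> = 2 * J x / (real (N x) * real (N (Suc x)) * real (Suc (N (Suc x))))"
  have "J x > 0" using J x by blast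
  then have \<epsilon>: "\<epsilon> > 0" using Nx N1 unfolding \<epsilon>_def by (intro divide_pos_pos mult_pos_pos) auto
  have "ham L N J (gen M) - ham L N' J (gen M) - \<epsilon> *\<^sub>R gen M' = \<epsilon> *\<^sub>R (excess - gen M')"
    unfolding ham_diff_excess[OF N1] \<epsilon>_def by (simp only: scaleR_diff_right)
  then show ?thesis using M' \<epsilon> kcone_scale[OF M'(2), of \<epsilon>] by (metis less_imp_le)
qed

end

lemma arcs_touching_last:
  assumes left_packed: "left_packed L m N" and ne: "arcs L N n \<noteq> {}" and n: "1 \<le> n"
  shows "\<exists>M\<in>arcs L N n. 1 \<le> deg M m"
proof -
  obtain M where M: "M \<in> arcs L N n" using ne by blast
  then have "M \<noteq> {#}" using n by (auto simp: arcs_def)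
  then obtain a b where ab: "(a, b) \<in># M" by (metis multiset_nonemptyE prod.exhaust)
  then obtain R where R: "M = add_mset (a, b) R" by (blast dest: multi_member_split)
  have site: "1 \<le> a" "a < b" "b \<le> m" "m \<le> L"
    using arcs_memberD[OF M ab] left_packed by (auto simp: left_packed_def)
  show ?thesis
  proof (cases "1 \<le> deg M m")
    case False
    then have m: "deg M m = 0" by simp
    have "{#(a, m)#} + R \<in> arcs L N n"
    proof (rule arcs_replace[of "{#(a, b)#}"])
      show "\<forall>z\<in>{1..L}. deg ({#(a, m)#} + R) z \<le> N z"
      proof
        fix z assume z: "z \<in> {1..L}"
        have "deg M z \<le> N z" using M z by (simp add: arcs_def)
        moreover have "1 \<le> N m" using left_packed site by (auto simp: left_packed_def)
        ultimately show "deg ({#(a, m)#} + R) z \<le> N z"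
          using m site unfolding R by (auto simp: deg_add split: if_splits)
      qed
    qed (use M R site in auto)
    moreover have "1 \<le> deg ({#(a, m)#} + R) m" by (simp add: deg_add)
    ultimately show ?thesis by blast
  qed (use M in blast)
qed

text \<open>For the new chain the old ground state satisfies T \<psi> = (c - e) \<psi> + D \<psi>.
  The surplus D \<psi> contains a generator because \<psi> is interior, and irreducibility spreads
  it until it dominates a multiple of the vector itself.\<close>

lemma energy_decreases:
  assumes left_packed: "left_packed L (if N (Suc x) = 0 then x else Suc x) N" "left_packed L (Suc x) N'"
    and x: "x \<in> {1..<L}" and N': "N' = N(Suc x := Suc (N (Suc x)))"
    and J: "\<forall>x\<in>{1..<L}. J x > 0" and n: "1 \<le> n"
    and gse: "gse L N J (int n) e" "gse L N' J (int n) e'"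
  shows "e' < e"
proof -
  have Nx: "1 \<le> N x"
  proof -
    have "x \<in> {1..L}" using x by simp
    then have "1 \<le> N' x" using left_packed(2) unfolding left_packed_def by auto
    then show ?thesis by (simp add: N')
  qed
  have last: "N z = 0" if "Suc x < z" "z \<le> L" for z
  proof -
    have "z \<in> {1..L}" using that by simp
    then have "\<not> 1 \<le> N' z" using left_packed(2) that unfolding left_packed_def by auto
    then show ?thesis using that by (simp add: N')
  qed
  have ne: "arcs L N n \<noteq> {}" using gse(1) hw_nonzero_iff unfolding gse_def by blast
  have ne': "arcs L N' n \<noteq> {}" using gse(2) hw_nonzero_iff unfolding gse_def by blast
  obtain \<psi> where \<psi>: "\<psi> \<in> kcone L N n" "\<psi> \<noteq> 0" "ham L N J \<psi> = e *\<^sub>R \<psi>"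
    using ground_state_in_cone[OF left_packed(1) J gse(1)] by blast
  define D where "D f = ham L N J f - ham L N' J f" for f
  have linD: "linear D" unfolding D_def by (intro linearI) (simp_all add: tot_simps algebra_simps)
  have D_cone: "D f \<in> kcone L N' n" if "f \<in> kcone L N n" for f
    using cone_linear_image[OF linD, of "arcs L N n" gen "arcs L N' n" gen f]
      ham_decreases[OF _ x N' J Nx last] that unfolding kcone_def D_def by blast
  obtain M where M: "M \<in> arcs L N n" "1 \<le> deg M (if N (Suc x) = 0 then x else Suc x)"
    using arcs_touching_last[OF left_packed(1) ne n] by blast
  obtain M' \<epsilon> where M': "M' \<in> arcs L N' n" "\<epsilon> > 0" "D (gen M) - \<epsilon> *\<^sub>R gen M' \<in> kcone L N' n"
    using ham_strictly_decreases[OF M(1) x N' J Nx last M(2)] unfolding D_def by blast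
  obtain \<epsilon>1 where \<epsilon>1: "\<epsilon>1 > 0" "\<psi> - \<epsilon>1 *\<^sub>R gen M \<in> kcone L N n"
    using ground_state_interior[OF left_packed(1) J \<psi> M(1)] by blast
  have "D (\<psi> - \<epsilon>1 *\<^sub>R gen M) + \<epsilon>1 *\<^sub>R (D (gen M) - \<epsilon> *\<^sub>R gen M') \<in> kcone L N' n"
    using \<epsilon>1 M' by (intro kcone_add kcone_scale D_cone) auto
  then have D\<psi>: "D \<psi> - (\<epsilon>1 * \<epsilon>) *\<^sub>R gen M' \<in> kcone L N' n"
    using linD by (simp add: linear_diff linear_scale algebra_simps)
  have \<psi>': "\<psi> \<in> kcone L N' n"
    using \<psi>(1) unfolding kcone_def
    by (rule cone_mono[rotated]) (rule cone_gen[OF finite_arcs], rule arcs_mono, auto simp: N')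
  obtain B where B: "\<And>u. u \<in> hw L N' (int n) \<Longrightarrow> \<bar>chain.ip L N' u (ham L N' J u)\<bar> \<le> B * chain.ip L N' u u"
    using ham_bound by blast
  define c where "c = max (shift_const L N' J) (max B (max e e'))"
  have c: "c \<ge> shift_const L N' J" "c \<ge> B" "c \<ge> e'" "c \<ge> e" by (auto simp: c_def)
  have Bc: "\<bar>chain.ip L N' u (ham L N' J u)\<bar> \<le> c * chain.ip L N' u u" if "u \<in> hw L N' (int n)" for u
    using B[OF that] mult_right_mono[OF c(2) chain.ip_self_nonneg[of L N' u]] by linarith
  obtain h j \<delta> where h: "h \<in> arcs L N' n" "\<forall>M\<in>arcs L N' n. gen h - gen M \<in> kcone L N' n"
    and \<delta>: "\<delta> > 0" "\<forall>M\<in>arcs L N' n. (shifted L N' J c ^^ j) (gen M) - \<delta> *\<^sub>R gen h \<in> kcone L N' n"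
    using hub_exists[OF J c(1) left_packed(2) ne'] by blast
  let ?A = "shifted L N' J c"
  have A\<psi>: "?A \<psi> = (c - e) *\<^sub>R \<psi> + D \<psi>"
    using \<psi>(3) by (simp add: shifted_def D_def algebra_simps)
  \<comment> \<open>The iteration commutes with T and turns the surplus into something above a
    multiple of the order unit \<open>gen h\<close>.\<close>
  define \<phi> where "\<phi> = (?A ^^ j) \<psi>"
  have \<phi>: "\<phi> \<in> kcone L N' n" unfolding \<phi>_def by (rule shifted_funpow_kcone[OF J c(1) \<psi>'])
  have "(?A ^^ j) (D \<psi> - (\<epsilon>1 * \<epsilon>) *\<^sub>R gen M')
      + (\<epsilon>1 * \<epsilon>) *\<^sub>R ((?A ^^ j) (gen M') - \<delta> *\<^sub>R gen h) \<in> kcone L N' n"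
    using D\<psi> \<delta> M' \<epsilon>1 by (intro kcone_add kcone_scale shifted_funpow_kcone[OF J c(1)]) auto
  then have AD: "(?A ^^ j) (D \<psi>) - (\<epsilon>1 * \<epsilon> * \<delta>) *\<^sub>R gen h \<in> kcone L N' n"
    using linear_shifted_funpow[where j = j] by (simp add: linear_diff linear_scale algebra_simps)
  obtain \<tau>0 where \<tau>0: "\<tau>0 \<ge> 0" "\<tau>0 *\<^sub>R gen h - \<phi> \<in> kcone L N' n"
    using hub_dominates[OF h kcone_hw[OF \<phi>]] by blast
  define \<tau> where "\<tau> = \<tau>0 + 1"
  have \<tau>: "\<tau> > 0" using \<tau>0(1) by (simp add: \<tau>_def)
  have \<tau>h: "\<tau> *\<^sub>R gen h - \<phi> \<in> kcone L N' n"
    using kcone_add[OF \<tau>0(2) kcone_gen[OF h(1)]] by (simp add: \<tau>_def algebra_simps)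
  \<comment> \<open>Chosen such that the gained multiple of \<open>gen h\<close> is \<eta> \<tau>
    \<open>gen h\<close>, which dominates \<eta> \<phi>.\<close>
  define \<eta> where "\<eta> = \<epsilon>1 * \<epsilon> * \<delta> / \<tau>"
  have \<eta>: "\<eta> > 0" using \<epsilon>1(1) M'(2) \<delta>(1) \<tau> by (simp add: \<eta>_def)
  have "((?A ^^ j) (D \<psi>) - (\<epsilon>1 * \<epsilon> * \<delta>) *\<^sub>R gen h) + \<eta> *\<^sub>R (\<tau> *\<^sub>R gen h - \<phi>) \<in> kcone L N' n"
    using AD \<tau>h \<eta> by (intro kcone_add kcone_scale) auto
  moreover have "\<eta> * \<tau> = \<epsilon>1 * \<epsilon> * \<delta>" using \<tau> by (simp add: \<eta>_def)
  ultimately have "(?A ^^ j) (D \<psi>) - \<eta> *\<^sub>R \<phi> \<in> kcone L N' n" by (simp add: scaleR_diff_right)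
  moreover have "?A \<phi> = (c - e) *\<^sub>R \<phi> + (?A ^^ j) (D \<psi>)"
  proof -
    have "?A \<phi> = (?A ^^ j) (?A \<psi>)" by (simp add: \<phi>_def funpow_swap1)
    then show ?thesis
      unfolding A\<psi> \<phi>_def using linear_shifted_funpow[where j = j] by (simp add: linear_add linear_scale)
  qed
  ultimately have super: "?A \<phi> - (c - e + \<eta>) *\<^sub>R \<phi> \<in> kcone L N' n" by (simp add: algebra_simps)
  \<comment> \<open>\<phi> lies above \<psi>; were it 0, the pointed cone would contain \<psi> and -
    \<psi>.\<close>
  have "\<phi> \<noteq> 0"
  proof
    assume "\<phi> = 0"
    then have "- \<psi> \<in> kcone L N' n"
      using shifted_funpow_increasing[OF J c(1) \<psi>', of j] by (simp add: \<phi>_def)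
    then have "0 \<le> ev L N' (- \<psi>)"
      unfolding kcone_def
      by (rule cone_functional_nonneg[OF linear_ev, rotated]) (rule less_imp_le[OF ev_gen_pos])
    then show False using kcone_ev_pos[OF \<psi>' \<psi>(2)] by (simp add: linear_neg[OF linear_ev])
  qed
  have "c - e + \<eta> \<le> c - e'"
  proof (rule symmetric_operator.collatz_wielandt_le[OF symmetric_shifted _ _ linear_ev ev_gen_pos])
    show "chain.ip L N' (?A u) (?A u) \<le> (c - e')\<^sup>2 * chain.ip L N' u u" if "u \<in> hw L N' (int n)" for u
      using c(3) Bc that by (intro shifted_norm_bound[OF gse(2)]) auto
    show "?A (gen M) \<in> cone_of (arcs L N' n) gen" if "M \<in> arcs L N' n" for M
      using shifted_kcone[OF J c(1) kcone_gen[OF that]] by (simp add: kcone_def)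
    show "\<phi> \<in> cone_of (arcs L N' n) gen" "?A \<phi> - (c - e + \<eta>) *\<^sub>R \<phi> \<in> cone_of (arcs L N' n) gen"
      using \<phi> super by (auto simp: kcone_def)
  qed (use c \<eta> gen_hw \<open>\<phi> \<noteq> 0\<close> in auto)
  then show ?thesis using \<eta> by simp
qed

section \<open>The first excitation and the induction over the chain\<close>

lemma pd_linear_form:
  assumes v: "v \<in> hw L N 1" and x: "x \<in> {1..L}"
  shows "\<exists>a. pd x v = a *\<^sub>R one_pol"
proof -
  have "coef (pd x v) c = coef (pd x v) (\<lambda>_. 0) * coef one_pol c" for c
  proof (cases "c = (\<lambda>_. 0)")
    case False
    have "coef (pd x v) c = 0"
    proof (rule ccontr)
      assume nz: "coef (pd x v) c \<noteq> 0"
      have "pd x v \<in> chain.supp L N" "homog L 0 (pd x v)"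
        using v x supp_pd[of v L N x] homog_pd[of L 1 v x] by (auto simp: hw_def)
      with nz have "c \<in> conf L N" "int (\<Sum>z\<in>{1..L}. c z) = 0"
        unfolding chain_supp_iff homog_def by blast+
      then have "c \<in> conf L N" "\<forall>z\<in>{1..L}. c z = 0" by (simp_all add: sum_nonneg_eq_0_iff)
      then have "c = (\<lambda>_. 0)" by (auto simp: conf_def fun_eq_iff)
      then show False using False by simp
    qed
    then show ?thesis using False by (simp add: one_pol_def)
  qed (simp add: one_pol_def)
  then have "pd x v = coef (pd x v) (\<lambda>_. 0) *\<^sub>R one_pol" unfolding vec_eq_iff coef_simps by blast
  then show ?thesis by blast
qed

text \<open>In the numbers z x = (v, z_x) the energy is a discrete Dirichlet form. Zero energy makes
  them constant on the occupied sites, so the coefficients of v are proportional to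
  \<open>N x\<close>; translation invariance makes these coefficients sum to 0, hence v = 0.\<close>

lemma first_excitation_pos:
  assumes left_packed: "left_packed L m N" and J: "\<forall>x\<in>{1..<L}. J x > 0"
    and v: "v \<in> hw L N 1" "v \<noteq> 0" "ham L N J v = e *\<^sub>R v"
  shows "0 < e"
proof -
  obtain \<alpha> where \<alpha>: "\<And>x. x \<in> {1..L} \<Longrightarrow> pd x v = \<alpha> x *\<^sub>R one_pol"
    using pd_linear_form[OF v(1)] by metis
  define I where "I = chain.ip L N one_pol one_pol"
  define z where "z x = chain.ip L N v (zmul x one_pol)" for x
  have one0: "one_pol \<noteq> 0" by (auto simp: vec_eq_iff one_pol_def)
  have I: "I > 0" unfolding I_def using one_pol_supp one0 by (rule chain.ip_self_pos)
  have vs: "v \<in> chain.supp L N" using v by (simp add: hw_def)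
  have Nz: "real (N x) * z x = \<alpha> x * I" if "x \<in> {1..L}" for x
  proof -
    have "smin N x one_pol = real (N x) *\<^sub>R zmul x one_pol" by (simp add: smin_def op_simps)
    then have "real (N x) * z x = chain.ip L N v (smin N x one_pol)"
      by (simp add: z_def chain.ip_scale_right)
    also have "\<dots> = chain.ip L N (pd x v) one_pol" using ip_pd[OF vs that] by simp
    also have "\<dots> = \<alpha> x * I" unfolding \<alpha>[OF that] I_def by (simp add: chain.ip_scale_left)
    finally show ?thesis .
  qed
  \<comment> \<open>The factor I, the squared norm of the constant 1, permits replacing \<alpha> x I
    by \<open>N x\<close> z x, also at empty sites.\<close>
  have bond: "I * chain.ip L N v (bond N x v) = - (real (N x) * real (N (Suc x)) * (z x - z (Suc x))\<^sup>2)"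
    if "x \<in> {1..<L}" for x
  proof -
    have xs: "x \<in> {1..L}" "Suc x \<in> {1..L}" using that by auto
    have bv: "bond N x v = (real (N x) * \<alpha> (Suc x) - real (N (Suc x)) * \<alpha> x) *\<^sub>R dmul x (Suc x) one_pol"
      unfolding bond_def \<alpha>[OF xs(1)] \<alpha>[OF xs(2)]
      by (simp add: dmul_simps op_simps algebra_simps)
    have "I * chain.ip L N v (bond N x v)
      = (real (N x) * (\<alpha> (Suc x) * I) - real (N (Suc x)) * (\<alpha> x * I)) * (z x - z (Suc x))"
      unfolding bv dmul_def chain.ip_scale_right chain.ip_diff_right z_def[symmetric]
      by (simp add: algebra_simps)
    also have "\<dots> = - (real (N x) * real (N (Suc x)) * (z x - z (Suc x))\<^sup>2)"
      unfolding Nz[OF xs(1), symmetric] Nz[OF xs(2), symmetric]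
      by (simp add: power2_eq_square algebra_simps)
    finally show ?thesis .
  qed
  define k where "k x = 2 * J x / (real (N x) * real (N (Suc x)))" for x
  have ham_k: "ham L N J v = - (\<Sum>x\<in>{1..<L}. k x *\<^sub>R bond N x v)"
    unfolding ham_def k_def ..
  have "I * (e * chain.ip L N v v) = I * chain.ip L N v (ham L N J v)"
    using v(3) by (simp add: chain.ip_scale_right)
  also have "\<dots> = - (\<Sum>x\<in>{1..<L}. k x * (I * chain.ip L N v (bond N x v)))"
    by (simp add: ham_k chain.ip_simps chain.ip_sum_right sum_distrib_left mult_ac)
  also have "\<dots> = (\<Sum>x\<in>{1..<L}. k x * (real (N x) * real (N (Suc x)) * (z x - z (Suc x))\<^sup>2))"
    using bond by (simp add: sum_negf)
  finally have E: "I * (e * chain.ip L N v v)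
    = (\<Sum>x\<in>{1..<L}. k x * (real (N x) * real (N (Suc x)) * (z x - z (Suc x))\<^sup>2))" .
  have k: "k x \<ge> 0" if "x \<in> {1..<L}" for x
  proof -
    have "J x > 0" using J that by blast
    then show ?thesis by (simp add: k_def)
  qed
  have vv: "chain.ip L N v v > 0" using chain.ip_self_pos[OF vs v(2)] .
  show ?thesis
  proof (rule ccontr)
    assume "\<not> 0 < e"
    then have "I * (e * chain.ip L N v v) \<le> 0"
      using I vv by (simp add: mult_nonneg_nonpos mult_nonpos_nonneg)
    moreover have nn: "0 \<le> k x * (real (N x) * real (N (Suc x)) * (z x - z (Suc x))\<^sup>2)" if "x \<in> {1..<L}" for x
      using k[OF that] by simp
    moreover from nn have "0 \<le> (\<Sum>x\<in>{1..<L}. k x * (real (N x) * real (N (Suc x)) * (z x - z (Suc x))\<^sup>2))"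
      by (rule sum_nonneg)
    ultimately have zero: "(\<Sum>x\<in>{1..<L}. k x * (real (N x) * real (N (Suc x)) * (z x - z (Suc x))\<^sup>2)) = 0"
      unfolding E by linarith
    have each: "k x * (real (N x) * real (N (Suc x)) * (z x - z (Suc x))\<^sup>2) = 0" if "x \<in> {1..<L}" for x
      using zero nn that by (subst (asm) sum_nonneg_eq_0_iff) auto
    have step: "z (Suc x) = z x" if x: "1 \<le> x" "Suc x \<le> m" for x
    proof -
      have xL: "x \<in> {1..<L}" and "1 \<le> N x" "1 \<le> N (Suc x)" using left_packed x by (auto simp: left_packed_def)
      moreover have "J x > 0" using J xL by blast
      ultimately show ?thesis using each[OF xL] by (auto simp: k_def)
    qed
    have const: "1 \<le> x \<Longrightarrow> x \<le> m \<Longrightarrow> z x = z 1" for x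
    proof (induction x)
      case (Suc x)
      then show ?case using step[of x] by (cases "x = 0") auto
    qed simp
    have NI: "\<alpha> x * I = real (N x) * z 1" if x: "x \<in> {1..L}" for x
    proof (cases "x \<le> m")
      case True
      then show ?thesis using Nz[OF x] const[of x] x by simp
    next
      case False
      then have "N x = 0" using left_packed x by (auto simp: left_packed_def)
      then show ?thesis using Nz[OF x] by simp
    qed
    have "(\<Sum>x\<in>{1..L}. \<alpha> x) *\<^sub>R one_pol = 0"
      using v(1) \<alpha> by (simp add: hw_def dtot_def scaleR_sum_left)
    then have "(\<Sum>x\<in>{1..L}. \<alpha> x * I) = 0" using one0 by (simp add: sum_distrib_right[symmetric])
    then have "(\<Sum>x\<in>{1..L}. real (N x)) * z 1 = 0" using NI by (simp add: sum_distrib_right)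
    then have "\<forall>x\<in>{1..L}. real (N x) * z 1 = 0"
      by (auto simp: sum_nonneg_eq_0_iff)
    then have \<alpha>0: "\<alpha> x = 0" if "x \<in> {1..L}" for x using NI[OF that] that I by auto
    have "v = 0"
    proof (rule ccontr)
      assume "v \<noteq> 0"
      then obtain c where c: "coef v c \<noteq> 0" by (auto simp: vec_eq_iff)
      then have "int (\<Sum>x\<in>{1..L}. c x) = 1" using v(1) unfolding hw_def homog_def by blast
      then have "(\<Sum>x\<in>{1..L}. c x) \<noteq> 0" by linarith
      then obtain x where x: "x \<in> {1..L}" "c x \<noteq> 0" by (meson sum.neutral)
      have "coef (zmul x (pd x v)) c = 0" using \<alpha>[OF x(1)] \<alpha>0[OF x(1)] by (simp add: op_simps)
      then show False using c x by (simp add: coef_zmul_pd)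
    qed
    then show False using v(2) by simp
  qed
qed

text \<open>If y has one end too many for the smaller chain, an arc at y is removed, otherwise any
  arc. Level n + 1 of the longer chain thus provides level n of the shorter one.\<close>

lemma arcs_remove:
  assumes M: "M \<in> arcs L (N(y := Suc (N y))) (Suc n)" and y: "y \<in> {1..L}"
  shows "arcs L N n \<noteq> {}"
proof -
  have "M \<noteq> {#}" using M by (auto simp: arcs_def)
  have "\<exists>e\<in>#M. deg M y = Suc (N y) \<longrightarrow> touches y e"
  proof (cases "deg M y = Suc (N y)")
    case True
    then show ?thesis using deg_pos[of M y] by (auto simp: touches_def)
  next
    case False
    then show ?thesis using \<open>M \<noteq> {#}\<close> by (metis multiset_nonemptyE)
  qed
  then obtain e where e: "e \<in># M" "deg M y = Suc (N y) \<longrightarrow> touches y e" by blast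
  obtain R where R: "M = add_mset e R" using e by (blast dest: multi_member_split)
  obtain a b where ab: "e = (a, b)" by force
  have "deg R z \<le> N z" if z: "z \<in> {1..L}" for z
  proof -
    have "deg M z \<le> (N(y := Suc (N y))) z" using M z by (simp add: arcs_def)
    then show ?thesis using e(2) unfolding R ab by (auto simp: deg_add touches_def split: if_splits)
  qed
  then have "R \<in> arcs L N n" using M R by (auto simp: arcs_def)
  then show ?thesis by blast
qed

lemma arcs_pred: "arcs L N (Suc n) \<noteq> {} \<Longrightarrow> arcs L N n \<noteq> {}"
proof -
  assume "arcs L N (Suc n) \<noteq> {}"
  then obtain M where M: "M \<in> arcs L N (Suc n)" by blast
  then have "M \<noteq> {#}" by (auto simp: arcs_def)
  then obtain e R where R: "M = add_mset e R" by (meson multiset_cases)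
  obtain a b where ab: "e = (a, b)" by force
  have "R \<in> arcs L N n" using M unfolding R ab by (fastforce simp: arcs_def deg_add)
  then show ?thesis by blast
qed

lemma gse_arcs: "(\<exists>e. gse L N J (int n) e) \<longleftrightarrow> arcs L N n \<noteq> {}"
  unfolding hw_nonzero_iff[symmetric] using gse_exists by (auto simp: gse_def)

text \<open>The induction removes a half-spin from the last occupied site and keeps n. For n = 0
  this fails, because the energy is 0 for every chain, and positivity of the first excitation takes
  its place.\<close>

lemma consecutive_levels:
  assumes J: "\<forall>x\<in>{1..<L}. J x > 0"
  shows "left_packed L m N \<Longrightarrow> gse L N J (int n) e \<Longrightarrow> gse L N J (int (Suc n)) e' \<Longrightarrow> e < e'"
proof (induction "\<Sum>x\<in>{1..L}. N x" arbitrary: N m n e e')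
  case 0
  have "arcs L N (Suc n) \<noteq> {}" using 0 gse_arcs by blast
  then obtain M where M: "M \<in> arcs L N (Suc n)" by blast
  then have "M \<noteq> {#}" by (auto simp: arcs_def)
  then obtain a b where ab: "(a, b) \<in># M" by (metis multiset_nonemptyE prod.exhaust)
  have "1 \<le> N a" "a \<in> {1..L}" using arcs_memberD[OF M ab] by auto
  then show ?case using 0(1) by simp
next
  case (Suc S)
  note left_packed = Suc.prems(1) and gse = Suc.prems(2,3)
  show ?case
  proof (cases n)
    case 0
    have "one_pol \<in> hw L N 0"
      by (simp add: hw_def one_pol_supp homog_one dtot_def)
    moreover have "one_pol \<noteq> 0" by (auto simp: vec_eq_iff one_pol_def)
    moreover have "ham L N J one_pol = 0 *\<^sub>R one_pol"
      by (simp add: ham_def bond_def dmul_simps op_simps)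
    ultimately have "e \<le> 0" using gse(1) 0 gse_le by fastforce
    moreover have "0 < e'"
    proof -
      obtain v where "v \<in> hw L N 1" "v \<noteq> 0" "ham L N J v = e' *\<^sub>R v"
        using gse(2) 0 by (auto simp: gse_def)
      then show ?thesis by (rule first_excitation_pos[OF left_packed J])
    qed
    ultimately show ?thesis by simp
  next
    case (Suc n')
    obtain M where M: "M \<in> arcs L N n" using gse(1) gse_arcs by blast
    then have "M \<noteq> {#}" using Suc by (auto simp: arcs_def)
    then obtain a b where ab: "(a, b) \<in># M" by (metis multiset_nonemptyE prod.exhaust)
    then have "1 \<le> a" "a < b" "b \<le> m" "m \<le> L"
      using arcs_memberD[OF M ab] left_packed by (auto simp: left_packed_def)
    \<comment> \<open>As n \<ge> 1 there is an arc, so at least two sites are occupied and the last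
      of them has a left neighbour.\<close>
    then obtain x where x: "m = Suc x" "x \<in> {1..<L}" by (cases m) auto
    define N0 where "N0 = N(Suc x := N (Suc x) - 1)"
    have "1 \<le> N (Suc x)" using left_packed x by (auto simp: left_packed_def)
    then have N: "N = N0(Suc x := Suc (N0 (Suc x)))" by (auto simp: N0_def)
    have y: "Suc x \<in> {1..L}" using x by auto
    have good0: "left_packed L (if N0 (Suc x) = 0 then x else Suc x) N0"
      unfolding left_packed_def
    proof (intro conjI ballI)
      show "(if N0 (Suc x) = 0 then x else Suc x) \<le> L" using x by simp
      fix z assume "z \<in> {1..L}"
      then have "1 \<le> N z \<longleftrightarrow> z \<le> Suc x" using left_packed x(1) unfolding left_packed_def by blast
      then show "1 \<le> N0 z \<longleftrightarrow> z \<le> (if N0 (Suc x) = 0 then x else Suc x)"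
        by (cases "z = Suc x") (auto simp: N0_def le_Suc_eq)
    qed
    have S: "S = (\<Sum>x\<in>{1..L}. N0 x)"
    proof -
      have "(\<Sum>x\<in>{1..L}. N x) = Suc (\<Sum>x\<in>{1..L}. N0 x)"
        using sum_upd_Suc[OF y, of N0] N by simp
      then show ?thesis using Suc.hyps(2) by linarith
    qed
    have "arcs L N (Suc n) \<noteq> {}" using gse(2) gse_arcs by blast
    then have ne: "arcs L N0 n \<noteq> {}" using arcs_remove[OF _ y, of _ N0 n] N by auto
    then obtain e1 where e1: "gse L N0 J (int n) e1" using gse_arcs by blast
    have "e < e1"
      using energy_decreases[OF good0 _ x(2) N J _ e1 gse(1)] left_packed x(1) Suc by simp
    moreover have "e1 \<le> e'"
    proof -
      have "lower_bound L N0 J (int n + 1) e1"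
      \<comment> \<open>Level n + 1 may be absent in the shorter chain; the bound is then
        vacuous.\<close>
      proof (cases "arcs L N0 (Suc n) = {}")
        case True
        show ?thesis unfolding lower_bound_def
        proof
          fix u assume "u \<in> hw L N0 (int n + 1)"
          then have "u = 0" using hw_nonzero_iff[of L N0 "Suc n"] True by (auto simp: add.commute)
          then show "e1 * chain.ip L N0 u u \<le> chain.ip L N0 u (ham L N0 J u)" by (simp add: tot_simps)
        qed
      next
        case False
        then obtain e2 where e2: "gse L N0 J (int (Suc n)) e2" using gse_arcs by blast
        have "e1 < e2" using Suc.hyps(1)[OF S good0 e1 e2] .
        show ?thesis unfolding lower_bound_def
        proof
          fix u assume "u \<in> hw L N0 (int n + 1)"
          then have "e2 * chain.ip L N0 u u \<le> chain.ip L N0 u (ham L N0 J u)"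
            using e2 by (auto simp: gse_def add.commute)
          moreover have "e1 * chain.ip L N0 u u \<le> e2 * chain.ip L N0 u u"
            using \<open>e1 < e2\<close> chain.ip_self_nonneg[of L N0 u] by (simp add: mult_right_mono)
          ultimately show "e1 * chain.ip L N0 u u \<le> chain.ip L N0 u (ham L N0 J u)" by linarith
        qed
      qed
      moreover have "lower_bound L N0 J (int n) e1" using e1 by (simp add: gse_def lower_bound_def)
      moreover have "N0 (Suc (Suc x)) = 0" if "Suc x < L"
      proof -
        have "Suc (Suc x) \<in> {1..L}" using that by simp
        then have "\<not> 1 \<le> N (Suc (Suc x))" using left_packed x(1) unfolding left_packed_def by auto
        then show ?thesis by (simp add: N0_def)
      qed
      ultimately have "lower_bound L N J (int n + 1) e1" using lower_bound_step[OF y N J] by blast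
      moreover obtain v where v: "v \<in> hw L N (int n + 1)" "v \<noteq> 0" "ham L N J v = e' *\<^sub>R v"
        using gse(2) by (auto simp: gse_def add.commute)
      ultimately have "e1 * chain.ip L N v v \<le> e' * chain.ip L N v v"
        by (auto simp: lower_bound_def chain.ip_scale_right)
      moreover have "chain.ip L N v v > 0"
        using v by (intro chain.ip_self_pos) (auto simp: hw_def)
      ultimately show ?thesis by simp
    qed
    ultimately show ?thesis by simp
  qed
qed

text \<open>The levels in between exist because an arc can always be dropped.\<close>

lemma levels_increasing:
  assumes J: "\<forall>x\<in>{1..<L}. J x > 0" and left_packed: "left_packed L m N"
  shows "n < n' \<Longrightarrow> gse L N J (int n) e \<Longrightarrow> gse L N J (int n') e' \<Longrightarrow> e < e'"
proof (induction n' arbitrary: e')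
  case (Suc n')
  show ?case
  proof (cases "n = n'")
    case True
    then show ?thesis using consecutive_levels[OF J left_packed] Suc.prems by blast
  next
    case False
    have "arcs L N n' \<noteq> {}" using Suc.prems(3) gse_arcs arcs_pred by blast
    then obtain e'' where e'': "gse L N J (int n') e''" using gse_arcs by blast
    have "e < e''" using Suc.IH[OF _ Suc.prems(2) e''] Suc.prems(1) False by simp
    moreover have "e'' < e'" using consecutive_levels[OF J left_packed e'' Suc.prems(3)] .
    ultimately show ?thesis by simp
  qed
qed simp

section \<open>From spin matrices to polynomials\<close>

text \<open>A spin space fixes the total spin but not S3, whose values correspond to the
  degrees.\<close>

definition component :: "nat \<Rightarrow> int \<Rightarrow> pol \<Rightarrow> pol" where
  "component L d f = Vec (\<lambda>c. if int (\<Sum>x\<in>{1..L}. c x) = d then coef f c else 0)"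

lemma linear_component: "linear (component L d)"
  by (intro linearI) (auto simp: vec_eq_iff component_def)

lemma homog_component: "homog L d (component L d f)"
  by (auto simp: homog_def component_def)

lemma component_homog: "homog L d' f \<Longrightarrow> component L d f = (if d = d' then f else 0)"
  by (auto simp: vec_eq_iff component_def homog_def)

lemma supp_component: "f \<in> chain.supp L N \<Longrightarrow> component L d f \<in> chain.supp L N"
  by (auto simp: chain_supp_iff component_def)

lemma sum_components:
  assumes "f \<in> chain.supp L N"
  shows "f = (\<Sum>d\<in>{0..int (\<Sum>x\<in>{1..L}. N x)}. component L d f)"
proof -
  have "coef f c = (\<Sum>d\<in>{0..int (\<Sum>x\<in>{1..L}. N x)}. if int (\<Sum>x\<in>{1..L}. c x) = d then coef f c else 0)" for c
  proof (cases "c \<in> conf L N")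
    case True
    then have "(\<Sum>x\<in>{1..L}. c x) \<le> (\<Sum>x\<in>{1..L}. N x)" by (intro sum_mono) (auto simp: conf_def)
    then have "int (\<Sum>x\<in>{1..L}. c x) \<in> {0..int (\<Sum>x\<in>{1..L}. N x)}"
      by (metis atLeastAtMost_iff of_nat_0_le_iff of_nat_le_iff)
    then show ?thesis by (simp del: of_nat_sum)
  next
    case False
    then have "coef f c = 0" using assms by (simp add: chain_supp_iff)
    then show ?thesis by simp
  qed
  then show ?thesis unfolding vec_eq_iff coef_sum component_def coef_Vec by blast
qed

lemma component_commute:
  assumes T: "linear T" "\<And>d g. homog L d g \<Longrightarrow> homog L d (T g)" and f: "f \<in> chain.supp L N"
  shows "component L d (T f) = T (component L d f)"
proof -
  let ?I = "{0..int (\<Sum>x\<in>{1..L}. N x)}"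
  have "component L d (T f) = component L d (T (\<Sum>d'\<in>?I. component L d' f))"
    using sum_components[OF f] by simp
  also have "\<dots> = (\<Sum>d'\<in>?I. component L d (T (component L d' f)))"
    by (simp only: linear_sum[OF T(1)] linear_sum[OF linear_component])
  also have "\<dots> = (\<Sum>d'\<in>?I. T (component L d (component L d' f)))"
    using component_homog[OF T(2)[OF homog_component]] component_homog[OF homog_component]
    by (intro sum.cong) (auto simp: linear_0[OF T(1)])
  also have "\<dots> = T (component L d (\<Sum>d'\<in>?I. component L d' f))"
    by (simp only: linear_sum[OF T(1)] linear_sum[OF linear_component])
  finally show ?thesis using sum_components[OF f] by simp
qed

definition sztot :: "nat \<Rightarrow> (nat \<Rightarrow> nat) \<Rightarrow> pol \<Rightarrow> pol" where
  "sztot L N f = (\<Sum>x\<in>{1..L}. sz N x f)"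

definition cas :: "nat \<Rightarrow> (nat \<Rightarrow> nat) \<Rightarrow> pol \<Rightarrow> pol" where
  "cas L N f = (1 / 2) *\<^sub>R (dtot L (smintot L N f) + smintot L N (dtot L f)) + sztot L N (sztot L N f)"

lemma sztot_homog:
  assumes "homog L k f"
  shows "sztot L N f = (real (\<Sum>x\<in>{1..L}. N x) / 2 - of_int k) *\<^sub>R f"
proof -
  have "2 *\<^sub>R sztot L N f = (real (\<Sum>x\<in>{1..L}. N x) - 2 * of_int k) *\<^sub>R f"
    using sum_sz_homog[OF assms, of N] by (simp add: sztot_def scaleR_sum_right del: of_nat_sum)
  also have "\<dots> = 2 *\<^sub>R ((real (\<Sum>x\<in>{1..L}. N x) / 2 - of_int k) *\<^sub>R f)"
    by (simp del: of_nat_sum add: algebra_simps)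
  finally show ?thesis unfolding scaleR_cancel_left by simp
qed

lemma linear_sz: "linear (sz N x)"
  by (intro linearI) (simp_all add: sz_def op_simps algebra_simps)

lemma linear_sztot: "linear (sztot L N)"
  by (intro linearI)
    (simp_all add: sztot_def linear_add[OF linear_sz] linear_scale[OF linear_sz] sum.distrib scaleR_sum_right)

lemma linear_cas: "linear (cas L N)"
  unfolding cas_def
  by (intro linearI)
    (simp_all add: tot_simps linear_add[OF linear_sztot] linear_scale[OF linear_sztot] algebra_simps)

text \<open>The commutator turns the Casimir operator into S- S+ + S3 (S3 + 1), and S3 is a number
  on homogeneous polynomials.\<close>

lemma cas_homog:
  fixes N :: "nat \<Rightarrow> nat"
  assumes "homog L k f"
  defines "s \<equiv> real (\<Sum>x\<in>{1..L}. N x) / 2 - of_int k"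
  shows "cas L N f = smintot L N (dtot L f) + (s * (s + 1)) *\<^sub>R f"
proof -
  have "dtot L (smintot L N f) = smintot L N (dtot L f) + (2 * s) *\<^sub>R f"
    unfolding dtot_smintot sum_sz_homog[OF assms(1)] s_def by (simp del: of_nat_sum)
  moreover have "sztot L N (sztot L N f) = (s * s) *\<^sub>R f"
    using sztot_homog[OF assms(1), of N] by (simp add: s_def linear_scale[OF linear_sztot] del: of_nat_sum)
  ultimately show ?thesis
    by (simp add: cas_def algebra_simps flip: scaleR_2)
qed

lemma homog_cas: "homog L k f \<Longrightarrow> homog L k (cas L N f)"
proof -
  assume f: "homog L k f"
  have "homog L (k - 1 + 1) (smintot L N (dtot L f))" using f by (intro homog_smintot homog_dtot)
  then show ?thesis unfolding cas_homog[OF f] using f by (intro homog_add homog_scale) auto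
qed

text \<open>S+ raises the value s of S3 by one. The change from s (s + 1) to (s + 1) (s + 2) is
  exactly the commutator term 2 (s + 1).\<close>

lemma cas_dtot:
  assumes "homog L k f" shows "cas L N (dtot L f) = dtot L (cas L N f)"
proof -
  have D: "homog L (k - 1) (dtot L f)" using assms by (rule homog_dtot)
  define s where "s = real (\<Sum>x\<in>{1..L}. N x) / 2 - of_int k"
  have 1: "cas L N (dtot L f) = smintot L N (dtot L (dtot L f)) + ((s + 1) * (s + 2)) *\<^sub>R dtot L f"
    using cas_homog[OF D, of N] by (simp add: s_def algebra_simps del: of_nat_sum)
  have 2: "dtot L (smintot L N (dtot L f)) = smintot L N (dtot L (dtot L f)) + (2 * (s + 1)) *\<^sub>R dtot L f"
    unfolding dtot_smintot sum_sz_homog[OF D] by (simp add: s_def algebra_simps del: of_nat_sum)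
  have "dtot L (cas L N f) = dtot L (smintot L N (dtot L f)) + (s * (s + 1)) *\<^sub>R dtot L f"
    unfolding cas_homog[OF assms] s_def by (simp add: tot_simps)
  also have "\<dots> = smintot L N (dtot L (dtot L f)) + (2 * (s + 1) + s * (s + 1)) *\<^sub>R dtot L f"
    unfolding 2 by (simp only: scaleR_add_left add.assoc)
  also have "2 * (s + 1) + s * (s + 1) = (s + 1) * (s + 2)" by (simp add: algebra_simps)
  finally show ?thesis using 1 by simp
qed

text \<open>The squared norm of S- g is twice the spin times the squared norm of g.\<close>

lemma hw_spin_nonneg:
  assumes g: "g \<in> hw L N k" "g \<noteq> 0"
  shows "0 \<le> real (\<Sum>x\<in>{1..L}. N x) / 2 - of_int k"
proof -
  have s: "g \<in> chain.supp L N" "smintot L N g \<in> chain.supp L N"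
    using g supp_smintot by (auto simp: hw_def)
  have "0 \<le> chain.ip L N (smintot L N g) (smintot L N g)" by (rule chain.ip_self_nonneg)
  also have "\<dots> = (real (\<Sum>x\<in>{1..L}. N x) - 2 * of_int k) * chain.ip L N g g"
    using ip_dtot[OF s(2), of g] dtot_smintot_hw[OF g(1)] by (simp add: chain.ip_scale_left)
  finally show ?thesis
    using chain.ip_self_pos[OF s(1) g(2)] by (simp add: zero_le_mult_iff)
qed

text \<open>The value S (S + 1) is shared by -S - 1, which is ruled out since both spins are
  nonnegative.\<close>

lemma hw_spin_value:
  assumes f: "f \<in> hw L N k" "f \<noteq> 0" and cas: "cas L N f = (S * (S + 1)) *\<^sub>R f" and S: "0 \<le> S"
  shows "S = real (\<Sum>x\<in>{1..L}. N x) / 2 - of_int k"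
proof -
  define s where "s = real (\<Sum>x\<in>{1..L}. N x) / 2 - of_int k"
  have "cas L N f = (s * (s + 1)) *\<^sub>R f"
    unfolding s_def using cas_homog[of L k f N] f(1) by (simp add: hw_def tot_simps del: of_nat_sum)
  then have "s * (s + 1) = S * (S + 1)" using cas f(2) by (metis scaleR_cancel_right)
  then have "(s - S) * (s + S + 1) = 0" by (simp add: algebra_simps)
  moreover have "s \<ge> 0" using hw_spin_nonneg[OF f] by (simp add: s_def)
  ultimately show ?thesis using S by (auto simp: s_def)
qed

text \<open>S+ is applied until it annihilates the vector. It preserves both eigenvalue equations
  and lowers the degree, so this happens at degree 0 at the latest.\<close>

lemma highest_weight_homog:
  assumes "homog L (int d) f" "f \<in> chain.supp L N" "f \<noteq> 0" "cas L N f = (S * (S + 1)) *\<^sub>R f"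
    "ham L N J f = e *\<^sub>R f" "0 \<le> S"
  shows "\<exists>k. S = real (\<Sum>x\<in>{1..L}. N x) / 2 - real k \<and> (\<exists>g\<in>hw L N (int k). g \<noteq> 0 \<and> ham L N J g = e *\<^sub>R g)"
  using assms
proof (induction d arbitrary: f)
  case (0 f)
  then have "homog L (- 1) (dtot L f)" using homog_dtot[of L 0 f] by simp
  then have "coef (dtot L f) c = 0" for c unfolding homog_def by (metis of_nat_0_le_iff neg_0_le_iff_le not_one_le_zero)
  then have f: "f \<in> hw L N (int 0)" using 0 by (simp add: hw_def vec_eq_iff)
  have "S = real (\<Sum>x\<in>{1..L}. N x) / 2 - real 0"
    using hw_spin_value[OF f] 0 by simp
  then show ?case using f 0 by blast
next
  case (Suc d f)
  show ?case
  proof (cases "dtot L f = 0")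
    case True
    then have f: "f \<in> hw L N (int (Suc d))" using Suc.prems by (simp add: hw_def)
    have "S = real (\<Sum>x\<in>{1..L}. N x) / 2 - real (Suc d)"
      using hw_spin_value[OF f] Suc.prems by simp
    then show ?thesis using f Suc.prems by blast
  next
    case False
    show ?thesis
    proof (rule Suc.IH[OF _ _ False])
      show "homog L (int d) (dtot L f)" using homog_dtot[OF Suc.prems(1)] by simp
      show "dtot L f \<in> chain.supp L N" using Suc.prems(2) by (rule supp_dtot)
      show "cas L N (dtot L f) = (S * (S + 1)) *\<^sub>R dtot L f"
        unfolding cas_dtot[OF Suc.prems(1)] Suc.prems(4) by (simp add: tot_simps)
      show "ham L N J (dtot L f) = e *\<^sub>R dtot L f"
        using Suc.prems(5) by (simp add: tot_simps flip: dtot_ham)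
    qed (rule Suc.prems(6))
  qed
qed

lemma highest_weight:
  assumes f: "f \<in> chain.supp L N" "f \<noteq> 0" "cas L N f = (S * (S + 1)) *\<^sub>R f"
    "ham L N J f = e *\<^sub>R f" and S: "0 \<le> S"
  shows "\<exists>k. S = real (\<Sum>x\<in>{1..L}. N x) / 2 - real k \<and> (\<exists>g\<in>hw L N (int k). g \<noteq> 0 \<and> ham L N J g = e *\<^sub>R g)"
proof -
  obtain c where c: "coef f c \<noteq> 0" using f(2) by (auto simp: vec_eq_iff)
  define d where "d = (\<Sum>x\<in>{1..L}. c x)"
  define h where "h = component L (int d) f"
  have "coef h c \<noteq> 0" using c by (simp add: h_def component_def d_def)
  then have "h \<noteq> 0" by auto
  moreover have "cas L N h = (S * (S + 1)) *\<^sub>R h"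
    using component_commute[OF linear_cas homog_cas f(1), of "int d" N] f(3)
    by (simp add: h_def linear_scale[OF linear_component])
  moreover have "ham L N J h = e *\<^sub>R h"
    using component_commute[OF linear_ham homog_ham f(1), of "int d" N J] f(4)
    by (simp add: h_def linear_scale[OF linear_component])
  ultimately show ?thesis
    using S f(1) by (intro highest_weight_homog[of L d h N S J e]) (auto simp: h_def homog_component supp_component)
qed

section \<open>Ladder form of the spin matrices\<close>

definition splus :: "nat \<Rightarrow> (nat \<Rightarrow> nat) \<Rightarrow> nat \<Rightarrow> state \<Rightarrow> state" where
  "splus L N x v = (\<lambda>c. if c \<in> conf L N then (\<Sum>b\<in>{..N x}. spin_plus (N x) (c x) b * v (c(x := b))) else 0)"

definition sminus :: "nat \<Rightarrow> (nat \<Rightarrow> nat) \<Rightarrow> nat \<Rightarrow> state \<Rightarrow> state" where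
  "sminus L N x v = (\<lambda>c. if c \<in> conf L N then (\<Sum>b\<in>{..N x}. spin_minus (N x) (c x) b * v (c(x := b))) else 0)"

lemma site_op_1: "site_op L N 1 x v = (\<lambda>c. (splus L N x v c + sminus L N x v c) / 2)"
  by (auto simp: fun_eq_iff site_op_def spin_mat_def splus_def sminus_def sum.distrib
      add_divide_distrib sum_divide_distrib algebra_simps)

lemma site_op_2: "site_op L N 2 x v = (\<lambda>c. (splus L N x v c - sminus L N x v c) / (2 * \<i>))"
  by (auto simp: fun_eq_iff site_op_def spin_mat_def splus_def sminus_def sum_subtractf
      diff_divide_distrib sum_divide_distrib algebra_simps)

lemma splus_lin:
  "splus L N x (\<lambda>c. a * u c + b * w c) = (\<lambda>c. a * splus L N x u c + b * splus L N x w c)"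
  by (auto simp: fun_eq_iff splus_def sum.distrib sum_distrib_left algebra_simps)

lemma sminus_lin:
  "sminus L N x (\<lambda>c. a * u c + b * w c) = (\<lambda>c. a * sminus L N x u c + b * sminus L N x w c)"
  by (auto simp: fun_eq_iff sminus_def sum.distrib sum_distrib_left algebra_simps)

text \<open>The products of two raising or of two lowering operators cancel between the two
  directions.\<close>

lemma site_op_12:
  "site_op L N 1 x (site_op L N 1 y v) c + site_op L N 2 x (site_op L N 2 y v) c
    = (splus L N x (sminus L N y v) c + sminus L N x (splus L N y v) c) / 2"
proof -
  have 1: "site_op L N 1 y v = (\<lambda>c. (1 / 2) * splus L N y v c + (1 / 2) * sminus L N y v c)"
    unfolding site_op_1 by (simp add: fun_eq_iff field_simps)
  have 2: "site_op L N 2 y v = (\<lambda>c. (1 / (2 * \<i>)) * splus L N y v c + (- 1 / (2 * \<i>)) * sminus L N y v c)"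
    unfolding site_op_2 by (simp add: fun_eq_iff field_simps)
  have 11: "site_op L N 1 x (site_op L N 1 y v) c
     = ((1/2) * splus L N x (splus L N y v) c + (1/2) * splus L N x (sminus L N y v) c
        + ((1/2) * sminus L N x (splus L N y v) c + (1/2) * sminus L N x (sminus L N y v) c)) / 2"
    unfolding 1 unfolding site_op_1 splus_lin sminus_lin ..
  have "site_op L N 2 x (site_op L N 2 y v) c
     = ((1 / (2 * \<i>)) * splus L N x (splus L N y v) c + (- 1 / (2 * \<i>)) * splus L N x (sminus L N y v) c
        - ((1 / (2 * \<i>)) * sminus L N x (splus L N y v) c + (- 1 / (2 * \<i>)) * sminus L N x (sminus L N y v) c)) / (2 * \<i>)"
    unfolding 2 unfolding site_op_2 splus_lin sminus_lin ..
  moreover have "((1 / (2 * \<i>)) * p + (- 1 / (2 * \<i>)) * q - ((1 / (2 * \<i>)) * s + (- 1 / (2 * \<i>)) * t)) / (2 * \<i>)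
      = (q + s - p - t) / 4" for p q s t :: complex
    by (simp add: complex_eq_iff Re_divide Im_divide power2_eq_square, simp add: field_simps)
  ultimately have "site_op L N 2 x (site_op L N 2 y v) c
      = (splus L N x (sminus L N y v) c + sminus L N x (splus L N y v) c
         - splus L N x (splus L N y v) c - sminus L N x (sminus L N y v) c) / 4"
    by presburger
  then show ?thesis unfolding 11 by (elim ssubst) (simp add: field_simps)
qed

lemma spin_dot_ladder:
  "spin_dot L N x y v c = (splus L N x (sminus L N y v) c + sminus L N x (splus L N y v) c) / 2
     + site_op L N 3 x (site_op L N 3 y v) c"
  using site_op_12[of L N x y v c] by (simp add: spin_dot_def add.assoc)

lemma site_op_3:
  assumes "x \<in> {1..L}" "in_space L N v"
  shows "site_op L N 3 x v = (\<lambda>c. complex_of_real (real (N x) / 2 - real (c x)) * v c)"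
proof
  fix c
  show "site_op L N 3 x v c = complex_of_real (real (N x) / 2 - real (c x)) * v c"
  proof (cases "c \<in> conf L N")
    case True
    then have cx: "c x \<in> {..N x}" using assms(1) by (auto simp: conf_def)
    have "site_op L N 3 x v c = (\<Sum>b\<in>{..N x}. spin_mat (N x) 3 (c x) b * v (c(x := b)))"
      using True by (simp add: site_op_def)
    also have "\<dots> = (\<Sum>b\<in>{..N x}. if b = c x then complex_of_real (real (N x) / 2 - real b) * v (c(x := b)) else 0)"
      by (rule sum.cong) (auto simp: spin_mat_def)
    also have "\<dots> = complex_of_real (real (N x) / 2 - real (c x)) * v (c(x := c x))"
      using cx by (subst sum.delta) auto
    finally show ?thesis by simp
  next
    case False
    then show ?thesis using assms(2) by (simp add: site_op_def in_space_def)
  qed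
qed

lemma splus_apply:
  assumes x: "x \<in> {1..L}" and v: "in_space L N v" and c: "c \<in> conf L N"
  shows "splus L N x v c = complex_of_real (sqrt (real (Suc (c x)) * (real (N x) - real (c x)))) * v (c(x := Suc (c x)))"
proof -
  have "spin_plus (N x) (c x) b * v (c(x := b))
      = (if b = Suc (c x) then complex_of_real (sqrt (real (Suc (c x)) * (real (N x) - real (c x)))) * v (c(x := Suc (c x))) else 0)" for b
  proof (cases "b = Suc (c x)")
    case True
    have "real (N x) / 2 * (real (N x) / 2 + 1) - (real (N x) / 2 - real b) * (real (N x) / 2 - real b + 1)
       = real (Suc (c x)) * (real (N x) - real (c x))"
      using True by (simp add: field_simps)
    then show ?thesis using True by (simp add: spin_plus_def Let_def)
  qed (auto simp: spin_plus_def Let_def)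
  then have "splus L N x v c = (if Suc (c x) \<le> N x
      then complex_of_real (sqrt (real (Suc (c x)) * (real (N x) - real (c x)))) * v (c(x := Suc (c x))) else 0)"
    using c by (simp add: splus_def sum.delta)
  moreover have "v (c(x := Suc (c x))) = 0" if "\<not> Suc (c x) \<le> N x"
    using that v conf_Suc_iff[OF x, of c N] by (auto simp: in_space_def)
  ultimately show ?thesis by auto
qed

lemma sminus_apply:
  assumes x: "x \<in> {1..L}" and c: "c \<in> conf L N"
  shows "sminus L N x v c = (if c x = 0 then 0 else
    complex_of_real (sqrt (real (c x) * (real (N x) - real (c x - 1)))) * v (c(x := c x - 1)))"
proof -
  have "spin_minus (N x) (c x) b * v (c(x := b))
      = (if b = c x - 1 then (if c x = 0 then 0 else
          complex_of_real (sqrt (real (c x) * (real (N x) - real (c x - 1)))) * v (c(x := c x - 1))) else 0)" for b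
  proof (cases "c x = Suc b")
    case True
    have "real (N x) / 2 * (real (N x) / 2 + 1) - (real (N x) / 2 - real b) * (real (N x) / 2 - real b - 1)
       = real (c x) * (real (N x) - real (c x - 1))"
      using True by (simp add: field_simps)
    then show ?thesis using True by (simp add: spin_minus_def Let_def)
  qed (auto simp: spin_minus_def Let_def)
  moreover have "c x - 1 \<le> N x" using x c by (auto simp: conf_def intro: order.trans[OF diff_le_self])
  ultimately show ?thesis using c by (simp add: sminus_def sum.delta)
qed

text \<open>Every operator involved has real matrix elements in the basis of the \<open>S\<^sup>3\<close>-eigenvectors, so the real and the
  imaginary part of a state are treated separately. Dividing by the square root of the weight turns the
  normalised spin matrices into the differential operators above.\<close>

definition part :: "(complex \<Rightarrow> real) \<Rightarrow> bool" where
  "part r \<longleftrightarrow> r = Re \<or> r = Im"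

lemma part_simps:
  assumes "part r"
  shows "r 0 = 0" "r (z + w) = r z + r w" "r (z - w) = r z - r w" "r (- z) = - r z"
    "r (complex_of_real t * z) = t * r z" "r (z / 2) = r z / 2" "r (sum g A) = (\<Sum>i\<in>A. r (g i))"
  using assms by (auto simp: part_def)

definition cf :: "nat \<Rightarrow> (nat \<Rightarrow> nat) \<Rightarrow> (complex \<Rightarrow> real) \<Rightarrow> state \<Rightarrow> pol" where
  "cf L N r v = Vec (\<lambda>c. r (v c) / sqrt (wt L N c))"

lemma coef_cf: "coef (cf L N r v) c = r (v c) / sqrt (wt L N c)"
  by (simp add: cf_def)

lemma wt_pos: "c \<in> conf L N \<Longrightarrow> 0 < wt L N c"
  using finite_weights.w_pos[OF finite_weights_conf] .

lemma cf_supp: "part r \<Longrightarrow> in_space L N v \<Longrightarrow> cf L N r v \<in> chain.supp L N"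
  by (auto simp: chain_supp_iff coef_cf in_space_def part_simps)

lemma in_space_ops:
  "in_space L N (splus L N x v)" "in_space L N (sminus L N x v)" "in_space L N (site_op L N i x v)"
  by (auto simp: in_space_def splus_def sminus_def site_op_def)

text \<open>Converts the square-root matrix elements of the normalised basis into the rational ones
  of the monomials; the hypothesis has the shape of \<open>wt_Suc\<close>.\<close>

lemma sqrt_ratio:
  fixes a b w w' :: real
  assumes "w * a = w' * b" "0 < w" "0 < w'" "0 < a"
  shows "sqrt (a * b) / sqrt w = a / sqrt w'"
proof -
  have "sqrt (a * b) * sqrt w' = sqrt (a * (w' * b))" by (simp add: real_sqrt_mult[symmetric] mult_ac)
  also have "\<dots> = sqrt (a\<^sup>2 * w)" using assms(1) by (simp add: power2_eq_square mult_ac)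
  also have "\<dots> = a * sqrt w" using assms(4) by (simp add: real_sqrt_mult)
  finally show ?thesis using assms by (simp add: field_simps)
qed

lemma cf_splus:
  assumes r: "part r" and x: "x \<in> {1..L}" and v: "in_space L N v"
  shows "cf L N r (splus L N x v) = pd x (cf L N r v)"
  unfolding vec_eq_iff
proof
  fix c
  show "coef (cf L N r (splus L N x v)) c = coef (pd x (cf L N r v)) c"
  proof (cases "c \<in> conf L N \<and> c x < N x")
    case True
    then have c: "c \<in> conf L N" "c x < N x" by auto
    then have c': "c(x := Suc (c x)) \<in> conf L N" using conf_Suc_iff[OF x] by blast
    let ?w = "wt L N c" and ?w' = "wt L N (c(x := Suc (c x)))" and ?a = "real (Suc (c x))"
      and ?b = "real (N x) - real (c x)"
    have pos: "?w > 0" "?w' > 0" "?a > 0" "?b > 0" using wt_pos c c' by auto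
    have ratio: "sqrt (?a * ?b) / sqrt ?w = ?a / sqrt ?w'"
      using sqrt_ratio[of ?w ?a ?w' ?b] wt_Suc[of x L c N] x c pos by simp
    have "coef (cf L N r (splus L N x v)) c = sqrt (?a * ?b) * r (v (c(x := Suc (c x)))) / sqrt ?w"
      by (simp only: coef_cf splus_apply[OF x v c(1)] part_simps(5)[OF r])
    also have "\<dots> = (sqrt (?a * ?b) / sqrt ?w) * r (v (c(x := Suc (c x))))" by (rule times_divide_eq_left[symmetric])
    also have "\<dots> = coef (pd x (cf L N r v)) c" unfolding ratio coef_pd coef_cf by simp
    finally show ?thesis .
  next
    case False
    then have "c(x := Suc (c x)) \<notin> conf L N" using conf_Suc_iff[OF x] by blast
    then have z: "v (c(x := Suc (c x))) = 0" using v by (simp add: in_space_def)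
    then have "splus L N x v c = 0"
      using splus_apply[OF x v, of c] by (cases "c \<in> conf L N") (auto simp: splus_def)
    then show ?thesis using r z by (simp add: coef_cf coef_pd part_simps)
  qed
qed

lemma cf_sminus:
  assumes r: "part r" and x: "x \<in> {1..L}" and v: "in_space L N v"
  shows "cf L N r (sminus L N x v) = smin N x (cf L N r v)"
  unfolding vec_eq_iff
proof
  fix c
  show "coef (cf L N r (sminus L N x v)) c = coef (smin N x (cf L N r v)) c"
  proof (cases "c \<in> conf L N")
    case True
    show ?thesis
    proof (cases "c x = 0")
      case False
      define d where "d = c(x := c x - 1)"
      have cd: "c = d(x := Suc (d x))" "c x = Suc (d x)" using False by (auto simp: d_def)
      then have d: "d \<in> conf L N" "d x < N x" using True conf_Suc_iff[OF x, of d N] by auto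
      let ?w = "wt L N d" and ?w' = "wt L N c" and ?a = "real (Suc (d x))" and ?b = "real (N x) - real (d x)"
      have pos: "?w > 0" "?w' > 0" "?a > 0" "?b > 0" using wt_pos d True by auto
      have ratio: "sqrt (?b * ?a) / sqrt ?w' = ?b / sqrt ?w"
        using sqrt_ratio[of ?w' ?b ?w ?a] wt_Suc[of x L d N, OF x d(2), folded cd(1)] pos by simp
      have "sminus L N x v c = complex_of_real (sqrt (?a * ?b)) * v d"
        using sminus_apply[OF x True, of v] False by (simp add: d_def del: of_nat_Suc)
      then have "coef (cf L N r (sminus L N x v)) c = sqrt (?a * ?b) * r (v d) / sqrt ?w'"
        by (simp only: coef_cf part_simps(5)[OF r])
      also have "\<dots> = (sqrt (?b * ?a) / sqrt ?w') * r (v d)" by (simp add: mult.commute)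
      also have "\<dots> = coef (smin N x (cf L N r v)) c"
        unfolding ratio coef_smin coef_cf using False by (simp add: d_def)
      finally show ?thesis .
    qed (use sminus_apply[OF x True, of v] r in \<open>simp add: coef_cf coef_smin part_simps\<close>)
  next
    case False
    have "smin N x (cf L N r v) \<in> chain.supp L N" using cf_supp[OF r v] x by (rule supp_smin)
    then show ?thesis using False r by (simp add: chain_supp_iff coef_cf sminus_def part_simps)
  qed
qed

lemma cf_sz:
  assumes "part r" "x \<in> {1..L}" "in_space L N v"
  shows "cf L N r (site_op L N 3 x v) = sz N x (cf L N r v)"
proof -
  have "r (site_op L N 3 x v c) = (real (N x) / 2 - real (c x)) * r (v c)" for c
    by (simp only: site_op_3[OF assms(2,3)] part_simps(5)[OF assms(1)])
  then show ?thesis by (simp add: vec_eq_iff coef_cf coef_sz)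
qed

lemma cf_spin_dot:
  assumes r: "part r" and x: "x \<in> {1..<L}" and v: "in_space L N v"
  shows "cf L N r (spin_dot L N x (Suc x) v)
    = (1 / 2) *\<^sub>R bond N x (cf L N r v) + (real (N x) * real (N (Suc x)) / 4) *\<^sub>R cf L N r v"
proof -
  have xs: "x \<in> {1..L}" "Suc x \<in> {1..L}" using x by auto
  have "cf L N r (spin_dot L N x (Suc x) v)
     = (1 / 2) *\<^sub>R (cf L N r (splus L N x (sminus L N (Suc x) v)) + cf L N r (sminus L N x (splus L N (Suc x) v)))
       + cf L N r (site_op L N 3 x (site_op L N 3 (Suc x) v))"
    using r by (simp add: vec_eq_iff coef_cf spin_dot_ladder part_simps add_divide_distrib)
  also have "\<dots> = (1 / 2) *\<^sub>R (pd x (smin N (Suc x) (cf L N r v)) + smin N x (pd (Suc x) (cf L N r v)))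
       + sz N x (sz N (Suc x) (cf L N r v))"
    using r xs v by (simp add: cf_splus cf_sminus cf_sz in_space_ops)
  finally show ?thesis unfolding bond_spin by (simp add: pd_smin algebra_simps)
qed

text \<open>1 / (s s') = 4 / (N N') gives half a bond the factor 2 / (N N') and makes the constant N
  N' / 4 of \<open>cf_spin_dot\<close> cancel the -1. At an empty site x / 0 = 0 would spoil the
  cancellation, whence the condition on \<open>N\<close>.\<close>

lemma cf_hamiltonian:
  assumes r: "part r" and n: "\<forall>x\<in>{1..L}. N x \<ge> 1" and v: "in_space L N v"
  shows "cf L N r (hamiltonian L N J v) = ham L N J (cf L N r v)"
proof -
  have term_eq: "J x *\<^sub>R ((4 / (real (N x) * real (N (Suc x)))) *\<^sub>R cf L N r (spin_dot L N x (Suc x) v) - cf L N r v)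
     = (2 * J x / (real (N x) * real (N (Suc x)))) *\<^sub>R bond N x (cf L N r v)" if x: "x \<in> {1..<L}" for x
  proof -
    have "N x \<noteq> 0" "N (Suc x) \<noteq> 0" using bspec[OF n, of x] bspec[OF n, of "Suc x"] x by auto
    then show ?thesis unfolding cf_spin_dot[OF r x v] by (simp add: vec_eq_iff field_simps)
  qed
  have "cf L N r (hamiltonian L N J v)
     = - (\<Sum>x\<in>{1..<L}. J x *\<^sub>R ((4 / (real (N x) * real (N (Suc x)))) *\<^sub>R cf L N r (spin_dot L N x (Suc x) v) - cf L N r v))"
  proof -
    have "r (hamiltonian L N J v c)
      = - (\<Sum>x\<in>{1..<L}. J x * (1 / ((real (N x) / 2) * (real (N (x + 1)) / 2)) * r (spin_dot L N x (x + 1) v c) - r (v c)))" for c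
      by (simp only: hamiltonian_def part_simps[OF r])
    then show ?thesis
      by (simp add: vec_eq_iff coef_cf sum_divide_distrib diff_divide_distrib algebra_simps)
  qed
  then show ?thesis unfolding ham_def using term_eq by simp
qed

lemma total_spin_sum:
  "total_spin L N i (total_spin L N i v) c = (\<Sum>x\<in>{1..L}. \<Sum>y\<in>{1..L}. site_op L N i x (site_op L N i y v) c)"
proof -
  have "site_op L N i x (\<lambda>c. \<Sum>y\<in>{1..L}. site_op L N i y v c) c = (\<Sum>y\<in>{1..L}. site_op L N i x (site_op L N i y v) c)" for x
  proof (cases "c \<in> conf L N")
    case True
    then show ?thesis
      unfolding site_op_def[of L N i x] by (simp add: sum_distrib_left) (rule sum.swap)
  qed (simp add: site_op_def[of L N i x])
  then show ?thesis by (simp add: total_spin_def)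
qed

lemma cf_casimir:
  assumes r: "part r" and v: "in_space L N v"
  shows "cf L N r (casimir L N v) = cas L N (cf L N r v)"
proof -
  let ?f = "cf L N r v"
  have "casimir L N v c = (\<Sum>x\<in>{1..L}. \<Sum>y\<in>{1..L}. spin_dot L N x y v c)" for c
    by (simp add: casimir_def total_spin_sum spin_dot_def sum.distrib)
  then have "cf L N r (casimir L N v) = (\<Sum>x\<in>{1..L}. \<Sum>y\<in>{1..L}. cf L N r (spin_dot L N x y v))"
    using r by (simp add: vec_eq_iff coef_cf part_simps sum_divide_distrib)
  also have "\<dots> = (\<Sum>x\<in>{1..L}. \<Sum>y\<in>{1..L}.
      (1 / 2) *\<^sub>R (pd x (smin N y ?f) + smin N x (pd y ?f)) + sz N x (sz N y ?f))"
  proof (intro sum.cong refl)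
    fix x y assume xy: "x \<in> {1..L}" "y \<in> {1..L}"
    have "cf L N r (spin_dot L N x y v)
       = (1 / 2) *\<^sub>R (cf L N r (splus L N x (sminus L N y v)) + cf L N r (sminus L N x (splus L N y v)))
         + cf L N r (site_op L N 3 x (site_op L N 3 y v))"
      using r by (simp add: vec_eq_iff coef_cf spin_dot_ladder part_simps add_divide_distrib)
    then show "cf L N r (spin_dot L N x y v)
      = (1 / 2) *\<^sub>R (pd x (smin N y ?f) + smin N x (pd y ?f)) + sz N x (sz N y ?f)"
      using r xy v by (simp add: cf_splus cf_sminus cf_sz in_space_ops)
  qed
  also have "\<dots> = (1 / 2) *\<^sub>R ((\<Sum>x\<in>{1..L}. pd x (\<Sum>y\<in>{1..L}. smin N y ?f))
      + (\<Sum>x\<in>{1..L}. smin N x (\<Sum>y\<in>{1..L}. pd y ?f))) + (\<Sum>x\<in>{1..L}. \<Sum>y\<in>{1..L}. sz N x (sz N y ?f))"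
    by (simp only: op_simps smin_simps sum.distrib scaleR_sum_right scaleR_add_right)
  also have "(\<Sum>x\<in>{1..L}. \<Sum>y\<in>{1..L}. sz N x (sz N y ?f)) = sztot L N (sztot L N ?f)"
    by (simp add: vec_eq_iff sztot_def coef_sz sum_distrib_left)
  finally show ?thesis by (simp add: cas_def dtot_def smintot_def)
qed

lemma cf_scale: "part r \<Longrightarrow> cf L N r (\<lambda>c. complex_of_real e * v c) = e *\<^sub>R cf L N r v"
  by (simp add: vec_eq_iff coef_cf part_simps)

section \<open>Energies of the spin spaces in the polynomial model\<close>

lemma state_eqI:
  assumes "in_space L N u" "in_space L N v" "cf L N Re u = cf L N Re v" "cf L N Im u = cf L N Im v"
  shows "u = v"
proof
  fix c
  show "u c = v c"
  proof (cases "c \<in> conf L N")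
    case True
    have "Re (u c) / sqrt (wt L N c) = Re (v c) / sqrt (wt L N c)"
      "Im (u c) / sqrt (wt L N c) = Im (v c) / sqrt (wt L N c)"
      using assms(3,4) by (metis coef_cf)+
    then show ?thesis using wt_pos[OF True] by (simp add: complex_eq_iff)
  qed (use assms in \<open>simp add: in_space_def\<close>)
qed

lemma in_space_hamiltonian: "in_space L N v \<Longrightarrow> in_space L N (hamiltonian L N J v)"
  by (auto simp: in_space_def hamiltonian_def spin_dot_def site_op_def)

lemma in_space_casimir: "in_space L N (casimir L N v)"
  by (auto simp: in_space_def casimir_def total_spin_def site_op_def)

lemma spin_space_highest_weight:
  assumes n: "\<forall>x\<in>{1..L}. N x \<ge> 1" and v: "v \<in> spin_space L N S" "v \<noteq> (\<lambda>c. 0)"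
    and H: "hamiltonian L N J v = (\<lambda>c. complex_of_real e * v c)" and S: "0 \<le> S"
  shows "\<exists>k. S = real (\<Sum>x\<in>{1..L}. N x) / 2 - real k \<and> (\<exists>g\<in>hw L N (int k). g \<noteq> 0 \<and> ham L N J g = e *\<^sub>R g)"
proof -
  have vs: "in_space L N v" "casimir L N v = (\<lambda>c. complex_of_real (S * (S + 1)) * v c)"
    using v by (auto simp: spin_space_def)
  have zero: "in_space L N (\<lambda>c. 0)" "cf L N r (\<lambda>c. 0) = 0" if "part r" for r
    using that by (auto simp: in_space_def vec_eq_iff coef_cf part_simps)
  have "\<exists>r. part r \<and> cf L N r v \<noteq> 0"
  proof (rule ccontr)
    assume "\<not> ?thesis"
    then have "cf L N Re v = 0" "cf L N Im v = 0" by (auto simp: part_def)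
    then have "v = (\<lambda>c. 0)" using zero vs(1) by (intro state_eqI) (auto simp: part_def)
    then show False using v by simp
  qed
  then obtain r where r: "part r" "cf L N r v \<noteq> 0" by blast
  show ?thesis
  proof (rule highest_weight[OF cf_supp[OF r(1) vs(1)] r(2) _ _ S])
    show "cas L N (cf L N r v) = (S * (S + 1)) *\<^sub>R cf L N r v"
      using cf_casimir[OF r(1) vs(1)] vs(2) cf_scale[OF r(1)] by metis
    show "ham L N J (cf L N r v) = e *\<^sub>R cf L N r v"
      using cf_hamiltonian[OF r(1) n vs(1), of J] H cf_scale[OF r(1)] by metis
  qed
qed

text \<open>Undoing the normalisation of \<open>cf\<close> gives a real state, for which the
  imaginary parts of both eigenvalue equations are trivial.\<close>

lemma highest_weight_spin_space:
  assumes n: "\<forall>x\<in>{1..L}. N x \<ge> 1" and g: "g \<in> hw L N (int k)" "g \<noteq> 0" "ham L N J g = e *\<^sub>R g"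
    and S: "S = real (\<Sum>x\<in>{1..L}. N x) / 2 - real k"
  shows "\<exists>v\<in>spin_space L N S. v \<noteq> (\<lambda>c. 0) \<and> hamiltonian L N J v = (\<lambda>c. complex_of_real e * v c)"
proof -
  define v where "v = (\<lambda>c. complex_of_real (sqrt (wt L N c) * coef g c))"
  have gs: "g \<in> chain.supp L N" "homog L (int k) g" "dtot L g = 0" using g by (auto simp: hw_def)
  have v: "in_space L N v" using gs(1) by (auto simp: in_space_def v_def chain_supp_iff)
  have Re: "cf L N Re v = g"
  proof -
    have "coef (cf L N Re v) c = coef g c" for c
    proof (cases "c \<in> conf L N")
      case True
      then show ?thesis using wt_pos[OF True] by (simp add: coef_cf v_def)
    next
      case False
      then show ?thesis using gs(1) by (simp add: coef_cf v_def chain_supp_iff)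
    qed
    then show ?thesis by (simp add: vec_eq_iff)
  qed
  have Im: "cf L N Im v = 0" by (simp add: vec_eq_iff coef_cf v_def)
  have p: "part Re" "part Im" by (simp_all add: part_def)
  have scaled: "in_space L N (\<lambda>c. complex_of_real a * v c)" for a using v by (simp add: in_space_def)
  have "cas L N g = (S * (S + 1)) *\<^sub>R g"
    using cas_homog[OF gs(2), of N] gs(3) by (simp add: tot_simps S)
  then have "casimir L N v = (\<lambda>c. complex_of_real (S * (S + 1)) * v c)"
    by (intro state_eqI[of L N] in_space_casimir scaled v)
      (simp_all only: cf_casimir[OF p(1) v] cf_casimir[OF p(2) v] cf_scale[OF p(1)] cf_scale[OF p(2)] Re Im
        linear_0[OF linear_cas] scaleR_zero_right)
  moreover have "hamiltonian L N J v = (\<lambda>c. complex_of_real e * v c)"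
    by (intro state_eqI[of L N] in_space_hamiltonian scaled v)
      (simp_all only: cf_hamiltonian[OF p(1) n v] cf_hamiltonian[OF p(2) n v] cf_scale[OF p(1)] cf_scale[OF p(2)] Re Im
        linear_0[OF linear_ham] scaleR_zero_right g(3))
  moreover have "v \<noteq> (\<lambda>c. 0)"
  proof
    assume "v = (\<lambda>c. 0)"
    then have "cf L N Re v = 0" by (simp add: vec_eq_iff coef_cf)
    then show False using Re g(2) by simp
  qed
  ultimately show ?thesis using v by (auto simp: spin_space_def)
qed

lemma energy_gse:
  assumes n: "\<forall>x\<in>{1..L}. N x \<ge> 1" and S: "0 \<le> S" "spin_space L N S \<noteq> {\<lambda>c. 0}"
  shows "\<exists>k. S = real (\<Sum>x\<in>{1..L}. N x) / 2 - real k \<and> gse L N J (int k) (energy L N (hamiltonian L N J) S)"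
proof -
  have "(\<lambda>c. 0) \<in> spin_space L N S"
    by (simp add: spin_space_def in_space_def casimir_def total_spin_def site_op_def cong: if_cong)
  then obtain v where v: "v \<in> spin_space L N S" "v \<noteq> (\<lambda>c. 0)" using S(2) by blast
  \<comment> \<open>With all couplings 0 every state is an eigenvector, so the degree k belonging to
    S is obtained before any eigenvalue is known.\<close>
  have "hamiltonian L N (\<lambda>_. 0) v = (\<lambda>c. complex_of_real 0 * v c)"
    by (simp add: hamiltonian_def)
  then obtain k g where k: "S = real (\<Sum>x\<in>{1..L}. N x) / 2 - real k" and g: "g \<in> hw L N (int k)" "g \<noteq> 0"
    using spin_space_highest_weight[OF n v _ S(1)] by blast
  obtain e where e: "gse L N J (int k) e" using gse_exists[OF g] by blast
  have "energy L N (hamiltonian L N J) S = e"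
    unfolding energy_def
  proof (rule cInf_eq_minimum)
    show "e \<in> {e. \<exists>v\<in>spin_space L N S. v \<noteq> (\<lambda>c. 0) \<and> hamiltonian L N J v = (\<lambda>c. complex_of_real e * v c)}"
      using e highest_weight_spin_space[OF n _ _ _ k] unfolding gse_def by blast
    fix e' assume "e' \<in> {e. \<exists>v\<in>spin_space L N S. v \<noteq> (\<lambda>c. 0) \<and> hamiltonian L N J v = (\<lambda>c. complex_of_real e * v c)}"
    then obtain k' g' where k': "S = real (\<Sum>x\<in>{1..L}. N x) / 2 - real k'"
      and g': "g' \<in> hw L N (int k')" "g' \<noteq> 0" "ham L N J g' = e' *\<^sub>R g'"
      using spin_space_highest_weight[OF n _ _ _ S(1)] by blast
    have "k' = k" using k k' by simp
    then show "e \<le> e'" using gse_le[OF e] g' by simp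
  qed
  then show ?thesis using k e by blast
qed

theorem theorem1:
  fixes L :: nat and n :: "nat \<Rightarrow> nat" and J :: "nat \<Rightarrow> real"
  assumes "L \<ge> 1"
    and "\<forall>x\<in>{1..L}. n x \<ge> 1"
    and "\<forall>x\<in>{1..<L}. J x > 0"
  shows "FOEL L n (hamiltonian L n J)"
  unfolding FOEL_def
proof (intro allI impI)
  fix S S' assume SS: "0 \<le> S' \<and> S' < S \<and> spin_space L n S \<noteq> {\<lambda>c. 0} \<and> spin_space L n S' \<noteq> {\<lambda>c. 0}"
  obtain k where k: "S = real (\<Sum>x\<in>{1..L}. n x) / 2 - real k"
      "gse L n J (int k) (energy L n (hamiltonian L n J) S)"
    using energy_gse[OF assms(2), of S J] SS by auto
  obtain k' where k': "S' = real (\<Sum>x\<in>{1..L}. n x) / 2 - real k'"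
      "gse L n J (int k') (energy L n (hamiltonian L n J) S')"
    using energy_gse[OF assms(2), of S' J] SS by auto
  \<comment> \<open>All sites of the given chain are occupied; empty ones arise only in the
    induction.\<close>
  have "left_packed L L n" using assms(2) by (simp add: left_packed_def)
  moreover have "k < k'" using SS k(1) k'(1) by simp
  ultimately show "energy L n (hamiltonian L n J) S < energy L n (hamiltonian L n J) S'"
    using levels_increasing[OF assms(3)] k(2) k'(2) by blast
qed

end
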